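(* Let $R$ be a simple root system of rank $n$ and let $R^+\subset R$ be a choice of positive roots. The minimal cocardinality $|R^+\setminus S|$ of a balanced (thus well-balanced) subset $S\subset R^+$ (that is, the minimum of $|R^+\setminus S|$ over all balanced subsets $S$, which is also the minimum over all well-balanced subsets $S$) is the following, according to the Dynkin type of $R$: \begin{itemize} \item $\mathrm{A}_n$: $0$ if $n=4k$; $2k+1$ if $n=4k+1$; $0$ if $n=4k+2$; $2k+2$ if $n=4k+3$. \item $\mathrm{B}_n$: $2k$ if $n=4k$; $2k+1$ if $n=4k+1$; $2k+1$ if $n=4k+2$; $2k+2$ if $n=4k+3$. \item $\mathrm{C}_n$: $0$ if $n=4k$; $1$ if $n=4k+1$; $1$ if $n=4k+2$; $0$ if $n=4k+3$. \item $\mathrm{D}_n$: $0$ if $n=4k$; $0$ if $n=4k+1$; $2$ if $n=4k+2$; $2$ if $n=4k+3$. \item $\mathrm{E}_6$: $0$; $\mathrm{E}_7$: $3$; $\mathrm{E}_8$: $0$; $\mathrm{F}_4$: $0$; $\mathrm{G}_2$: $0$. \end{itemize} Here $k\ge 0$ is an integer.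
   Context: Root systems are finite, reduced and crystallographic; "simple root system" means irreducible root system, and the types are the usual Dynkin types ($\mathrm{A}_n$ with $n\ge1$, $\mathrm{B}_n$ and $\mathrm{C}_n$ with $n\ge2$, $\mathrm{D}_n$ with $n\ge3$, and $\mathrm{E}_6,\mathrm{E}_7,\mathrm{E}_8,\mathrm{F}_4,\mathrm{G}_2$). Let $R$ be a root system and $R^+\subset R$ a choice of positive roots. A subset $S\subset R^+$ is called: (i) balanced if there exist signs $s_\alpha\in\{+1,-1\}$, $\alpha\in S$, such that $\sum_{\alpha\in S}s_\alpha\alpha=0$ (the empty set is balanced); (ii) strongly orthogonal if for any two elements $\alpha,\beta\in S$, neither $\alpha+\beta$ nor $\alpha-\beta$ is a root; (iii) well-balanced if $S$ is balanced and $R^+\setminus S$ is strongly orthogonal. The cocardinality of $S\subset R^+$ is $|R^+\setminus S|$. *)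

theory Defs
  imports "HOL-Analysis.Analysis"
begin

definition reflection :: "'a::euclidean_space \<Rightarrow> 'a \<Rightarrow> 'a" where
  "reflection \<alpha> \<beta> = \<beta> - (2 * (\<beta> \<bullet> \<alpha>) / (\<alpha> \<bullet> \<alpha>)) *\<^sub>R \<alpha>"

definition cartan_number :: "'a::euclidean_space \<Rightarrow> 'a \<Rightarrow> real" where
  "cartan_number \<alpha> \<beta> = 2 * (\<alpha> \<bullet> \<beta>) / (\<beta> \<bullet> \<beta>)"

text \<open>Root systems are finite, crystallographic and reduced. A root system lives in its own linear
  span, which may be a proper subspace of the ambient type; accordingly its rank is \<^term>\<open>dim R\<close>.\<close>

definition root_system :: "'a::euclidean_space set \<Rightarrow> bool" where
  "root_system R \<longleftrightarrow>
     finite R \<and> 0 \<notin> R \<and>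
     (\<forall>\<alpha>\<in>R. reflection \<alpha> ` R = R) \<and>
     (\<forall>\<alpha>\<in>R. \<forall>\<beta>\<in>R. cartan_number \<alpha> \<beta> \<in> \<int>) \<and>
     (\<forall>\<alpha>\<in>R. \<forall>c::real. c *\<^sub>R \<alpha> \<in> R \<longrightarrow> c = 1 \<or> c = -1)"

definition irreducible_system :: "'a::euclidean_space set \<Rightarrow> bool" where
  "irreducible_system R \<longleftrightarrow>
     R \<noteq> {} \<and>
     \<not> (\<exists>R1 R2. R1 \<noteq> {} \<and> R2 \<noteq> {} \<and> R1 \<inter> R2 = {} \<and> R1 \<union> R2 = R \<and>
            (\<forall>\<alpha>\<in>R1. \<forall>\<beta>\<in>R2. \<alpha> \<bullet> \<beta> = 0))"

definition simple_root_system :: "'a::euclidean_space set \<Rightarrow> bool" where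
  "simple_root_system R \<longleftrightarrow> root_system R \<and> irreducible_system R"

definition positive_roots :: "'a::euclidean_space set \<Rightarrow> 'a set \<Rightarrow> bool" where
  "positive_roots R P \<longleftrightarrow>
     P \<subseteq> R \<and>
     (\<forall>\<alpha>\<in>R. \<alpha> \<in> P \<longleftrightarrow> - \<alpha> \<notin> P) \<and>
     (\<forall>\<alpha>\<in>P. \<forall>\<beta>\<in>P. \<alpha> + \<beta> \<in> R \<longrightarrow> \<alpha> + \<beta> \<in> P)"

definition root_base :: "'a::euclidean_space set \<Rightarrow> 'a set \<Rightarrow> bool" where
  "root_base R \<Delta> \<longleftrightarrow>
     \<Delta> \<subseteq> R \<and> independent \<Delta> \<and>
     (\<forall>\<beta>\<in>R. \<exists>c::'a \<Rightarrow> int. \<beta> = (\<Sum>\<alpha>\<in>\<Delta>. of_int (c \<alpha>) *\<^sub>R \<alpha>) \<and>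
            ((\<forall>\<alpha>\<in>\<Delta>. 0 \<le> c \<alpha>) \<or> (\<forall>\<alpha>\<in>\<Delta>. c \<alpha> \<le> 0)))"

datatype dynkin_type =
  TypeA nat | TypeB nat | TypeC nat | TypeD nat | TypeE6 | TypeE7 | TypeE8 | TypeF4 | TypeG2

fun dynkin_rank :: "dynkin_type \<Rightarrow> nat" where
  "dynkin_rank (TypeA n) = n"
| "dynkin_rank (TypeB n) = n"
| "dynkin_rank (TypeC n) = n"
| "dynkin_rank (TypeD n) = n"
| "dynkin_rank TypeE6 = 6"
| "dynkin_rank TypeE7 = 7"
| "dynkin_rank TypeE8 = 8"
| "dynkin_rank TypeF4 = 4"
| "dynkin_rank TypeG2 = 2"

fun admissible_type :: "dynkin_type \<Rightarrow> bool" where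
  "admissible_type (TypeA n) \<longleftrightarrow> n \<ge> 1"
| "admissible_type (TypeB n) \<longleftrightarrow> n \<ge> 2"
| "admissible_type (TypeC n) \<longleftrightarrow> n \<ge> 2"
| "admissible_type (TypeD n) \<longleftrightarrow> n \<ge> 3"
| "admissible_type _ \<longleftrightarrow> True"

text \<open>Dynkin diagrams have the vertices \<open>1, \<dots>, n\<close>, numbered as in Bourbaki. The entry at \<open>(i, j)\<close>
  of the Cartan matrix is \<open>2 (\<alpha>\<^sub>i, \<alpha>\<^sub>j) / (\<alpha>\<^sub>j, \<alpha>\<^sub>j)\<close>, so that an entry \<open>-2\<close> or \<open>-3\<close> at \<open>(i, j)\<close> means that
  \<open>\<alpha>\<^sub>i\<close> is longer than \<open>\<alpha>\<^sub>j\<close>: the last simple root is short in type B and long in type C.\<close>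

definition edges_cartan :: "nat set set \<Rightarrow> nat \<Rightarrow> nat \<Rightarrow> int" where
  "edges_cartan E i j = (if i = j then 2 else if {i, j} \<in> E then -1 else 0)"

definition path_edges :: "nat \<Rightarrow> nat \<Rightarrow> nat set set" where
  "path_edges a b = {{i, Suc i} | i. a \<le> i \<and> i < b}"

definition E_edges :: "nat \<Rightarrow> nat set set" where
  "E_edges n = {{1, 3}, {2, 4}} \<union> path_edges 3 n"

fun cartan_matrix :: "dynkin_type \<Rightarrow> nat \<Rightarrow> nat \<Rightarrow> int" where
  "cartan_matrix (TypeA n) i j = edges_cartan (path_edges 1 n) i j"
| "cartan_matrix (TypeB n) i j =
     (if i = n - 1 \<and> j = n then -2 else edges_cartan (path_edges 1 n) i j)"
| "cartan_matrix (TypeC n) i j =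
     (if i = n \<and> j = n - 1 then -2 else edges_cartan (path_edges 1 n) i j)"
| "cartan_matrix (TypeD n) i j = edges_cartan (path_edges 1 (n - 1) \<union> {{n - 2, n}}) i j"
| "cartan_matrix TypeE6 i j = edges_cartan (E_edges 6) i j"
| "cartan_matrix TypeE7 i j = edges_cartan (E_edges 7) i j"
| "cartan_matrix TypeE8 i j = edges_cartan (E_edges 8) i j"
| "cartan_matrix TypeF4 i j =
     (if i = 2 \<and> j = 3 then -2 else edges_cartan (path_edges 1 4) i j)"
| "cartan_matrix TypeG2 i j =
     (if i = 2 \<and> j = 1 then -3 else edges_cartan (path_edges 1 2) i j)"

definition has_dynkin_type :: "'a::euclidean_space set \<Rightarrow> dynkin_type \<Rightarrow> bool" where
  "has_dynkin_type R X \<longleftrightarrow>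
     admissible_type X \<and>
     (\<exists>\<alpha>::nat \<Rightarrow> 'a. inj_on \<alpha> {1..dynkin_rank X} \<and> root_base R (\<alpha> ` {1..dynkin_rank X}) \<and>
        (\<forall>i\<in>{1..dynkin_rank X}. \<forall>j\<in>{1..dynkin_rank X}.
            cartan_number (\<alpha> i) (\<alpha> j) = of_int (cartan_matrix X i j)))"

definition balanced :: "'a::euclidean_space set \<Rightarrow> bool" where
  "balanced S \<longleftrightarrow>
     (\<exists>s::'a \<Rightarrow> real. (\<forall>\<alpha>\<in>S. s \<alpha> \<in> {1, -1}) \<and> (\<Sum>\<alpha>\<in>S. s \<alpha> *\<^sub>R \<alpha>) = 0)"

definition strongly_orthogonal :: "'a::euclidean_space set \<Rightarrow> 'a set \<Rightarrow> bool" where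
  "strongly_orthogonal R S \<longleftrightarrow> (\<forall>\<alpha>\<in>S. \<forall>\<beta>\<in>S. \<alpha> + \<beta> \<notin> R \<and> \<alpha> - \<beta> \<notin> R)"

definition well_balanced :: "'a::euclidean_space set \<Rightarrow> 'a set \<Rightarrow> 'a set \<Rightarrow> bool" where
  "well_balanced R P S \<longleftrightarrow> balanced S \<and> strongly_orthogonal R (P - S)"

definition minimal_cocardinality :: "'a set \<Rightarrow> ('a set \<Rightarrow> bool) \<Rightarrow> nat \<Rightarrow> bool" where
  "minimal_cocardinality P Q m \<longleftrightarrow>
     (\<exists>S\<subseteq>P. Q S \<and> card (P - S) = m) \<and> (\<forall>S\<subseteq>P. Q S \<longrightarrow> m \<le> card (P - S))"

end

theory Submission
  imports Defs
begin

text \<open>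
The lower bounds are parity obstructions. If a signed sum over a subset \<open>S\<close> of the positive roots vanishes,
then every integer-valued linear functional on the root lattice has the same parity on the sum
of the omitted roots as on the sum of all positive roots (\<open>signed_null_parity_complement\<close>). In types A
(of odd rank) and B each coordinate functional is odd on the sum of all positive roots, so the omitted roots, which
have at most two nonzero coordinates each, must involve every coordinate. In types C and D the only
obstruction of this kind is half the sum of all coordinates; in type D one omitted root
would in addition make some coordinate odd, so two are needed. In type E7 the sum of the positive roots is not
congruent modulo 2 to a sum of fewer than three roots. In all other cases the bound is zero.

These bounds are attained. The positive roots of a classical type are arranged in a square
(\<open>grid_root\<close>), and induction on the rank, in steps of two or four, cuts the square into small balanced blocks:
cycles in the complete graph for type A, and the roots \<open>e i \<plusminus> e a\<close>, \<open>e i \<plusminus> e b\<close> for the others. What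
is left over is an orthogonal set of roots too long for a sum or difference of two of them to
be a root, hence strongly orthogonal. So the minimum over balanced subsets is attained at
a well-balanced one and the two minima agree. For the exceptional types the positive roots are listed with
suitable signs, and the vanishing of the signed sum is computed.

Two general facts connect this with an abstract root system. First, the question depends only on the roots
up to sign (\<open>half_system_transfer\<close>), so an explicit choice of positive roots may be used. Second, a set
that contains the base and is stable under simple reflections contains every root (\<open>roots_subset_reflection_closed\<close>);
this identifies the root system from its Dynkin type. For the classical types it is applied to vectors
\<open>e i\<close> that are constructed from the simple roots inside the span of the roots, for the exceptional types
to lists of coordinates with respect to the base.
\<close>

section \<open>Roots generated by simple reflections\<close>

lemma reflection_alt: "reflection \<alpha> \<beta> = \<beta> - cartan_number \<beta> \<alpha> *\<^sub>R \<alpha>"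
  by (simp add: reflection_def cartan_number_def)

lemma reflection_minus: "reflection \<alpha> (- \<beta>) = - reflection \<alpha> \<beta>"
  by (simp add: reflection_def)

lemma reflection_add: "reflection \<alpha> (\<beta> + \<gamma>) = reflection \<alpha> \<beta> + reflection \<alpha> \<gamma>"
  by (simp add: reflection_def inner_add_left add_divide_distrib algebra_simps)

lemma reflection_diff: "reflection \<alpha> (\<beta> - \<gamma>) = reflection \<alpha> \<beta> - reflection \<alpha> \<gamma>"
  by (simp add: reflection_def inner_diff_left diff_divide_distrib algebra_simps)

lemma reflection_scaleR: "reflection \<alpha> (c *\<^sub>R \<beta>) = c *\<^sub>R reflection \<alpha> \<beta>"
  by (simp add: reflection_def algebra_simps)

lemma reflection_by_scaled: "c \<noteq> 0 \<Longrightarrow> reflection (c *\<^sub>R \<alpha>) \<beta> = reflection \<alpha> \<beta>"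
  by (simp add: reflection_def field_simps)

lemma reflection_self: "\<alpha> \<noteq> 0 \<Longrightarrow> reflection \<alpha> \<alpha> = - \<alpha>"
  by (simp add: reflection_def algebra_simps scaleR_2)

lemma reflection_reflection:
  assumes "\<alpha> \<noteq> 0"
  shows "reflection \<alpha> (reflection \<alpha> \<beta>) = \<beta>"
proof -
  have "reflection \<alpha> (reflection \<alpha> \<beta>) = reflection \<alpha> \<beta> - (2 * (\<beta> \<bullet> \<alpha>) / (\<alpha> \<bullet> \<alpha>)) *\<^sub>R reflection \<alpha> \<alpha>"
    by (metis reflection_def reflection_diff reflection_scaleR)
  then show ?thesis using reflection_self[OF assms] by (simp add: reflection_def)
qed

lemma inner_reflection_self: "reflection \<alpha> \<beta> \<bullet> reflection \<alpha> \<beta> = \<beta> \<bullet> \<beta>"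
proof (cases "\<alpha> = 0")
  case False
  then show ?thesis
    by (simp add: reflection_def inner_diff_left inner_diff_right inner_commute field_simps)
qed (simp add: reflection_def)

lemma root_nonzero: "root_system R \<Longrightarrow> \<alpha> \<in> R \<Longrightarrow> \<alpha> \<noteq> 0"
  unfolding root_system_def by blast

lemma reflection_in_roots: "root_system R \<Longrightarrow> \<alpha> \<in> R \<Longrightarrow> \<beta> \<in> R \<Longrightarrow> reflection \<alpha> \<beta> \<in> R"
  unfolding root_system_def by blast

lemma uminus_in_roots: "root_system R \<Longrightarrow> \<alpha> \<in> R \<Longrightarrow> - \<alpha> \<in> R"
  by (metis reflection_in_roots reflection_self root_nonzero)

text \<open>This is how a Dynkin type determines the root system: every explicit list of vectors below is shown
  to contain all roots by checking that simple reflections preserve it. The reason is descent on the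
  height. As a positive root \<open>\<beta>\<close> has \<open>\<beta> \<bullet> \<beta> > 0\<close>, it has a positive inner product with
  some simple root occurring in it, and the reflection in that simple root lowers the height.
  Unless \<open>\<beta>\<close> is itself simple, the reflected root is again positive, so induction applies.\<close>

theorem roots_subset_reflection_closed:
  fixes R :: "'a::euclidean_space set"
  assumes R: "root_system R" and base: "root_base R \<Delta>"
    and simple: "\<Delta> \<subseteq> C"
    and closed: "\<And>\<alpha> c. \<alpha> \<in> \<Delta> \<Longrightarrow> c \<in> C \<Longrightarrow> reflection \<alpha> c \<in> C"
  shows "R \<subseteq> C"
proof -
  have finR: "finite R" and red: "\<And>\<alpha> c. \<alpha> \<in> R \<Longrightarrow> c *\<^sub>R \<alpha> \<in> R \<Longrightarrow> c = 1 \<or> c = -1"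
    and cart: "\<And>\<alpha> \<beta>. \<alpha> \<in> R \<Longrightarrow> \<beta> \<in> R \<Longrightarrow> cartan_number \<alpha> \<beta> \<in> \<int>"
    using R unfolding root_system_def by blast+
  have \<Delta>R: "\<Delta> \<subseteq> R" and ind: "independent \<Delta>"
    and expand: "\<And>\<beta>. \<beta> \<in> R \<Longrightarrow> \<exists>c::'a \<Rightarrow> int. \<beta> = (\<Sum>\<alpha>\<in>\<Delta>. of_int (c \<alpha>) *\<^sub>R \<alpha>) \<and>
            ((\<forall>\<alpha>\<in>\<Delta>. 0 \<le> c \<alpha>) \<or> (\<forall>\<alpha>\<in>\<Delta>. c \<alpha> \<le> 0))"
    using base unfolding root_base_def by blast+
  have fin: "finite \<Delta>" using finR \<Delta>R finite_subset by blast
  have step: "\<beta> \<in> C \<and> - \<beta> \<in> C" if "\<beta> \<in> R" "\<beta> = (\<Sum>\<alpha>\<in>\<Delta>. of_int (c \<alpha>) *\<^sub>R \<alpha>)"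
      "\<forall>\<alpha>\<in>\<Delta>. 0 \<le> c \<alpha>" for \<beta> and c :: "'a \<Rightarrow> int"
    using that
  proof (induction "nat (\<Sum>\<alpha>\<in>\<Delta>. c \<alpha>)" arbitrary: \<beta> c rule: less_induct)
    case less
    show ?case
    proof (cases "\<beta> \<in> \<Delta>")
      case True
      then show ?thesis
        by (metis less.prems(1) R closed reflection_self root_nonzero simple subsetD)
    next
      case False
      have "0 < \<beta> \<bullet> \<beta>" using root_nonzero[OF R less.prems(1)] by simp
      also have "\<beta> \<bullet> \<beta> = (\<Sum>\<alpha>\<in>\<Delta>. of_int (c \<alpha>) * (\<beta> \<bullet> \<alpha>))"
        by (subst (2) less.prems(2)) (simp add: inner_sum_right)
      finally obtain \<alpha> where \<alpha>: "\<alpha> \<in> \<Delta>" "0 < of_int (c \<alpha>) * (\<beta> \<bullet> \<alpha>)"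
        by (metis (no_types, lifting) not_le sum_nonpos)
      have c\<alpha>: "0 < c \<alpha>" and ip: "0 < \<beta> \<bullet> \<alpha>"
        using \<alpha> less.prems(3) by (force simp: zero_less_mult_iff)+
      have \<alpha>R: "\<alpha> \<in> R" and \<alpha>0: "\<alpha> \<noteq> 0" using \<alpha>(1) \<Delta>R root_nonzero[OF R] by auto
      obtain k :: int where k: "cartan_number \<beta> \<alpha> = of_int k"
        using cart[OF less.prems(1) \<alpha>R] by (auto elim: Ints_cases)
      have "0 < cartan_number \<beta> \<alpha>" using ip \<alpha>0 by (simp add: cartan_number_def)
      then have k0: "0 < k" using k by simp
      define \<beta>' where "\<beta>' = reflection \<alpha> \<beta>"
      have \<beta>'R: "\<beta>' \<in> R" unfolding \<beta>'_def by (rule reflection_in_roots[OF R \<alpha>R less.prems(1)])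
      obtain d :: "'a \<Rightarrow> int" where d: "\<beta>' = (\<Sum>\<alpha>\<in>\<Delta>. of_int (d \<alpha>) *\<^sub>R \<alpha>)"
        "(\<forall>\<alpha>\<in>\<Delta>. 0 \<le> d \<alpha>) \<or> (\<forall>\<alpha>\<in>\<Delta>. d \<alpha> \<le> 0)" using expand[OF \<beta>'R] by blast
      define c' where "c' = c(\<alpha> := c \<alpha> - k)"
      have c': "\<beta>' = (\<Sum>\<alpha>\<in>\<Delta>. of_int (c' \<alpha>) *\<^sub>R \<alpha>)"
      proof -
        have "(\<Sum>\<alpha>\<in>\<Delta>. of_int (c' \<alpha>) *\<^sub>R \<alpha>) = (\<Sum>\<gamma>\<in>\<Delta>. of_int (c \<gamma>) *\<^sub>R \<gamma> - (if \<gamma> = \<alpha> then of_int k *\<^sub>R \<alpha> else 0))"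
          by (rule sum.cong) (auto simp: c'_def algebra_simps)
        also have "\<dots> = \<beta> - of_int k *\<^sub>R \<alpha>"
          using \<alpha>(1) fin by (simp add: sum_subtractf less.prems(2)[symmetric])
        finally show ?thesis by (simp add: \<beta>'_def reflection_alt k)
      qed
      have dc': "d \<gamma> = c' \<gamma>" if "\<gamma> \<in> \<Delta>" for \<gamma>
      proof -
        have "(\<Sum>\<alpha>\<in>\<Delta>. of_int (d \<alpha> - c' \<alpha>) *\<^sub>R \<alpha>) = 0"
          using d(1) c' by (simp add: sum_subtractf scaleR_left_diff_distrib)
        from independentD[OF ind fin order_refl this that] have "real_of_int (d \<gamma> - c' \<gamma>) = 0"
          by simp
        then show ?thesis by linarith
      qed
      \<comment> \<open>As \<open>R\<close> is reduced, \<open>\<beta>\<close> involves a second simple root, whose coefficient the reflection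
        leaves positive; so the reflected root is still positive.\<close>
      obtain \<gamma> where \<gamma>: "\<gamma> \<in> \<Delta>" "\<gamma> \<noteq> \<alpha>" "0 < c \<gamma>"
      proof (rule ccontr)
        assume "\<not> thesis"
        then have z: "c \<gamma> = 0" if "\<gamma> \<in> \<Delta>" "\<gamma> \<noteq> \<alpha>" for \<gamma>
          using that less.prems(3) \<open>\<And>\<gamma>. \<gamma> \<in> \<Delta> \<Longrightarrow> \<gamma> \<noteq> \<alpha> \<Longrightarrow> 0 < c \<gamma> \<Longrightarrow> thesis\<close>
          by (metis order_le_less)
        have "\<beta> = (\<Sum>\<gamma>\<in>\<Delta>. if \<gamma> = \<alpha> then of_int (c \<alpha>) *\<^sub>R \<alpha> else 0)"
          unfolding less.prems(2) by (rule sum.cong) (auto simp: z)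
        then have e: "\<beta> = of_int (c \<alpha>) *\<^sub>R \<alpha>" using \<alpha>(1) fin by simp
        then have "real_of_int (c \<alpha>) = 1 \<or> real_of_int (c \<alpha>) = -1"
          using red[OF \<alpha>R] less.prems(1) by blast
        then show False using e False \<alpha>(1) c\<alpha> by auto
      qed
      have pos: "\<forall>\<gamma>\<in>\<Delta>. 0 \<le> c' \<gamma>"
        using d(2) dc' \<gamma> by (force simp: c'_def)
      have "(\<Sum>\<gamma>\<in>\<Delta>. c' \<gamma>) < (\<Sum>\<gamma>\<in>\<Delta>. c \<gamma>)"
        by (rule sum_strict_mono_ex1[OF fin]) (use \<alpha>(1) k0 in \<open>auto simp: c'_def\<close>)
      moreover have "0 \<le> (\<Sum>\<gamma>\<in>\<Delta>. c' \<gamma>)" using pos by (simp add: sum_nonneg)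
      ultimately have "nat (\<Sum>\<gamma>\<in>\<Delta>. c' \<gamma>) < nat (\<Sum>\<gamma>\<in>\<Delta>. c \<gamma>)" by linarith
      from less.hyps[OF this \<beta>'R c' pos] have "\<beta>' \<in> C" "- \<beta>' \<in> C" by auto
      then show ?thesis
        using closed[OF \<alpha>(1)] reflection_reflection[OF \<alpha>0, of \<beta>] reflection_minus[of \<alpha> \<beta>']
        unfolding \<beta>'_def by metis
    qed
  qed
  show ?thesis
  proof
    fix \<beta> assume \<beta>: "\<beta> \<in> R"
    obtain c :: "'a \<Rightarrow> int" where c: "\<beta> = (\<Sum>\<alpha>\<in>\<Delta>. of_int (c \<alpha>) *\<^sub>R \<alpha>)"
      "(\<forall>\<alpha>\<in>\<Delta>. 0 \<le> c \<alpha>) \<or> (\<forall>\<alpha>\<in>\<Delta>. c \<alpha> \<le> 0)" using expand[OF \<beta>] by blast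
    show "\<beta> \<in> C"
    proof (cases "\<forall>\<alpha>\<in>\<Delta>. 0 \<le> c \<alpha>")
      case True
      then show ?thesis using step[OF \<beta> c(1)] by blast
    next
      case False
      then have "\<forall>\<alpha>\<in>\<Delta>. 0 \<le> - c \<alpha>" using c(2) by auto
      moreover have "- \<beta> = (\<Sum>\<alpha>\<in>\<Delta>. of_int (- c \<alpha>) *\<^sub>R \<alpha>)" by (simp add: c(1) sum_negf)
      ultimately have "- \<beta> \<in> C \<and> - (- \<beta>) \<in> C"
        by (intro step[OF uminus_in_roots[OF R \<beta>]])
      then show ?thesis by simp
    qed
  qed
qed

section \<open>Balanced families\<close>

text \<open>Balancedness of an indexed family. Unlike sets of roots, index sets split into small explicit
  pieces without any knowledge of which vectors coincide.\<close>

definition signed_null :: "'b set \<Rightarrow> ('b \<Rightarrow> 'a::real_vector) \<Rightarrow> bool" where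
  "signed_null J f \<longleftrightarrow> (\<exists>s::'b \<Rightarrow> real. (\<forall>x\<in>J. s x \<in> {1, -1}) \<and> (\<Sum>x\<in>J. s x *\<^sub>R f x) = 0)"

lemma signed_null_empty: "signed_null {} f"
  by (simp add: signed_null_def)

lemma signed_null_Un:
  assumes "signed_null A f" "signed_null B f" "finite A" "finite B" "A \<inter> B = {}"
  shows "signed_null (A \<union> B) f"
proof -
  obtain s t where st: "\<forall>x\<in>A. s x \<in> {1, -1::real}" "(\<Sum>x\<in>A. s x *\<^sub>R f x) = 0"
    "\<forall>x\<in>B. t x \<in> {1, -1::real}" "(\<Sum>x\<in>B. t x *\<^sub>R f x) = 0"
    using assms(1,2) unfolding signed_null_def by blast
  let ?u = "\<lambda>x. if x \<in> A then s x else t x"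
  have "(\<Sum>x\<in>A. ?u x *\<^sub>R f x) = 0" using st(2) by simp
  moreover have "(\<Sum>x\<in>B. ?u x *\<^sub>R f x) = (\<Sum>x\<in>B. t x *\<^sub>R f x)"
    by (rule sum.cong) (use assms(5) in auto)
  ultimately have "(\<Sum>x\<in>A \<union> B. ?u x *\<^sub>R f x) = 0"
    using st(4) assms(3-5) by (simp add: sum.union_disjoint)
  then show ?thesis unfolding signed_null_def using st(1,3) by (intro exI[of _ ?u]) auto
qed

text \<open>Balanced subsets are assembled from disjoint blocks of a few roots each; a block is balanced
  because its plus part and its minus part have the same sum (\<open>signed_null_eq_sums\<close>).\<close>

lemma signed_null_UN:
  assumes "finite K" "\<And>k. k \<in> K \<Longrightarrow> signed_null (A k) f" "\<And>k. k \<in> K \<Longrightarrow> finite (A k)"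
    "\<And>k l. k \<in> K \<Longrightarrow> l \<in> K \<Longrightarrow> k \<noteq> l \<Longrightarrow> A k \<inter> A l = {}"
  shows "signed_null (\<Union>k\<in>K. A k) f"
  using assms
proof (induction K rule: finite_induct)
  case (insert k K)
  have "signed_null (A k \<union> (\<Union>k\<in>K. A k)) f"
    by (rule signed_null_Un) (use insert in fastforce)+
  then show ?case by simp
qed (simp add: signed_null_empty)

lemma signed_null_eq_sums:
  assumes "finite A" "finite B" "A \<inter> B = {}" "sum f A = sum f B"
  shows "signed_null (A \<union> B) f"
proof -
  let ?s = "\<lambda>x. if x \<in> A then 1 else - 1 :: real"
  have "(\<Sum>x\<in>A. ?s x *\<^sub>R f x) = sum f A" by simp
  moreover have "(\<Sum>x\<in>B. ?s x *\<^sub>R f x) = (\<Sum>x\<in>B. - f x)"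
    by (rule sum.cong) (use assms(3) in auto)
  ultimately have "(\<Sum>x\<in>A \<union> B. ?s x *\<^sub>R f x) = 0"
    using assms by (simp add: sum.union_disjoint sum_negf)
  then show ?thesis unfolding signed_null_def by (intro exI[of _ ?s]) auto
qed

lemma signed_null_image:
  assumes "inj_on f J"
  shows "balanced (f ` J) \<longleftrightarrow> signed_null J f"
proof
  assume "balanced (f ` J)"
  then obtain s where s: "\<forall>x\<in>f ` J. s x \<in> {1, -1::real}" "(\<Sum>x\<in>f ` J. s x *\<^sub>R x) = 0"
    unfolding balanced_def by blast
  then show "signed_null J f" unfolding signed_null_def
    by (intro exI[of _ "s \<circ> f"]) (simp add: sum.reindex[OF assms])
next
  assume "signed_null J f"
  then obtain s where s: "\<forall>x\<in>J. s x \<in> {1, -1::real}" "(\<Sum>x\<in>J. s x *\<^sub>R f x) = 0"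
    unfolding signed_null_def by blast
  then show "balanced (f ` J)" unfolding balanced_def
    by (intro exI[of _ "s \<circ> inv_into J f"]) (simp add: sum.reindex[OF assms] inv_into_f_f[OF assms])
qed

text \<open>All lower bounds come from here. A sign does not change an integer modulo 2, so for a functional
  with integer values on the family the signed sum and the plain sum have the same parity,
  and the signed sum is zero.\<close>

lemma signed_null_parity:
  fixes g :: "'a::real_vector \<Rightarrow> real" and h :: "'b \<Rightarrow> int"
  assumes "signed_null J f" "finite J" "linear g" "\<And>x. x \<in> J \<Longrightarrow> g (f x) = of_int (h x)"
  shows "even (\<Sum>x\<in>J. h x)"
proof -
  obtain s where s: "\<forall>x\<in>J. s x \<in> {1, -1::real}" "(\<Sum>x\<in>J. s x *\<^sub>R f x) = 0"
    using assms(1) unfolding signed_null_def by blast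
  define t :: "'b \<Rightarrow> int" where "t x = (if s x = 1 then 1 else -1)" for x
  have t: "s x = of_int (t x)" if "x \<in> J" for x using s(1) that by (auto simp: t_def)
  have "0 = g (\<Sum>x\<in>J. s x *\<^sub>R f x)" using s(2) linear_0[OF assms(3)] by simp
  also have "\<dots> = (\<Sum>x\<in>J. s x * g (f x))"
    by (simp add: linear_sum[OF assms(3)] linear_cmul[OF assms(3)])
  also have "\<dots> = of_int (\<Sum>x\<in>J. t x * h x)" by (simp add: t assms(4))
  finally have "(\<Sum>x\<in>J. t x * h x) = 0" by linarith
  moreover have "even (\<Sum>x\<in>J. h x - t x * h x)"
    by (rule dvd_sum) (simp add: t_def)
  ultimately show ?thesis by (simp add: sum_subtractf)
qed

text \<open>Consequently the parity of the sum of such a functional over the omitted roots is that of its sum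
  over all positive roots, whatever balanced subset was chosen.\<close>

lemma signed_null_parity_complement:
  fixes g :: "'a::real_vector \<Rightarrow> real" and h :: "'b \<Rightarrow> int"
  assumes "signed_null J f" "finite I" "J \<subseteq> I" "linear g" "\<And>x. x \<in> I \<Longrightarrow> g (f x) = of_int (h x)"
  shows "even (\<Sum>x\<in>I - J. h x) \<longleftrightarrow> even (\<Sum>x\<in>I. h x)"
proof -
  have "even (\<Sum>x\<in>J. h x)"
    by (rule signed_null_parity[OF assms(1) _ assms(4)]) (use assms finite_subset in auto)
  moreover have "(\<Sum>x\<in>I. h x) = (\<Sum>x\<in>I - J. h x) + (\<Sum>x\<in>J. h x)"
    by (rule sum.subset_diff[OF assms(3,2)])
  ultimately show ?thesis by simp
qed

section \<open>Independence of the choice of positive roots\<close>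

text \<open>Neither balancedness nor strong orthogonality changes when a root is replaced by its negative.
  Hence only the choice of one root from each pair \<open>\<plusminus>\<alpha>\<close> matters, and
  an explicit half of \<open>R\<close> can stand in for the abstract set of positive roots.\<close>

definition half_system :: "'a::euclidean_space set \<Rightarrow> 'a set \<Rightarrow> bool" where
  "half_system R T \<longleftrightarrow> R = T \<union> uminus ` T \<and> (\<forall>x\<in>T. - x \<notin> T)"

lemma positive_roots_half_system:
  assumes "root_system R" "positive_roots R P"
  shows "half_system R P"
proof -
  have P: "P \<subseteq> R" "\<And>\<alpha>. \<alpha> \<in> R \<Longrightarrow> \<alpha> \<in> P \<longleftrightarrow> - \<alpha> \<notin> P"
    using assms(2) unfolding positive_roots_def by blast+
  have "R \<subseteq> P \<union> uminus ` P" using P(2) by (metis Un_iff imageI minus_minus subsetI)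
  moreover have "P \<union> uminus ` P \<subseteq> R" using P(1) uminus_in_roots[OF assms(1)] by auto
  ultimately show ?thesis using P unfolding half_system_def by blast
qed

lemma half_system_transfer:
  fixes R :: "'a::euclidean_space set"
  assumes T: "half_system R T" and P: "half_system R P" and S: "S \<subseteq> T"
  obtains S' where "S' \<subseteq> P" "card (P - S') = card (T - S)" "balanced S \<Longrightarrow> balanced S'"
    "strongly_orthogonal R (T - S) \<Longrightarrow> strongly_orthogonal R (P - S')"
proof -
  define h where "h x = (if x \<in> P then x else - x)" for x
  have pm: "h x = x \<or> h x = - x" for x by (simp add: h_def)
  have inj: "inj_on h T"
  proof (rule inj_onI)
    fix x y assume xy: "x \<in> T" "y \<in> T" and "h x = h y"
    then have "x = y \<or> x = - y" unfolding h_def by (auto split: if_splits)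
    then show "x = y" using xy T unfolding half_system_def by auto
  qed
  have im: "h ` T = P"
  proof
    show "h ` T \<subseteq> P"
    proof (rule image_subsetI)
      fix x assume "x \<in> T"
      then have "x \<in> P \<union> uminus ` P" using T P unfolding half_system_def by blast
      then show "h x \<in> P" unfolding h_def by auto
    qed
    show "P \<subseteq> h ` T"
    proof
      fix p assume p: "p \<in> P"
      then have "p \<in> R" using P unfolding half_system_def by blast
      then obtain t where t: "t \<in> T" "p = t \<or> p = - t" using T unfolding half_system_def by blast
      then have "h t = p" using p P unfolding half_system_def h_def by auto
      then show "p \<in> h ` T" using t(1) by blast
    qed
  qed
  have diff: "P - h ` S = h ` (T - S)"
    using im inj S by (metis inj_on_image_set_diff order_refl Diff_subset)
  have R_uminus: "- x \<in> R \<longleftrightarrow> x \<in> R" for x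
  proof -
    have "R = P \<union> uminus ` P" using P unfolding half_system_def by blast
    then show ?thesis by (auto simp: image_iff) (metis minus_minus)+
  qed
  show thesis
  proof (rule that)
    show "h ` S \<subseteq> P" using im S by blast
    show "card (P - h ` S) = card (T - S)"
      unfolding diff by (rule card_image) (use inj inj_on_diff in blast)
    show "balanced (h ` S)" if bal: "balanced S"
    proof -
      obtain s where s: "\<forall>x\<in>S. s x \<in> {1, -1::real}" "(\<Sum>x\<in>S. s x *\<^sub>R x) = 0"
        using bal unfolding balanced_def by blast
      have "signed_null S h" unfolding signed_null_def
      proof (intro exI[of _ "\<lambda>x. if x \<in> P then s x else - s x"] conjI)
        show "(\<Sum>x\<in>S. (if x \<in> P then s x else - s x) *\<^sub>R h x) = 0"
          using s(2) by (simp add: h_def if_distrib cong: if_cong)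
      qed (use s(1) in auto)
      then show ?thesis using signed_null_image[OF inj_on_subset[OF inj S]] by blast
    qed
    show "strongly_orthogonal R (P - h ` S)" if so: "strongly_orthogonal R (T - S)"
      unfolding diff strongly_orthogonal_def
    proof (intro ballI)
      fix a b assume "a \<in> h ` (T - S)" "b \<in> h ` (T - S)"
      then obtain x y where xy: "x \<in> T - S" "y \<in> T - S" "a = h x" "b = h y" by blast
      then have "x + y \<notin> R" "x - y \<notin> R" using so unfolding strongly_orthogonal_def by blast+
      moreover have "- (x + y) \<notin> R" "- (x - y) \<notin> R" using calculation R_uminus by blast+
      ultimately show "a + b \<notin> R \<and> a - b \<notin> R"
        using pm[of x] pm[of y] xy(3,4) by (auto simp: algebra_simps)
    qed
  qed
qed

text \<open>The common frame for all types: the roots up to sign are indexed without repetition by \<open>I\<close>, the set \<open>K\<close>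
  of omitted indices realises the minimum, and \<open>lower\<close> is the parity bound.
  Since \<open>K\<close> is strongly orthogonal, the same number is the minimum over the well-balanced subsets.\<close>

theorem minimal_cocardinality_indexed:
  fixes R P :: "'a::euclidean_space set" and f :: "'b \<Rightarrow> 'a"
  assumes R: "root_system R" and P: "positive_roots R P"
    and cover: "R = f ` I \<union> uminus ` f ` I"
    and inj: "\<And>x y. x \<in> I \<Longrightarrow> y \<in> I \<Longrightarrow> f x = f y \<or> f x = - f y \<Longrightarrow> x = y"
    and K: "K \<subseteq> I" "signed_null (I - K) f" "strongly_orthogonal R (f ` K)" "card K = m"
    and lower: "\<And>J. J \<subseteq> I \<Longrightarrow> signed_null J f \<Longrightarrow> m \<le> card (I - J)"
  shows "minimal_cocardinality P balanced m \<and> minimal_cocardinality P (well_balanced R P) m"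
proof -
  have inj': "inj_on f I" using inj by (auto intro: inj_onI)
  have T: "half_system R (f ` I)"
    unfolding half_system_def
  proof (intro conjI ballI notI)
    fix x assume "x \<in> f ` I" "- x \<in> f ` I"
    then obtain i j where ij: "i \<in> I" "j \<in> I" "x = f i" "- x = f j" by blast
    \<comment> \<open>A root and its negative cannot both be listed: injectivity up to sign would force \<open>x = - x\<close>.\<close>
    have "f i = - f j" using ij(3) ij(4)[symmetric] by simp
    then have "i = j" using inj ij(1,2) by blast
    then have "x = - x" using ij(3,4) by simp
    then have "x + x = 0" by (simp add: add_eq_0_iff)
    then have "2 *\<^sub>R x = 0" by (simp only: scaleR_2)
    then have "x = 0" by simp
    moreover have "x \<in> R" using ij(1,3) cover by blast
    ultimately show False using root_nonzero[OF R] by blast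
  qed (rule cover)
  have hP: "half_system R P" using R P by (rule positive_roots_half_system)
  have co: "f ` I - f ` (I - K) = f ` K"
    using K(1) inj' by (metis Diff_Diff_Int Diff_subset inf.absorb_iff2 inj_on_image_set_diff)
  have "card (f ` K) = m" using K(1,4) inj' by (metis card_image inj_on_subset)
  moreover have "balanced (f ` (I - K))"
    using K(2) signed_null_image inj_on_diff[OF inj'] by blast
  moreover have "f ` (I - K) \<subseteq> f ` I" by blast
  ultimately obtain S where S: "S \<subseteq> P" "card (P - S) = m" "balanced S" "strongly_orthogonal R (P - S)"
    using half_system_transfer[OF T hP, of "f ` (I - K)"] K(3) unfolding co by metis
  have lb: "m \<le> card (P - S)" if SP: "S \<subseteq> P" "balanced S" for S
  proof -
    obtain S' where S': "S' \<subseteq> f ` I" "card (f ` I - S') = card (P - S)" "balanced S'"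
      using half_system_transfer[OF hP T SP(1)] SP(2) by metis
    obtain J where J: "J \<subseteq> I" "S' = f ` J" using S'(1) by (meson subset_imageE)
    have "signed_null J f" using S'(3) J signed_null_image inj' inj_on_subset by metis
    then have "m \<le> card (I - J)" using lower J(1) by blast
    also have "\<dots> = card (f ` I - S')"
      unfolding J(2) using J(1) inj' by (metis Diff_subset card_image inj_on_image_set_diff inj_on_subset order_refl)
    finally show ?thesis using S'(2) by simp
  qed
  show ?thesis
    unfolding minimal_cocardinality_def well_balanced_def using S lb by blast
qed

lemma strongly_orthogonal_singleton:
  assumes "root_system R" "x \<in> R"
  shows "strongly_orthogonal R {x}"
proof -
  have "2 *\<^sub>R x \<notin> R" using assms unfolding root_system_def by fastforce
  then show ?thesis using assms unfolding root_system_def strongly_orthogonal_def by (simp add: scaleR_2)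
qed

text \<open>For orthogonal \<open>x\<close> and \<open>y\<close> the vectors \<open>x \<plusminus> y\<close> have squared norm \<open>x \<bullet> x + y \<bullet> y\<close>, which is
  too long for a root. This fails for two orthogonal short roots in type B, whose sum is
  a long root; the omitted sets below contain at most one short root there.\<close>

lemma strongly_orthogonal_if_orthogonal:
  fixes R :: "'a::euclidean_space set"
  assumes R: "root_system R" and K: "K \<subseteq> R"
    and orth: "\<And>x y. x \<in> K \<Longrightarrow> y \<in> K \<Longrightarrow> x \<noteq> y \<Longrightarrow> x \<bullet> y = 0"
    and long: "\<And>x y z. x \<in> K \<Longrightarrow> y \<in> K \<Longrightarrow> x \<noteq> y \<Longrightarrow> z \<in> R \<Longrightarrow> z \<bullet> z < x \<bullet> x + y \<bullet> y"
  shows "strongly_orthogonal R K"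
  unfolding strongly_orthogonal_def
proof (intro ballI)
  fix x y assume xy: "x \<in> K" "y \<in> K"
  show "x + y \<notin> R \<and> x - y \<notin> R"
  proof (cases "x = y")
    case True
    then show ?thesis using strongly_orthogonal_singleton[OF R] xy K
      unfolding strongly_orthogonal_def by blast
  next
    case False
    have "(x + y) \<bullet> (x + y) = x \<bullet> x + y \<bullet> y" "(x - y) \<bullet> (x - y) = x \<bullet> x + y \<bullet> y"
      using orth[OF xy False] by (simp_all add: inner_add_left inner_add_right inner_diff_left inner_diff_right inner_commute)
    then show ?thesis using long[OF xy False] by (metis less_irrefl)
  qed
qed

section \<open>Coordinate frames\<close>

text \<open>Vectors \<open>e i\<close> whose inner products with the differences \<open>e a - e b\<close> are as for an orthogonal basis.
  In type A the \<open>n + 1\<close> vectors have to live in the \<open>n\<close>-dimensional span of the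
  roots, so they cannot be orthogonal; they are the projections of an orthogonal basis.\<close>

definition frame :: "nat \<Rightarrow> real \<Rightarrow> (nat \<Rightarrow> 'a::euclidean_space) \<Rightarrow> bool" where
  "frame n N e \<longleftrightarrow> 0 < N \<and> (\<forall>a\<in>{1..n}. \<forall>b\<in>{1..n}. \<forall>c\<in>{1..n}.
     e c \<bullet> (e a - e b) = N * (of_bool (c = a) - of_bool (c = b)))"

definition orthogonal_frame :: "nat \<Rightarrow> real \<Rightarrow> (nat \<Rightarrow> 'a::euclidean_space) \<Rightarrow> bool" where
  "orthogonal_frame n N e \<longleftrightarrow> 0 < N \<and> (\<forall>a\<in>{1..n}. \<forall>b\<in>{1..n}. e a \<bullet> e b = N * of_bool (a = b))"

lemma orthogonal_frame_frame: "orthogonal_frame n N e \<Longrightarrow> frame n N e"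
  unfolding frame_def orthogonal_frame_def by (auto simp: inner_diff_right algebra_simps)

lemma frame_inner:
  assumes "frame n N e" "a \<in> {1..n}" "b \<in> {1..n}" "c \<in> {1..n}"
  shows "e c \<bullet> (e a - e b) = N * (of_bool (c = a) - of_bool (c = b))"
  using assms unfolding frame_def by blast

lemma orthogonal_frame_inner:
  assumes "orthogonal_frame n N e" "a \<in> {1..n}" "b \<in> {1..n}"
  shows "e a \<bullet> e b = N * of_bool (a = b)"
  using assms unfolding orthogonal_frame_def by blast

lemma frame_norm:
  assumes "frame n N e" "a \<in> {1..n}" "b \<in> {1..n}" "a \<noteq> b"
  shows "(e a - e b) \<bullet> (e a - e b) = 2 * N"
  using frame_inner[OF assms(1,2,3,2)] frame_inner[OF assms(1,2,3,3)] assms(4)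
  by (simp add: inner_diff_left)

text \<open>Reflections in differences transpose two frame vectors, in the projected frame of type A as well
  as in an orthogonal one.\<close>

lemma reflection_difference:
  assumes "frame n N e" "a \<in> {1..n}" "b \<in> {1..n}" "c \<in> {1..n}" "a \<noteq> b"
  shows "reflection (e a - e b) (e c) = e (if c = a then b else if c = b then a else c)"
proof -
  have "0 < N" using assms(1) unfolding frame_def by blast
  then show ?thesis
    using assms(5) unfolding reflection_def frame_norm[OF assms(1-3,5)] frame_inner[OF assms(1-4)]
    by auto
qed

lemma reflection_axis:
  assumes "orthogonal_frame n N e" "a \<in> {1..n}" "c \<in> {1..n}"
  shows "reflection (e a) (e c) = (if c = a then - e a else e c)"
proof -
  have "0 < N" using assms(1) unfolding orthogonal_frame_def by blast
  then show ?thesis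
    unfolding reflection_def orthogonal_frame_inner[OF assms(1,3,2)] orthogonal_frame_inner[OF assms(1,2,2)]
    by (auto simp: scaleR_2)
qed

lemma reflection_sum:
  assumes o: "orthogonal_frame n N e" and ab: "a \<in> {1..n}" "b \<in> {1..n}" and c: "c \<in> {1..n}" and ne: "a \<noteq> b"
  shows "reflection (e a + e b) (e c) = (if c = a then - e b else if c = b then - e a else e c)"
proof -
  have N: "0 < N" using o unfolding orthogonal_frame_def by blast
  have "e c \<bullet> (e a + e b) = N * (of_bool (c = a) + of_bool (c = b))"
    unfolding inner_add_right orthogonal_frame_inner[OF o c ab(1)] orthogonal_frame_inner[OF o c ab(2)]
    by (simp add: algebra_simps)
  moreover have "(e a + e b) \<bullet> (e a + e b) = 2 * N"
    unfolding inner_add_right inner_add_left orthogonal_frame_inner[OF o ab(1) ab(1)]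
      orthogonal_frame_inner[OF o ab(2) ab(2)] orthogonal_frame_inner[OF o ab]
      orthogonal_frame_inner[OF o ab(2) ab(1)]
    using ne by simp
  ultimately show ?thesis
    using ne N by (auto simp: reflection_def algebra_simps)
qed

lemma differences_in_roots:
  assumes R: "root_system R" and F: "frame n N e"
    and simple: "\<And>i. 1 \<le> i \<Longrightarrow> i < n \<Longrightarrow> e i - e (Suc i) \<in> R"
    and ij: "i \<in> {1..n}" "j \<in> {1..n}" "i \<noteq> j"
  shows "e i - e j \<in> R"
proof -
  have up: "i < j \<Longrightarrow> j \<le> n \<Longrightarrow> 1 \<le> i \<Longrightarrow> e i - e j \<in> R" for i j
  proof (induction j)
    case (Suc j)
    show ?case
    proof (cases "i = j")
      case True
      then show ?thesis using simple Suc.prems by simp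
    next
      case False
      then have "e i - e j \<in> R" using Suc by simp
      moreover have "e j - e (Suc j) \<in> R" using simple Suc.prems False by simp
      ultimately have "reflection (e j - e (Suc j)) (e i - e j) \<in> R"
        using reflection_in_roots[OF R] by blast
      moreover have "reflection (e j - e (Suc j)) (e i - e j) = e i - e (Suc j)"
        using Suc.prems False by (simp add: reflection_diff reflection_difference[OF F])
      ultimately show ?thesis by simp
    qed
  qed simp
  show ?thesis
  proof (cases "i < j")
    case True
    then show ?thesis using up ij by simp
  next
    case False
    then have "- (e j - e i) \<in> R" using up[of j i] ij by (intro uminus_in_roots[OF R]) auto
    then show ?thesis by simp
  qed
qed

text \<open>The cells of a square index the roots up to sign: above the diagonal the differences, below it the
  sums, on it the multiples \<open>d *\<^sub>R e i\<close>. The whole square gives type B (\<open>d = 1\<close>) and type C (\<open>d = 2\<close>),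
  the square without its diagonal type D, and the part above the diagonal type A.\<close>

definition grid_root :: "real \<Rightarrow> (nat \<Rightarrow> 'a::real_vector) \<Rightarrow> nat \<times> nat \<Rightarrow> 'a" where
  "grid_root d e = (\<lambda>(i, j). if i < j then e i - e j else if j < i then e i + e j else d *\<^sub>R e i)"

lemma grid_root_simps:
  "i < j \<Longrightarrow> grid_root d e (i, j) = e i - e j"
  "j < i \<Longrightarrow> grid_root d e (i, j) = e i + e j"
  "grid_root d e (i, i) = d *\<^sub>R e i"
  by (simp_all add: grid_root_def)

definition upper :: "nat \<Rightarrow> (nat \<times> nat) set" where
  "upper n = {(i, j). i \<in> {1..n} \<and> j \<in> {1..n} \<and> i < j}"

definition grid :: "nat \<Rightarrow> (nat \<times> nat) set" where
  "grid n = {1..n} \<times> {1..n}"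

definition off_diagonal :: "nat \<Rightarrow> (nat \<times> nat) set" where
  "off_diagonal n = {(i, j). i \<in> {1..n} \<and> j \<in> {1..n} \<and> i \<noteq> j}"

lemma finite_grid [simp]: "finite (grid n)" "finite (upper n)" "finite (off_diagonal n)"
proof -
  show f: "finite (grid n)" by (simp add: grid_def)
  show "finite (upper n)" by (rule finite_subset[OF _ f]) (auto simp: upper_def grid_def)
  show "finite (off_diagonal n)" by (rule finite_subset[OF _ f]) (auto simp: off_diagonal_def grid_def)
qed

lemma grid_root_upper_image:
  "grid_root d e ` upper n \<union> uminus ` grid_root d e ` upper n
   = {e i - e j | i j. i \<in> {1..n} \<and> j \<in> {1..n} \<and> i \<noteq> j}" (is "?L = ?R")
proof
  show "?L \<subseteq> ?R" by (auto simp: upper_def grid_root_simps) force+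
  show "?R \<subseteq> ?L"
  proof
    fix x assume "x \<in> ?R"
    then obtain i j where x: "x = e i - e j" "i \<in> {1..n}" "j \<in> {1..n}" "i \<noteq> j" by blast
    show "x \<in> ?L"
    proof (cases "i < j")
      case True
      then have "x = grid_root d e (i, j)" "(i, j) \<in> upper n" using x by (auto simp: upper_def grid_root_simps)
      then show ?thesis by blast
    next
      case False
      then have "x = - grid_root d e (j, i)" "(j, i) \<in> upper n" using x by (auto simp: upper_def grid_root_simps)
      then show ?thesis by blast
    qed
  qed
qed

lemma grid_root_off_diagonal_image:
  "grid_root d e ` off_diagonal n \<union> uminus ` grid_root d e ` off_diagonal n
   = {s *\<^sub>R e i + t *\<^sub>R e j | s t i j. s \<in> {1, -1} \<and> t \<in> {1, -1} \<and> i \<in> {1..n} \<and> j \<in> {1..n} \<and> i \<noteq> j}"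
  (is "?L = ?R")
proof
  have RI: "s *\<^sub>R e i + t *\<^sub>R e j \<in> ?R" if "s \<in> {1, -1}" "t \<in> {1, -1}" "i \<in> {1..n}" "j \<in> {1..n}" "i \<noteq> j" for s t i j
    using that by blast
  show "?L \<subseteq> ?R"
  proof
    fix x assume "x \<in> ?L"
    then obtain i j where ij: "i \<in> {1..n}" "j \<in> {1..n}" "i \<noteq> j"
      "x = grid_root d e (i, j) \<or> x = - grid_root d e (i, j)"
      unfolding off_diagonal_def by blast
    show "x \<in> ?R"
    proof (cases "i < j")
      case True
      then show ?thesis using ij RI[of 1 "-1" i j] RI[of "-1" 1 i j] by (auto simp: grid_root_simps)
    next
      case False
      then have "j < i" using ij(3) by simp
      then show ?thesis using ij RI[of 1 "1" i j] RI[of "-1" "-1" i j] by (auto simp: grid_root_simps)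
    qed
  qed
  have ord: "s *\<^sub>R e i + t *\<^sub>R e j \<in> ?L"
    if "s \<in> {1, -1}" "t \<in> {1, -1}" "i \<in> {1..n}" "j \<in> {1..n}" "i < j" for s t i j
  proof -
    have "grid_root d e (i, j) \<in> ?L" "- grid_root d e (i, j) \<in> ?L"
      "grid_root d e (j, i) \<in> ?L" "- grid_root d e (j, i) \<in> ?L"
      using that by (auto simp: off_diagonal_def)
    moreover have "s *\<^sub>R e i + t *\<^sub>R e j \<in> {grid_root d e (i, j), - grid_root d e (i, j),
        grid_root d e (j, i), - grid_root d e (j, i)}"
      using that(1,2,5) by (auto simp: grid_root_simps)
    ultimately show ?thesis by (auto simp del: image_eqI)
  qed
  show "?R \<subseteq> ?L"
  proof
    fix x assume "x \<in> ?R"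
    then obtain s t i j where x: "x = s *\<^sub>R e i + t *\<^sub>R e j" "s \<in> {1, -1}" "t \<in> {1, -1}"
      "i \<in> {1..n}" "j \<in> {1..n}" "i \<noteq> j" by blast
    show "x \<in> ?L"
    proof (cases "i < j")
      case True
      then show ?thesis using ord[OF x(2-5)] x(1) by simp
    next
      case False
      then show ?thesis using ord[OF x(3,2,5,4)] x(1,6) by (simp add: add.commute)
    qed
  qed
qed

lemma grid_root_grid_image:
  "grid_root d e ` grid n \<union> uminus ` grid_root d e ` grid n
   = grid_root d e ` off_diagonal n \<union> uminus ` grid_root d e ` off_diagonal n
     \<union> {(s * d) *\<^sub>R e i | s i. s \<in> {1, -1} \<and> i \<in> {1..n}}"
proof -
  have g: "grid n = off_diagonal n \<union> (\<lambda>i. (i, i)) ` {1..n}"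
    by (auto simp: grid_def off_diagonal_def)
  have "{(s * d) *\<^sub>R e i | s i. s \<in> {1, -1} \<and> i \<in> {1..n}}
    = (\<lambda>i. (1 * d) *\<^sub>R e i) ` {1..n} \<union> (\<lambda>i. (-1 * d) *\<^sub>R e i) ` {1..n}"
    by blast
  then show ?thesis unfolding g by (simp add: image_Un image_image grid_root_simps Un_ac)
qed

text \<open>The coefficient of \<open>e c\<close> in the root of a cell, the diagonal multiple being \<open>d\<close>.\<close>

definition coeff :: "int \<Rightarrow> nat \<Rightarrow> nat \<times> nat \<Rightarrow> int" where
  "coeff d c = (\<lambda>(i, j). if i < j then of_bool (c = i) - of_bool (c = j)
     else if j < i then of_bool (c = i) + of_bool (c = j) else d * of_bool (c = i))"

lemma inner_grid_root_upper:
  assumes "frame n N e" "c \<in> {1..n}" "x \<in> upper n"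
  shows "e c \<bullet> grid_root d e x = N * of_int (coeff d' c x)"
  using assms frame_inner[OF assms(1) _ _ assms(2)]
  by (auto simp: upper_def grid_root_def coeff_def)

lemma inner_grid_root:
  assumes "orthogonal_frame n N e" "c \<in> {1..n}" "x \<in> grid n"
  shows "e c \<bullet> grid_root (of_int d) e x = N * of_int (coeff d c x)"
  using assms orthogonal_frame_inner[OF assms(1,2)]
  by (auto simp: grid_def grid_root_def coeff_def inner_diff_right inner_add_right algebra_simps)

text \<open>A difference has coefficients of both signs, a sum two equal ones and a diagonal root only one, so
  the shape of the root and its indices are visible in the coefficients even up to a common sign.\<close>

lemma coeff_inj:
  assumes "x \<in> grid n" "y \<in> grid n" "0 < d"
    and "(\<forall>c\<in>{1..n}. coeff d c x = coeff d c y) \<or> (\<forall>c\<in>{1..n}. coeff d c x = - coeff d c y)"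
  shows "x = y"
proof -
  obtain i j k l where xy: "x = (i, j)" "y = (k, l)" by (cases x, cases y)
  have "i \<in> {1..n}" "j \<in> {1..n}" "k \<in> {1..n}" "l \<in> {1..n}" using assms(1,2) by (auto simp: grid_def xy)
  then have "(\<forall>c\<in>{i,j,k,l}. coeff d c (i, j) = coeff d c (k, l)) \<or>
    (\<forall>c\<in>{i,j,k,l}. coeff d c (i, j) = - coeff d c (k, l))"
    using assms(4) unfolding xy by blast
  then show ?thesis unfolding xy using assms(3)
    by (cases i j rule: linorder_cases; cases k l rule: linorder_cases)
       (auto simp: coeff_def of_bool_def split: if_splits)
qed

section \<open>Balanced pieces of the grid\<close>

lemma sum_upper_Suc:
  "sum g (upper (Suc n)) = sum g (upper n) + (\<Sum>i\<in>{1..n}. g (i, Suc n))"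
proof -
  have "upper (Suc n) = upper n \<union> (\<lambda>i. (i, Suc n)) ` {1..n}"
    by (auto simp: upper_def)
  moreover have "upper n \<inter> (\<lambda>i. (i, Suc n)) ` {1..n} = {}" by (auto simp: upper_def)
  ultimately show ?thesis by (simp add: sum.union_disjoint sum.reindex inj_on_def)
qed

lemma sum_off_diagonal_Suc:
  "sum g (off_diagonal (Suc n)) = sum g (off_diagonal n) + (\<Sum>i\<in>{1..n}. g (i, Suc n) + g (Suc n, i))"
proof -
  let ?A = "(\<lambda>i. (i, Suc n)) ` {1..n}" and ?B = "(\<lambda>i. (Suc n, i)) ` {1..n}"
  have "off_diagonal (Suc n) = off_diagonal n \<union> (?A \<union> ?B)"
    by (auto simp: off_diagonal_def)
  moreover have "off_diagonal n \<inter> (?A \<union> ?B) = {}" "?A \<inter> ?B = {}" by (auto simp: off_diagonal_def)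
  ultimately show ?thesis by (simp add: sum.union_disjoint sum.reindex inj_on_def sum.distrib)
qed

lemma sum_grid: "sum g (grid n) = sum g (off_diagonal n) + (\<Sum>i\<in>{1..n}. g (i, i))"
proof -
  let ?A = "(\<lambda>i. (i, i)) ` {1..n}"
  have "grid n = off_diagonal n \<union> ?A" by (auto simp: grid_def off_diagonal_def)
  moreover have "off_diagonal n \<inter> ?A = {}" by (auto simp: off_diagonal_def)
  ultimately show ?thesis by (simp add: sum.union_disjoint sum.reindex inj_on_def)
qed

text \<open>In the complete graph of type A, the edges joining a pair \<open>x, x + 1\<close> to a pair \<open>a, b\<close> form a
  four-cycle, and traversing a cycle gives a vanishing signed sum.\<close>

lemma four_cycles_null:
  assumes "l + 2 * k \<le> a" "l + 2 * k \<le> b" "a \<noteq> b"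
  shows "signed_null ({l..<l + 2 * k} \<times> {a, b}) (grid_root d e)"
  using assms
proof (induction k)
  case 0
  then show ?case by (simp add: signed_null_empty)
next
  case (Suc k)
  let ?x = "l + 2 * k" and ?y = "Suc (l + 2 * k)"
  have "signed_null ({(?x, a), (?y, b)} \<union> {(?x, b), (?y, a)}) (grid_root d e)"
    by (rule signed_null_eq_sums) (use Suc.prems in \<open>auto simp: grid_root_simps\<close>)
  then have "signed_null ({l..<l + 2 * k} \<times> {a, b} \<union> ({(?x, a), (?y, b)} \<union> {(?x, b), (?y, a)})) (grid_root d e)"
    by (rule signed_null_Un[rotated]) (use Suc in auto)
  moreover have "{l..<l + 2 * k} \<times> {a, b} \<union> ({(?x, a), (?y, b)} \<union> {(?x, b), (?y, a)})
      = {l..<l + 2 * Suc k} \<times> {a, b}"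
  proof -
    have "{l..<l + 2 * Suc k} = insert ?y (insert ?x {l..<l + 2 * k})" by auto
    then show ?thesis by auto
  qed
  ultimately show ?case by simp
qed

definition cross :: "nat \<Rightarrow> nat \<Rightarrow> nat \<Rightarrow> (nat \<times> nat) set" where
  "cross n a b = {1..n} \<times> {a, b} \<union> {a, b} \<times> {1..n}"

lemma finite_cross [simp]: "finite (cross n a b)"
  by (simp add: cross_def)

text \<open>For each \<open>i\<close>, the four roots \<open>e i \<plusminus> e a\<close> and \<open>e i \<plusminus> e b\<close> are balanced: both pairs add up
  to \<open>2 *\<^sub>R e i\<close>. So enlarging the square by an even number of coordinates leaves only the new
  diagonal block to be balanced.\<close>

lemma cross_null:
  assumes "n < a" "n < b" "a \<noteq> b"
  shows "signed_null (cross n a b) (grid_root d e)"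
proof -
  have "cross n a b = (\<Union>i\<in>{1..n}. {(i, a), (a, i)} \<union> {(i, b), (b, i)})"
    by (auto simp: cross_def)
  moreover have "signed_null \<dots> (grid_root d e)"
  proof (rule signed_null_UN)
    fix i assume "i \<in> {1..n}"
    then show "signed_null ({(i, a), (a, i)} \<union> {(i, b), (b, i)}) (grid_root d e)"
      using assms by (intro signed_null_eq_sums) (auto simp: grid_root_simps)
  qed (use assms in auto)
  ultimately show ?thesis by simp
qed

text \<open>Pairs of consecutive indices, counted from the top; for odd \<open>n\<close> the index 1 stays unmatched.\<close>

fun matching :: "nat \<Rightarrow> (nat \<times> nat) set" where
  "matching 0 = {}"
| "matching (Suc 0) = {}"
| "matching (Suc (Suc n)) = insert (Suc n, Suc (Suc n)) (matching n)"

lemma matching_upper: "matching n \<subseteq> upper n"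
  by (induction n rule: matching.induct) (auto simp: upper_def)

lemma matching_range:
  "(i, j) \<in> matching n \<Longrightarrow> 1 \<le> i \<and> i < j \<and> j \<le> n \<and> (odd n \<longrightarrow> 1 < i)"
proof (induction n rule: matching.induct)
  case (3 n)
  then show ?case by (cases n) auto
qed auto

lemma finite_matching [simp]: "finite (matching n)"
  by (rule finite_subset[OF matching_upper]) simp

lemma card_matching: "card (matching n) = n div 2"
proof (induction n rule: matching.induct)
  case (3 n)
  moreover have "(Suc n, Suc (Suc n)) \<notin> matching n" using matching_range by force
  ultimately show ?case by simp
qed simp_all

lemma matching_disjoint:
  "(i, j) \<in> matching n \<Longrightarrow> (k, l) \<in> matching n \<Longrightarrow> (i, j) \<noteq> (k, l) \<Longrightarrow> {i, j} \<inter> {k, l} = {}"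
proof (induction n rule: matching.induct)
  case (3 n)
  then show ?case using matching_range[of i j n] matching_range[of k l n] by auto
qed simp_all

lemma upper_Suc_Suc:
  "upper (Suc (Suc n)) = upper n \<union> {1..n} \<times> {Suc n, Suc (Suc n)} \<union> {(Suc n, Suc (Suc n))}"
  by (auto simp: upper_def)

lemma grid_Suc_Suc:
  "grid (Suc (Suc n)) = grid n \<union> cross n (Suc n) (Suc (Suc n)) \<union> {Suc n, Suc (Suc n)} \<times> {Suc n, Suc (Suc n)}"
proof -
  have "{1..Suc (Suc n)} = {1..n} \<union> {Suc n, Suc (Suc n)}" by auto
  then show ?thesis unfolding grid_def cross_def by blast
qed

lemma grid_add_4:
  fixes m :: nat
  defines "V \<equiv> {m + 1, m + 2, m + 3, m + 4}"
  shows "grid (m + 4) = grid m \<union> cross m (m + 1) (m + 2) \<union> cross m (m + 3) (m + 4) \<union> V \<times> V"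
    "(cross m (m + 1) (m + 2) \<union> cross m (m + 3) (m + 4) \<union> V \<times> V) \<inter> grid m = {}"
proof -
  have "(W \<union> (A \<union> B)) \<times> (W \<union> (A \<union> B))
      = W \<times> W \<union> (W \<times> A \<union> A \<times> W) \<union> (W \<times> B \<union> B \<times> W) \<union> (A \<union> B) \<times> (A \<union> B)"
    for W A B :: "nat set" by blast
  moreover have "{1..m + 4} = {1..m} \<union> ({m + 1, m + 2} \<union> {m + 3, m + 4})" by auto
  moreover have "{m + 1, m + 2} \<union> {m + 3, m + 4} = V" by (auto simp: V_def)
  ultimately show "grid (m + 4) = grid m \<union> cross m (m + 1) (m + 2) \<union> cross m (m + 3) (m + 4) \<union> V \<times> V"
    unfolding grid_def cross_def by metis
  show "(cross m (m + 1) (m + 2) \<union> cross m (m + 3) (m + 4) \<union> V \<times> V) \<inter> grid m = {}"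
    by (auto simp: grid_def cross_def V_def)
qed

lemma off_diagonal_grid: "off_diagonal n = grid n \<inter> {(x, y). x \<noteq> y}"
  by (auto simp: off_diagonal_def grid_def)

text \<open>The complete graph on an even number of vertices without a perfect matching is a union of the
  four-cycles between matched pairs.\<close>

lemma upper_minus_matching_null:
  "even n \<Longrightarrow> signed_null (upper n - matching n) (grid_root d e)"
proof (induction n rule: matching.induct)
  case (3 n)
  let ?a = "Suc n" and ?b = "Suc (Suc n)"
  have new: "(?a, ?b) \<notin> upper n" "upper n \<inter> {1..n} \<times> {?a, ?b} = {}" "(?a, ?b) \<notin> {1..n} \<times> {?a, ?b}"
    by (auto simp: upper_def)
  then have split: "upper ?b - matching ?b = (upper n - matching n) \<union> {1..n} \<times> {?a, ?b}"
    using matching_upper[of n] unfolding upper_Suc_Suc matching.simps by blast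
  have "{1..<1 + 2 * (n div 2)} = {1..n}" using 3(2) by auto
  then have "signed_null ({1..n} \<times> {?a, ?b}) (grid_root d e)"
    using four_cycles_null[of 1 "n div 2" ?a ?b d e] 3(2) by simp
  then show ?case
    unfolding split using 3 new(2) by (intro signed_null_Un) auto
qed (simp_all add: upper_def signed_null_empty)

text \<open>With an odd number of vertices each matched edge is used instead, in the triangle that it forms
  with vertex 1.\<close>

lemma upper_null:
  "odd n \<Longrightarrow> signed_null (upper n) (grid_root d e)"
proof (induction n rule: matching.induct)
  case 2
  have "upper (Suc 0) = {}" by (auto simp: upper_def)
  then show ?case by (simp add: signed_null_empty)
next
  case (3 n)
  let ?a = "Suc n" and ?b = "Suc (Suc n)"
  let ?T = "{(1, ?a), (?a, ?b)} \<union> {(1, ?b)}"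
  have n1: "1 \<le> n" using 3(2) by (cases n) auto
  have "{1..n} = insert 1 {2..n}" using n1 by auto
  then have split: "upper ?b = (upper n \<union> {2..n} \<times> {?a, ?b}) \<union> ?T"
    unfolding upper_Suc_Suc by blast
  have "{2..<2 + 2 * (n div 2)} = {2..n}" using 3(2) by (auto elim!: oddE)
  moreover have "2 + 2 * (n div 2) \<le> ?a" using 3(2) by (auto elim!: oddE)
  ultimately have cycles: "signed_null ({2..n} \<times> {?a, ?b}) (grid_root d e)"
    using four_cycles_null[of 2 "n div 2" ?a ?b d e] by simp
  have triangle: "signed_null ?T (grid_root d e)"
    using n1 by (intro signed_null_eq_sums) (auto simp: grid_root_simps)
  have disj: "upper n \<inter> {2..n} \<times> {?a, ?b} = {}" "(upper n \<union> {2..n} \<times> {?a, ?b}) \<inter> ?T = {}"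
    by (auto simp: upper_def)
  have "signed_null (upper n) (grid_root d e)" using 3 by simp
  then show ?case
    unfolding split using cycles triangle disj
    by (intro signed_null_Un[OF signed_null_Un, of _ _ _ ?T]) (simp_all only: finite_grid finite_cartesian_product finite_Un finite.emptyI finite_insert finite_atLeastAtMost)
qed simp

text \<open>The omitted roots of type B: one long root for each matched pair, and the short root at the
  unmatched index.\<close>

definition B_removed :: "nat \<Rightarrow> (nat \<times> nat) set" where
  "B_removed n = matching n \<union> (if odd n then {(1, 1)} else {})"

lemma B_removed_grid: "B_removed n \<subseteq> grid n"
  using matching_upper[of n] by (auto simp: B_removed_def grid_def upper_def elim!: oddE)

lemma grid_minus_B_removed_null:
  "signed_null (grid n - B_removed n) (grid_root 1 e)"
proof (induction n rule: matching.induct)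
  case 2
  have "grid (Suc 0) - B_removed (Suc 0) = {}" by (auto simp: grid_def B_removed_def)
  then show ?case by (simp only: signed_null_empty)
next
  case (3 n)
  let ?a = "Suc n" and ?b = "Suc (Suc n)"
  let ?T = "{(?b, ?a)} \<union> {(?a, ?a), (?b, ?b)}"
  have rem: "B_removed ?b = insert (?a, ?b) (B_removed n)" by (auto simp: B_removed_def)
  have disj: "grid n \<inter> cross n ?a ?b = {}" "grid n \<inter> {?a, ?b} \<times> {?a, ?b} = {}"
    "cross n ?a ?b \<inter> {?a, ?b} \<times> {?a, ?b} = {}"
    by (auto simp: grid_def cross_def)
  have block: "{?a, ?b} \<times> {?a, ?b} = insert (?a, ?b) ?T" "(?a, ?b) \<notin> ?T" by auto
  have split: "grid ?b - B_removed ?b = ((grid n - B_removed n) \<union> cross n ?a ?b) \<union> ?T"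
  proof -
    have "(G \<union> X \<union> V) - insert p B = ((G - B) \<union> X) \<union> T"
      if "G \<inter> X = {}" "G \<inter> V = {}" "X \<inter> V = {}" "V = insert p T" "p \<notin> T" "B \<subseteq> G"
      for G X V T B :: "(nat \<times> nat) set" and p
      using that by blast
    from this[OF disj block B_removed_grid] show ?thesis unfolding grid_Suc_Suc rem .
  qed
  have "signed_null ?T (grid_root 1 e)"
    by (intro signed_null_eq_sums) (auto simp: grid_root_simps)
  moreover have "((grid n - B_removed n) \<union> cross n ?a ?b) \<inter> ?T = {}"
    by (auto simp: grid_def cross_def)
  moreover have "(grid n - B_removed n) \<inter> cross n ?a ?b = {}" using disj by blast
  ultimately show ?case
    unfolding split using 3 cross_null[of n ?a ?b 1 e]
    by (intro signed_null_Un[OF signed_null_Un, of _ _ _ ?T]) simp_all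
qed (simp add: grid_def signed_null_empty)

text \<open>In a signed sum the roots \<open>e i + e j\<close> and \<open>e i - e j\<close> together contribute \<open>\<plusminus>2 *\<^sub>R e i\<close> or \<open>\<plusminus>2 *\<^sub>R e j\<close>, and
  the root \<open>2 *\<^sub>R e i\<close> contributes \<open>\<plusminus>2 *\<^sub>R e i\<close>. If the sum vanishes, the number of these contributions is even;
  there are \<open>n * (n + 1) div 2\<close> of them, and if this is odd, one is dropped.\<close>

definition C_removed :: "nat \<Rightarrow> (nat \<times> nat) set" where
  "C_removed n = (if n mod 4 = 0 \<or> n mod 4 = 3 then {} else {(1, 1)})"

text \<open>Without the diagonal there are \<open>n * (n - 1) div 2\<close> contributions. If this is odd, the pair of coordinates 1 and 2 is
  dropped, with both its roots.\<close>

definition D_removed :: "nat \<Rightarrow> (nat \<times> nat) set" where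
  "D_removed n = (if n mod 4 = 0 \<or> n mod 4 = 1 then {} else {(1, 2), (2, 1)})"

text \<open>Every coordinate has to receive an even number of contributions. In type C the diagonal contributes
  once to every coordinate, so the six pairs are distributed as 3, 1, 1, 1: \<open>a\<close> takes its three
  pairs, and \<open>b, c, d\<close> share theirs cyclically.\<close>

lemma C_block_null:
  assumes "a < b" "b < c" "c < d"
  shows "signed_null ({a, b, c, d} \<times> {a, b, c, d}) (grid_root 2 e)"
proof -
  have "{a, b, c, d} \<times> {a, b, c, d} =
      {(a, b), (b, a), (a, c), (c, a), (b, c), (c, b), (c, d), (d, c), (d, b)} \<union>
      {(a, d), (d, a), (a, a), (b, b), (c, c), (b, d), (d, d)}" by auto
  moreover have "signed_null \<dots> (grid_root 2 e)"
    by (rule signed_null_eq_sums) (use assms in \<open>auto simp: grid_root_simps algebra_simps scaleR_2\<close>)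
  ultimately show ?thesis by simp
qed

text \<open>In type D there is no diagonal, and the six pairs are distributed as 0, 2, 2, 2: the pairs of \<open>a\<close>
  go to the other end, and \<open>b, c, d\<close> share theirs cyclically.\<close>

lemma D_block_null:
  assumes "a < b" "b < c" "c < d"
  shows "signed_null {(x, y). x \<in> {a, b, c, d} \<and> y \<in> {a, b, c, d} \<and> x \<noteq> y} (grid_root t e)"
proof -
  have "{(x, y). x \<in> {a, b, c, d} \<and> y \<in> {a, b, c, d} \<and> x \<noteq> y} =
      {(b, a), (c, a), (d, a), (b, d)} \<union>
      {(a, b), (a, c), (a, d), (b, c), (c, b), (c, d), (d, c), (d, b)}" using assms by auto
  moreover have "signed_null \<dots> (grid_root t e)"
    by (rule signed_null_eq_sums) (use assms in \<open>auto simp: grid_root_simps algebra_simps\<close>)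
  ultimately show ?thesis by simp
qed

text \<open>Four new coordinates at a time: the crosses with the old coordinates and the new block are balanced.\<close>

lemma grid_minus_C_removed_null:
  "signed_null (grid n - C_removed n) (grid_root 2 e)"
proof (induction n rule: less_induct)
  case (less n)
  have "n = 0 \<or> n = 1 \<or> n = 2 \<or> n = 3 \<or> n = (n - 4) + 4" by linarith
  then consider "n = 0" | "n = 1" | "n = 2" | "n = 3" | m where "n = m + 4" by blast
  then show ?case
  proof cases
    case 1
    then show ?thesis by (simp add: grid_def signed_null_empty)
  next
    case 2
    then have "grid n - C_removed n = {}" by (auto simp: grid_def C_removed_def)
    then show ?thesis by (simp only: signed_null_empty)
  next
    case 3
    have "grid n - C_removed n = {(2, 1)} \<union> {(1, 2), (2, 2)}" unfolding 3
      by (auto simp: grid_def C_removed_def)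
    moreover have "signed_null \<dots> (grid_root 2 e)"
      by (rule signed_null_eq_sums) (auto simp: grid_root_simps scaleR_2)
    ultimately show ?thesis by simp
  next
    case 4
    have "grid n - C_removed n = {(1, 2), (2, 1), (2, 3), (3, 2), (3, 1)} \<union> {(1, 1), (2, 2), (1, 3), (3, 3)}"
    proof -
      have "{1..3} = {1, 2, 3::nat}" by auto
      then show ?thesis unfolding 4 grid_def C_removed_def by simp blast
    qed
    moreover have "signed_null \<dots> (grid_root 2 e)"
      by (rule signed_null_eq_sums) (auto simp: grid_root_simps scaleR_2)
    ultimately show ?thesis by simp
  next
    case 5
    let ?V = "{m + 1, m + 2, m + 3, m + 4}"
    have r: "C_removed n = C_removed m" "C_removed m \<subseteq> grid m" unfolding 5
      by (auto simp: C_removed_def grid_def)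
    have "grid n - C_removed n
        = (grid m - C_removed m) \<union> cross m (m + 1) (m + 2) \<union> cross m (m + 3) (m + 4) \<union> ?V \<times> ?V"
    proof -
      have "G \<union> X \<union> Y \<union> Z - K = (G - K) \<union> X \<union> Y \<union> Z"
        if "(X \<union> Y \<union> Z) \<inter> G = {}" "K \<subseteq> G" for G X Y Z K :: "(nat \<times> nat) set"
        using that by blast
      from this[OF grid_add_4(2) r(2)] show ?thesis unfolding r(1) unfolding 5 grid_add_4(1) .
    qed

    moreover have "signed_null \<dots> (grid_root 2 e)"
      by (intro signed_null_Un less C_block_null cross_null)
         (use 5 in \<open>auto simp: grid_def cross_def\<close>)
    ultimately show ?thesis by simp
  qed
qed

lemma off_diagonal_minus_D_removed_null:
  "signed_null (off_diagonal n - D_removed n) (grid_root t e)"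
proof (induction n rule: less_induct)
  case (less n)
  have "n = 0 \<or> n = 1 \<or> n = 2 \<or> n = 3 \<or> n = (n - 4) + 4" by linarith
  then consider "n = 0" | "n = 1" | "n = 2" | "n = 3" | m where "n = m + 4" by blast
  then show ?case
  proof cases
    case 1
    then show ?thesis by (simp add: off_diagonal_def signed_null_empty)
  next
    case 2
    then have "off_diagonal n - D_removed n = {}" by (auto simp: off_diagonal_def)
    then show ?thesis by (simp only: signed_null_empty)
  next
    case 3
    then have "off_diagonal n - D_removed n = {}" by (auto simp: off_diagonal_def D_removed_def)
    then show ?thesis by (simp only: signed_null_empty)
  next
    case 4
    have "off_diagonal n - D_removed n = {(3, 1), (2, 3)} \<union> {(1, 3), (3, 2)}"
    proof -
      have "{1..3} = {1, 2, 3::nat}" by auto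
      then have "off_diagonal 3 = {(1, 2), (2, 1), (3, 1), (2, 3), (1, 3), (3, 2)}"
        unfolding off_diagonal_def by auto
      then show ?thesis unfolding 4 D_removed_def by auto
    qed
    moreover have "signed_null \<dots> (grid_root t e)"
      by (rule signed_null_eq_sums) (auto simp: grid_root_simps)
    ultimately show ?thesis by simp
  next
    case 5
    let ?V = "{m + 1, m + 2, m + 3, m + 4}"
    have "2 \<le> m" if "m mod 4 \<noteq> 0" "m mod 4 \<noteq> 1"
      using that by (cases "m = 0"; cases "m = 1") auto
    then have r: "D_removed n = D_removed m" "D_removed m \<subseteq> off_diagonal m"
      by (simp_all add: 5 D_removed_def off_diagonal_def) linarith
    have "off_diagonal n - D_removed n
        = (off_diagonal m - D_removed m) \<union> cross m (m + 1) (m + 2) \<union> cross m (m + 3) (m + 4)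
          \<union> {(x, y). x \<in> ?V \<and> y \<in> ?V \<and> x \<noteq> y}"
    proof -
      have "(G \<union> X \<union> Y \<union> Z) \<inter> D - K = (G \<inter> D - K) \<union> X \<union> Y \<union> (Z \<inter> D)"
        if "X \<subseteq> D" "Y \<subseteq> D" "(X \<union> Y \<union> Z) \<inter> G = {}" "K \<subseteq> G \<inter> D" for G X Y Z D K :: "(nat \<times> nat) set"
        using that by blast
      note split = this
      have "cross m (m + 1) (m + 2) \<subseteq> {(x, y). x \<noteq> y}" "cross m (m + 3) (m + 4) \<subseteq> {(x, y). x \<noteq> y}"
        by (auto simp: cross_def)
      from split[OF this grid_add_4(2) r(2)[unfolded off_diagonal_grid]]
      have "grid n \<inter> {(x, y). x \<noteq> y} - D_removed n
        = (grid m \<inter> {(x, y). x \<noteq> y} - D_removed m) \<union> cross m (m + 1) (m + 2) \<union> cross m (m + 3) (m + 4)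
          \<union> (?V \<times> ?V \<inter> {(x, y). x \<noteq> y})"
        unfolding r(1) unfolding 5 grid_add_4(1) .
      moreover have "V \<times> V \<inter> {(x, y). x \<noteq> y} = {(x, y). x \<in> V \<and> y \<in> V \<and> x \<noteq> y}" for V :: "nat set"
        by blast
      ultimately show ?thesis unfolding off_diagonal_grid by (simp only:)
    qed
    moreover have "finite {(x, y). x \<in> ?V \<and> y \<in> ?V \<and> x \<noteq> y}"
      by (rule finite_subset[of _ "?V \<times> ?V"]) auto
    then have "signed_null ((off_diagonal m - D_removed m) \<union> cross m (m + 1) (m + 2) \<union> cross m (m + 3) (m + 4)
          \<union> {(x, y). x \<in> ?V \<and> y \<in> ?V \<and> x \<noteq> y}) (grid_root t e)"
      by (intro signed_null_Un less D_block_null cross_null finite_UnI finite_cross finite_Diff finite_grid)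
         (use 5 in \<open>auto simp: off_diagonal_def cross_def\<close>)
    ultimately show ?thesis by simp
  qed
qed

section \<open>Parities\<close>

lemma sum_coeff_upper:
  assumes "1 \<le> c"
  shows "(\<Sum>x\<in>upper n. coeff d c x) = (if c \<le> n then int n + 1 - 2 * int c else 0)"
proof (induction n)
  case 0
  then show ?case using assms by (simp add: upper_def)
next
  case (Suc n)
  have "(\<Sum>i\<in>{1..n}. coeff d c (i, Suc n)) = (\<Sum>i\<in>{1..n}. of_bool (c = i) - of_bool (c = Suc n))"
    by (rule sum.cong) (auto simp: coeff_def)
  also have "\<dots> = of_bool (c \<le> n) - int n * of_bool (c = Suc n)"
    using assms by (auto simp: sum_subtractf of_bool_def)
  finally show ?case using Suc by (auto simp: sum_upper_Suc)
qed

lemma even_sum_coeff_off_diagonal: "even (\<Sum>x\<in>off_diagonal n. coeff d c x)"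
proof (induction n)
  case 0
  then show ?case by (simp add: off_diagonal_def)
next
  case (Suc n)
  have "(\<Sum>i\<in>{1..n}. coeff d c (i, Suc n) + coeff d c (Suc n, i)) = (\<Sum>i\<in>{1..n}. 2 * of_bool (c = i))"
    by (rule sum.cong) (auto simp: coeff_def)
  then show ?case using Suc by (simp add: sum_off_diagonal_Suc sum_distrib_left[symmetric])
qed

lemma even_sum_coeff_grid:
  assumes "c \<in> {1..n}"
  shows "even (\<Sum>x\<in>grid n. coeff d c x) \<longleftrightarrow> even d"
proof -
  have "(\<Sum>i\<in>{1..n}. coeff d c (i, i)) = (\<Sum>i\<in>{1..n}. if c = i then d else 0)"
    by (rule sum.cong) (auto simp: coeff_def)
  also have "\<dots> = d" using assms by simp
  finally show ?thesis using even_sum_coeff_off_diagonal[of d c n] by (simp add: sum_grid)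
qed

text \<open>Half the sum of all coefficients for \<open>d = 2\<close>. It is an integer on the roots of types C and D, since their
  coefficient sums are even, and it is the functional that obstructs balancedness there.\<close>

definition half_total :: "nat \<times> nat \<Rightarrow> int" where
  "half_total = (\<lambda>(i, j). if i < j then 0 else 1)"

lemma sum_coeff_2:
  assumes "x \<in> grid n"
  shows "(\<Sum>c\<in>{1..n}. coeff 2 c x) = 2 * half_total x"
proof -
  obtain i j where x: "x = (i, j)" "i \<in> {1..n}" "j \<in> {1..n}" using assms by (auto simp: grid_def)
  have one: "(\<Sum>c\<in>{1..n}. of_bool (c = k)) = (1::int)" if "k \<in> {1..n}" for k
    using that by (simp add: of_bool_def)
  consider "i < j" | "j < i" | "i = j" by linarith
  then show ?thesis
  proof cases
    case 1
    then have "(\<Sum>c\<in>{1..n}. coeff 2 c x) = (\<Sum>c\<in>{1..n}. of_bool (c = i) - of_bool (c = j))"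
      by (simp add: x(1) coeff_def)
    then show ?thesis using 1 one x by (simp add: sum_subtractf half_total_def)
  next
    case 2
    then have "(\<Sum>c\<in>{1..n}. coeff 2 c x) = (\<Sum>c\<in>{1..n}. of_bool (c = i) + of_bool (c = j))"
      by (simp add: x(1) coeff_def)
    then show ?thesis using 2 one x by (simp add: sum.distrib half_total_def)
  next
    case 3
    then have "(\<Sum>c\<in>{1..n}. coeff 2 c x) = (\<Sum>c\<in>{1..n}. 2 * of_bool (c = i))"
      by (simp add: x(1) coeff_def)
    then show ?thesis using 3 one[OF x(2)] x(1) by (simp only: sum_distrib_left[symmetric]) (simp add: half_total_def)
  qed
qed

lemma even_sum_half_total_off_diagonal:
  "even (\<Sum>x\<in>off_diagonal n. half_total x) \<longleftrightarrow> n mod 4 = 0 \<or> n mod 4 = 1"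
proof (induction n)
  case 0
  then show ?case by (simp add: off_diagonal_def)
next
  case (Suc n)
  have "(\<Sum>i\<in>{1..n}. half_total (i, Suc n) + half_total (Suc n, i)) = (\<Sum>i\<in>{1..n}. 1)"
    by (rule sum.cong) (auto simp: half_total_def)
  then have "even (\<Sum>x\<in>off_diagonal (Suc n). half_total x) \<longleftrightarrow> ((n mod 4 = 0 \<or> n mod 4 = 1) \<longleftrightarrow> even n)"
    using Suc by (simp add: sum_off_diagonal_Suc)
  also have "\<dots> \<longleftrightarrow> Suc n mod 4 = 0 \<or> Suc n mod 4 = 1" by presburger
  finally show ?case .
qed

lemma even_sum_half_total_grid:
  "even (\<Sum>x\<in>grid n. half_total x) \<longleftrightarrow> n mod 4 = 0 \<or> n mod 4 = 3"
proof -
  have "(\<Sum>i\<in>{1..n}. half_total (i, i)) = int n" by (simp add: half_total_def)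
  then have "even (\<Sum>x\<in>grid n. half_total x) \<longleftrightarrow> ((n mod 4 = 0 \<or> n mod 4 = 1) \<longleftrightarrow> even n)"
    using even_sum_half_total_off_diagonal[of n] by (simp add: sum_grid)
  also have "\<dots> \<longleftrightarrow> n mod 4 = 0 \<or> n mod 4 = 3" by presburger
  finally show ?thesis .
qed

lemma linear_inner_right: "linear (\<lambda>v. (u \<bullet> v) / N)"
  by (rule linearI) (simp_all add: inner_add_right add_divide_distrib)

text \<open>For even \<open>n\<close>, every coordinate has an odd sum over the positive roots of type A, so the omitted
  roots must involve every coordinate.\<close>

lemma upper_complement_parity:
  assumes F: "frame n N e" and J: "J \<subseteq> upper n" "signed_null J (grid_root d e)" and c: "c \<in> {1..n}"
  shows "even (\<Sum>x\<in>upper n - J. coeff 1 c x) \<longleftrightarrow> odd n"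
proof -
  have N: "0 < N" using F unfolding frame_def by blast
  have "even (\<Sum>x\<in>upper n - J. coeff 1 c x) \<longleftrightarrow> even (\<Sum>x\<in>upper n. coeff 1 c x)"
    by (rule signed_null_parity_complement[OF J(2) _ J(1) linear_inner_right[of "e c" N]])
       (use N inner_grid_root_upper[OF F c, where d = d and d' = 1] in simp_all)
  then show ?thesis using c sum_coeff_upper[of c 1 n] by simp
qed

lemma grid_complement_parity:
  assumes F: "orthogonal_frame n N e" and I: "I \<subseteq> grid n"
    and J: "J \<subseteq> I" "signed_null J (grid_root (of_int d) e)" and c: "c \<in> {1..n}"
  shows "even (\<Sum>x\<in>I - J. coeff d c x) \<longleftrightarrow> even (\<Sum>x\<in>I. coeff d c x)"
proof -
  have N: "0 < N" using F unfolding orthogonal_frame_def by blast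
  have "finite I" using I finite_grid finite_subset by blast
  then show ?thesis
    by (rule signed_null_parity_complement[OF J(2) _ J(1) linear_inner_right[of "e c" N]])
       (use N I inner_grid_root[OF F c] in auto)
qed

lemma half_total_complement_parity:
  assumes F: "orthogonal_frame n N e" and I: "I \<subseteq> grid n"
    and J: "J \<subseteq> I" "signed_null J (grid_root 2 e)"
  shows "even (\<Sum>x\<in>I - J. half_total x) \<longleftrightarrow> even (\<Sum>x\<in>I. half_total x)"
proof -
  have N: "0 < N" using F unfolding orthogonal_frame_def by blast
  have "finite I" using I finite_grid finite_subset by blast
  then show ?thesis
  proof (rule signed_null_parity_complement[OF J(2) _ J(1) linear_inner_right[of "\<Sum>c\<in>{1..n}. e c" "2 * N"]])
    fix x assume x: "x \<in> I"
    have "(\<Sum>c\<in>{1..n}. e c) \<bullet> grid_root 2 e x = (\<Sum>c\<in>{1..n}. N * of_int (coeff 2 c x))"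
      unfolding inner_sum_left
      by (rule sum.cong) (use inner_grid_root[OF F, of _ x 2] x I in auto)
    also have "\<dots> = N * of_int (2 * half_total x)"
    proof -
      have "(\<Sum>c\<in>{1..n}. coeff 2 c x) = 2 * half_total x" using sum_coeff_2 x I by blast
      then show ?thesis by (metis of_int_sum sum_distrib_left)
    qed
    finally show "(\<Sum>c\<in>{1..n}. e c) \<bullet> grid_root 2 e x / (2 * N) = of_int (half_total x)"
      using N by simp
  qed
qed

text \<open>If every coordinate has odd sum over \<open>K\<close>, each of the \<open>n\<close> coordinates occurs in a root of \<open>K\<close>,
  and a root involves at most two coordinates.\<close>

lemma card_le_double_card:
  assumes "finite K" and hit: "\<And>c. c \<in> {1..n} \<Longrightarrow> odd (\<Sum>x\<in>K. coeff d c x)"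
  shows "n \<le> 2 * card K"
proof -
  have "{1..n} \<subseteq> (\<Union>x\<in>K. {fst x, snd x})"
  proof
    fix c assume "c \<in> {1..n}"
    then have "\<exists>x\<in>K. odd (coeff d c x)" using hit by (metis dvd_sum)
    then obtain x where "x \<in> K" "coeff d c x \<noteq> 0" by (metis even_zero)
    then show "c \<in> (\<Union>x\<in>K. {fst x, snd x})"
      by (cases x) (force simp: coeff_def split: if_splits)
  qed
  moreover have "card (\<Union>x\<in>K. {fst x, snd x}) \<le> (\<Sum>x\<in>K. card {fst x, snd x})"
    by (rule card_UN_le[OF assms(1)])
  moreover have "(\<Sum>x\<in>K. card {fst x, snd x}) \<le> (\<Sum>x\<in>K. 2)"
    by (rule sum_mono) (simp add: card_insert_if)
  moreover have "finite (\<Union>x\<in>K. {fst x, snd x})" using assms(1) by simp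
  ultimately have "card {1..n} \<le> (\<Sum>x\<in>K. 2)" by (meson card_mono le_trans)
  then show ?thesis by simp
qed

section \<open>Frames from Dynkin diagrams\<close>

lemma path_edges_iff:
  "{i, j} \<in> path_edges a b \<longleftrightarrow> (j = Suc i \<and> a \<le> i \<and> i < b) \<or> (i = Suc j \<and> a \<le> j \<and> j < b)"
  unfolding path_edges_def by (auto simp: doubleton_eq_iff)

lemma inner_from_cartan: "\<beta> \<noteq> 0 \<Longrightarrow> cartan_number \<alpha> \<beta> = c \<Longrightarrow> \<alpha> \<bullet> \<beta> = c * (\<beta> \<bullet> \<beta>) / 2"
  by (auto simp: cartan_number_def)

text \<open>The inner products of the simple roots along a path of single edges. The squared norm is written \<open>2 * N\<close>
  because these roots become differences \<open>e a - e b\<close> of a frame with constant \<open>N\<close>.\<close>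

definition chain_gram :: "nat \<Rightarrow> real \<Rightarrow> (nat \<Rightarrow> 'a::euclidean_space) \<Rightarrow> bool" where
  "chain_gram n N \<alpha> \<longleftrightarrow> 0 < N \<and> (\<forall>i\<in>{1..n}. \<forall>j\<in>{1..n}.
     \<alpha> i \<bullet> \<alpha> j = N * (2 * of_bool (i = j) - of_bool (j = Suc i) - of_bool (i = Suc j)))"

text \<open>Across a single edge both Cartan numbers are \<open>-1\<close>, so neighbours have equal norm.\<close>

lemma chain_gramI:
  assumes nz: "\<And>i. i \<in> {1..n} \<Longrightarrow> \<alpha> i \<noteq> 0" and n: "1 \<le> n"
    and cart: "\<And>i j. i \<in> {1..n} \<Longrightarrow> j \<in> {1..n} \<Longrightarrow>
      cartan_number (\<alpha> i) (\<alpha> j) = 2 * of_bool (i = j) - of_bool (j = Suc i) - of_bool (i = Suc j)"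
  obtains N where "chain_gram n N \<alpha>"
proof -
  define N where "N = \<alpha> 1 \<bullet> \<alpha> 1 / 2"
  have norm: "\<alpha> i \<bullet> \<alpha> i = 2 * N" if "1 \<le> i" "i \<le> n" for i
    using that
  proof (induction i rule: dec_induct)
    case base
    then show ?case by (simp add: N_def)
  next
    case (step i)
    have "\<alpha> i \<bullet> \<alpha> (Suc i) = -1 * (\<alpha> (Suc i) \<bullet> \<alpha> (Suc i)) / 2"
      by (rule inner_from_cartan) (use step nz cart[of i "Suc i"] in auto)
    moreover have "\<alpha> (Suc i) \<bullet> \<alpha> i = -1 * (\<alpha> i \<bullet> \<alpha> i) / 2"
      by (rule inner_from_cartan) (use step nz cart[of "Suc i" i] in auto)
    ultimately show ?case using step by (simp add: inner_commute)
  qed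
  have "chain_gram n N \<alpha>" unfolding chain_gram_def
  proof (intro conjI ballI)
    show "0 < N" using nz[of 1] n by (simp add: N_def)
    fix i j assume ij: "i \<in> {1..n}" "j \<in> {1..n}"
    have "\<alpha> i \<bullet> \<alpha> j = (2 * of_bool (i = j) - of_bool (j = Suc i) - of_bool (i = Suc j)) * (\<alpha> j \<bullet> \<alpha> j) / 2"
      by (rule inner_from_cartan[OF nz[OF ij(2)] cart[OF ij]])
    then show "\<alpha> i \<bullet> \<alpha> j = N * (2 * of_bool (i = j) - of_bool (j = Suc i) - of_bool (i = Suc j))"
      using norm[of j] ij(2) by simp
  qed
  then show thesis by (rule that)
qed

lemma frameI:
  assumes N: "0 < N"
    and step: "\<And>c l. c \<in> {1..n} \<Longrightarrow> 1 \<le> l \<Longrightarrow> l < n \<Longrightarrow>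
      e c \<bullet> (e l - e (Suc l)) = N * (of_bool (c = l) - of_bool (c = Suc l))"
  shows "frame n N e"
proof -
  have "e c \<bullet> (e a - e b) = N * (of_bool (c = a) - of_bool (c = b))"
    if c: "c \<in> {1..n}" and ab: "a \<in> {1..n}" "b \<in> {1..n}" for a b c
  proof -
    have const: "e c \<bullet> e a - N * of_bool (c = a) = e c \<bullet> e 1 - N * of_bool (c = 1)" if "1 \<le> a" "a \<le> n" for a
      using that
    proof (induction a rule: dec_induct)
      case (step a)
      then show ?case using assms(2)[OF c, of a] by (simp add: inner_diff_right algebra_simps)
    qed simp
    show ?thesis using const[of a] const[of b] ab by (simp add: inner_diff_right algebra_simps)
  qed
  then show ?thesis using N unfolding frame_def by blast
qed

text \<open>Partial sums of the simple roots give vectors \<open>p c\<close> with the right differences. Their inner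
  products with \<open>\<alpha> l\<close> are off from the desired ones by an amount independent of \<open>c\<close>, because
  taking differences in \<open>c\<close> reproduces the Gram matrix. As the desired inner products sum to zero over \<open>c\<close>,
  that amount is the inner product with the mean of the \<open>p c\<close>; subtracting the mean corrects it.\<close>

lemma chain_frame:
  assumes "chain_gram n N \<alpha>"
  obtains e where "frame (Suc n) N e" "\<And>i. i \<in> {1..n} \<Longrightarrow> \<alpha> i = e i - e (Suc i)"
proof -
  have N: "0 < N" and gram: "\<And>i j. i \<in> {1..n} \<Longrightarrow> j \<in> {1..n} \<Longrightarrow>
     \<alpha> i \<bullet> \<alpha> j = N * (2 * of_bool (i = j) - of_bool (j = Suc i) - of_bool (i = Suc j))"
    using assms unfolding chain_gram_def by blast+
  define p where "p c = - (\<Sum>l\<in>{1..<c}. \<alpha> l)" for c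
  define q where "q = (\<Sum>c\<in>{1..Suc n}. p c) /\<^sub>R (n + 1)"
  define e where "e c = p c - q" for c
  define h where "h c l = N * (of_bool (c = l) - of_bool (c = Suc l))" for c l :: nat
  have p_step: "p c - p (Suc c) = \<alpha> c" if "1 \<le> c" for c
    using that by (simp add: p_def)
  have p_inner: "p c \<bullet> \<alpha> l - h c l = p 1 \<bullet> \<alpha> l - h 1 l" if l: "l \<in> {1..n}" and c: "1 \<le> c" "c \<le> Suc n" for c l
    using c
  proof (induction c rule: dec_induct)
    case (step c)
    have "p (Suc c) = p c - \<alpha> c" using p_step[OF step(1)] by (simp add: algebra_simps)
    then have "p (Suc c) \<bullet> \<alpha> l = p c \<bullet> \<alpha> l - \<alpha> c \<bullet> \<alpha> l" by (simp add: inner_diff_left)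
    moreover have "\<alpha> c \<bullet> \<alpha> l = h c l - h (Suc c) l"
      using gram[of c l] step l by (auto simp: h_def algebra_simps)
    ultimately show ?case using step by simp
  qed simp
  have q_inner: "q \<bullet> \<alpha> l = p 1 \<bullet> \<alpha> l - h 1 l" if l: "l \<in> {1..n}" for l
  proof -
    have "(\<Sum>c\<in>{1..Suc n}. h c l) = N * ((\<Sum>c\<in>{1..Suc n}. of_bool (c = l)) - (\<Sum>c\<in>{1..Suc n}. of_bool (c = Suc l)))"
      unfolding h_def by (simp only: sum_distrib_left[symmetric] sum_subtractf)
    also have "\<dots> = 0"
    proof -
      have "(\<Sum>c\<in>{1..Suc n}. of_bool (c = k)) = (1::real)" if "k \<in> {1..Suc n}" for k
        using that by (simp add: of_bool_def)
      then show ?thesis using l by simp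
    qed
    finally have "(\<Sum>c\<in>{1..Suc n}. p c \<bullet> \<alpha> l) = (\<Sum>c\<in>{1..Suc n}. p c \<bullet> \<alpha> l - h c l)"
      by (simp add: sum_subtractf)
    also have "\<dots> = (\<Sum>c\<in>{1..Suc n}. p 1 \<bullet> \<alpha> l - h 1 l)"
      by (rule sum.cong[OF refl]) (rule p_inner[OF l], simp_all)
    finally have "(\<Sum>c\<in>{1..Suc n}. p c) \<bullet> \<alpha> l = (n + 1) * (p 1 \<bullet> \<alpha> l - h 1 l)"
      unfolding inner_sum_left by simp
    then show ?thesis by (simp add: q_def)
  qed
  have diff: "\<alpha> i = e i - e (Suc i)" if "i \<in> {1..n}" for i
    using p_step[of i] that by (simp add: e_def)
  have "frame (Suc n) N e"
  proof (rule frameI[OF N])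
    fix c l assume cl: "c \<in> {1..Suc n}" "1 \<le> l" "l < Suc n"
    then have "e c \<bullet> \<alpha> l = h c l"
      using p_inner[of l c] q_inner[of l] by (simp add: e_def inner_diff_left)
    then show "e c \<bullet> (e l - e (Suc l)) = N * (of_bool (c = l) - of_bool (c = Suc l))"
      using diff[of l] cl by (simp add: h_def)
  qed
  then show thesis using diff by (rule that)
qed

text \<open>In types B, C and D the last frame vector \<open>u\<close> is available in the span of the roots (as \<open>\<alpha> n\<close>, \<open>\<alpha> n / 2\<close>
  and \<open>(\<alpha> n - \<alpha> (n - 1)) / 2\<close>), and the others follow by adding simple roots.
  The Gram matrix is then that of type B.\<close>

lemma chain_orthogonal_frame:
  assumes "chain_gram m N \<alpha>" "n = Suc m" and last: "u \<bullet> u = N" "\<And>l. l \<in> {1..m} \<Longrightarrow> u \<bullet> \<alpha> l = - N * of_bool (l = m)"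
  obtains e where "orthogonal_frame n N e" "\<And>i. i \<in> {1..m} \<Longrightarrow> \<alpha> i = e i - e (Suc i)" "e n = u"
proof -
  have N: "0 < N" and gram: "\<And>i j. i \<in> {1..m} \<Longrightarrow> j \<in> {1..m} \<Longrightarrow>
     \<alpha> i \<bullet> \<alpha> j = N * (2 * of_bool (i = j) - of_bool (j = Suc i) - of_bool (i = Suc j))"
    using assms(1) unfolding chain_gram_def by blast+
  define e where "e c = u + (\<Sum>l\<in>{c..<n}. \<alpha> l)" for c
  have e_n: "e n = u" by (simp add: e_def)
  have e_step: "e c = e (Suc c) + \<alpha> c" if "c < n" for c
    using that by (simp add: e_def sum.atLeast_Suc_lessThan algebra_simps)
  have e_\<alpha>: "e c \<bullet> \<alpha> l = N * (of_bool (c = l) - of_bool (c = Suc l))"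
    if l: "l \<in> {1..m}" and c: "c \<le> n" "1 \<le> c" for c l
    using c
  proof (induction c rule: inc_induct)
    case base
    show ?case using last(2)[OF l] l assms(2) unfolding e_n by auto
  next
    case (step c)
    then show ?case using e_step[of c] gram[of c l] l assms(2) by (auto simp: inner_add_left algebra_simps)
  qed
  have e_u: "e c \<bullet> u = N * of_bool (c = n)" if c: "c \<le> n" "1 \<le> c" for c
    using c
  proof (induction c rule: inc_induct)
    case base
    then show ?case using last(1) by (simp add: e_n)
  next
    case (step c)
    then show ?case using e_step[of c] last(2)[of c] assms(2) by (auto simp: inner_add_left inner_add_right inner_commute)
  qed
  have "e c \<bullet> e d = N * of_bool (c = d)" if "c \<le> n" "1 \<le> c" "d \<le> n" "1 \<le> d" for c d
    using that(3,4)
  proof (induction d rule: inc_induct)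
    case base
    then show ?case using e_u[of c] that by (simp add: e_n)
  next
    case (step d)
    then show ?case using e_step[of d] e_\<alpha>[of d c] that assms(2) by (auto simp: inner_add_right algebra_simps)
  qed
  then have "orthogonal_frame n N e" using N unfolding orthogonal_frame_def by auto
  moreover have "\<alpha> i = e i - e (Suc i)" if "i \<in> {1..m}" for i
    using e_step[of i] that assms(2) by simp
  ultimately show thesis using e_n by (rule that)
qed

section \<open>Classical root systems in coordinates\<close>

definition pair_roots :: "nat \<Rightarrow> (nat \<Rightarrow> 'a::real_vector) \<Rightarrow> 'a set" where
  "pair_roots n e = grid_root 1 e ` off_diagonal n \<union> uminus ` grid_root 1 e ` off_diagonal n"

definition axis_roots :: "real \<Rightarrow> nat \<Rightarrow> (nat \<Rightarrow> 'a::real_vector) \<Rightarrow> 'a set" where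
  "axis_roots d n e = {(s * d) *\<^sub>R e i | s i. s \<in> {1, -1} \<and> i \<in> {1..n}}"

lemma pair_roots_iff:
  "pair_roots n e = {s *\<^sub>R e i + t *\<^sub>R e j | s t i j. s \<in> {1, -1} \<and> t \<in> {1, -1} \<and> i \<in> {1..n} \<and> j \<in> {1..n} \<and> i \<noteq> j}"
  unfolding pair_roots_def by (rule grid_root_off_diagonal_image)

lemma pair_roots_eq_grid_root:
  "pair_roots n e = grid_root d e ` off_diagonal n \<union> uminus ` grid_root d e ` off_diagonal n"
  unfolding pair_roots_def grid_root_off_diagonal_image ..

text \<open>The reflections of the types B, C and D permute the frame vectors up to sign, which makes the closure of
  the explicit root sets under reflections evident.\<close>

definition signed_permutation :: "nat \<Rightarrow> (nat \<Rightarrow> 'a::real_vector) \<Rightarrow> ('a \<Rightarrow> 'a) \<Rightarrow> bool" where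
  "signed_permutation n e T \<longleftrightarrow> (\<exists>\<pi> s. inj_on \<pi> {1..n} \<and>
     (\<forall>i\<in>{1..n}. \<pi> i \<in> {1..n} \<and> s i \<in> {1, -1::real} \<and> T (e i) = s i *\<^sub>R e (\<pi> i)))"

lemma signed_permutation_pair_roots:
  assumes "signed_permutation n e (reflection \<alpha>)" "x \<in> pair_roots n e"
  shows "reflection \<alpha> x \<in> pair_roots n e"
proof -
  obtain \<pi> s where \<pi>: "inj_on \<pi> {1..n}" and
    s: "\<And>i. i \<in> {1..n} \<Longrightarrow> \<pi> i \<in> {1..n} \<and> s i \<in> {1, -1::real} \<and> reflection \<alpha> (e i) = s i *\<^sub>R e (\<pi> i)"
    using assms(1) unfolding signed_permutation_def by blast
  obtain a b i j where x: "x = a *\<^sub>R e i + b *\<^sub>R e j" "a \<in> {1, -1}" "b \<in> {1, -1}"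
    "i \<in> {1..n}" "j \<in> {1..n}" "i \<noteq> j"
    using assms(2) unfolding pair_roots_iff by blast
  have "reflection \<alpha> x = (a * s i) *\<^sub>R e (\<pi> i) + (b * s j) *\<^sub>R e (\<pi> j)"
    using s[OF x(4)] s[OF x(5)] by (simp add: x(1) reflection_add reflection_scaleR)
  moreover have "a * s i \<in> {1, -1}" "b * s j \<in> {1, -1}" using x(2,3) s[OF x(4)] s[OF x(5)] by auto
  moreover have "\<pi> i \<noteq> \<pi> j" using \<pi> x(4-6) by (meson inj_onD)
  ultimately show ?thesis using s[OF x(4)] s[OF x(5)] unfolding pair_roots_iff by blast
qed

lemma signed_permutation_axis_roots:
  assumes "signed_permutation n e (reflection \<alpha>)" "x \<in> axis_roots d n e"
  shows "reflection \<alpha> x \<in> axis_roots d n e"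
proof -
  obtain \<pi> s where
    s: "\<And>i. i \<in> {1..n} \<Longrightarrow> \<pi> i \<in> {1..n} \<and> s i \<in> {1, -1::real} \<and> reflection \<alpha> (e i) = s i *\<^sub>R e (\<pi> i)"
    using assms(1) unfolding signed_permutation_def by blast
  obtain a i where x: "x = (a * d) *\<^sub>R e i" "a \<in> {1, -1}" "i \<in> {1..n}"
    using assms(2) unfolding axis_roots_def by blast
  have "reflection \<alpha> x = ((a * s i) * d) *\<^sub>R e (\<pi> i)"
    using s[OF x(3)] by (simp add: x(1) reflection_scaleR mult.commute mult.left_commute)
  moreover have "a * s i \<in> {1, -1}" using x(2) s[OF x(3)] by auto
  ultimately show ?thesis using s[OF x(3)] unfolding axis_roots_def by blast
qed

lemma signed_permutation_difference:
  assumes "frame n N e" "a \<in> {1..n}" "b \<in> {1..n}" "a \<noteq> b"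
  shows "signed_permutation n e (reflection (e a - e b))"
  unfolding signed_permutation_def
  by (rule exI[of _ "\<lambda>c. if c = a then b else if c = b then a else c"], rule exI[of _ "\<lambda>_. 1"])
     (use assms reflection_difference[OF assms(1-3) _ assms(4)] in \<open>auto simp: inj_on_def\<close>)

lemma signed_permutation_axis:
  assumes "orthogonal_frame n N e" "a \<in> {1..n}" "d \<noteq> 0"
  shows "signed_permutation n e (reflection (d *\<^sub>R e a))"
  unfolding signed_permutation_def
  by (rule exI[of _ id], rule exI[of _ "\<lambda>c. if c = a then -1 else 1"])
     (use reflection_axis[OF assms(1,2)] assms(3) in \<open>auto simp: reflection_by_scaled\<close>)

lemma signed_permutation_sum:
  assumes "orthogonal_frame n N e" "a \<in> {1..n}" "b \<in> {1..n}" "a \<noteq> b"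
  shows "signed_permutation n e (reflection (e a + e b))"
  unfolding signed_permutation_def
  by (rule exI[of _ "\<lambda>c. if c = a then b else if c = b then a else c"],
      rule exI[of _ "\<lambda>c. if c = a \<or> c = b then -1 else 1"])
     (use assms reflection_sum[OF assms(1-3) _ assms(4)] in \<open>auto simp: inj_on_def\<close>)

lemma pair_roots_subset:
  assumes R: "root_system R"
    and diff: "\<And>i j. i \<in> {1..n} \<Longrightarrow> j \<in> {1..n} \<Longrightarrow> i \<noteq> j \<Longrightarrow> e i - e j \<in> R"
    and sum: "\<And>i j. i \<in> {1..n} \<Longrightarrow> j \<in> {1..n} \<Longrightarrow> i \<noteq> j \<Longrightarrow> e i + e j \<in> R"
  shows "pair_roots n e \<subseteq> R"
proof -
  have "grid_root 1 e x \<in> R" if "x \<in> off_diagonal n" for x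
    using that diff sum by (auto simp: off_diagonal_def grid_root_def)
  then show ?thesis using uminus_in_roots[OF R] unfolding pair_roots_def by blast
qed

theorem type_A_roots:
  assumes R: "root_system R" and base: "root_base R (\<alpha> ` {1..n})" and n: "1 \<le> n"
    and cart: "\<And>i j. i \<in> {1..n} \<Longrightarrow> j \<in> {1..n} \<Longrightarrow>
      cartan_number (\<alpha> i) (\<alpha> j) = of_int (cartan_matrix (TypeA n) i j)"
  obtains N e where "frame (Suc n) N e"
    "R = grid_root 1 e ` upper (Suc n) \<union> uminus ` grid_root 1 e ` upper (Suc n)"
proof -
  have \<alpha>R: "\<alpha> i \<in> R" if "i \<in> {1..n}" for i using base that unfolding root_base_def by blast
  obtain N where "chain_gram n N \<alpha>"
  proof (rule chain_gramI[OF _ n])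
    show "\<alpha> i \<noteq> 0" if "i \<in> {1..n}" for i using root_nonzero[OF R] \<alpha>R that by blast
    show "cartan_number (\<alpha> i) (\<alpha> j) = 2 * of_bool (i = j) - of_bool (j = Suc i) - of_bool (i = Suc j)"
      if "i \<in> {1..n}" "j \<in> {1..n}" for i j
      using cart[OF that] that by (auto simp: edges_cartan_def path_edges_iff)
  qed
  then obtain e where F: "frame (Suc n) N e" and e: "\<And>i. i \<in> {1..n} \<Longrightarrow> \<alpha> i = e i - e (Suc i)"
    by (rule chain_frame) blast
  let ?D = "{e i - e j | i j. i \<in> {1..Suc n} \<and> j \<in> {1..Suc n} \<and> i \<noteq> j}"
  have "R \<subseteq> ?D"
  proof (rule roots_subset_reflection_closed[OF R base])
    show "\<alpha> ` {1..n} \<subseteq> ?D" using e by fastforce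
  next
    fix a c assume "a \<in> \<alpha> ` {1..n}" "c \<in> ?D"
    then obtain l i j where lij: "l \<in> {1..n}" "a = e l - e (Suc l)" "c = e i - e j"
      "i \<in> {1..Suc n}" "j \<in> {1..Suc n}" "i \<noteq> j" using e by blast
    let ?\<pi> = "\<lambda>c. if c = l then Suc l else if c = Suc l then l else c"
    have "reflection a c = e (?\<pi> i) - e (?\<pi> j)"
      using lij by (simp add: reflection_diff reflection_difference[OF F])
    moreover have "?\<pi> i \<noteq> ?\<pi> j" "?\<pi> i \<in> {1..Suc n}" "?\<pi> j \<in> {1..Suc n}" using lij by auto
    ultimately show "reflection a c \<in> ?D" by blast
  qed
  moreover have "?D \<subseteq> R"
  proof -
    have "e i - e j \<in> R" if "i \<in> {1..Suc n}" "j \<in> {1..Suc n}" "i \<noteq> j" for i j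
      by (rule differences_in_roots[OF R F _ that]) (use e \<alpha>R in \<open>metis atLeastAtMost_iff less_Suc_eq_le\<close>)
    then show ?thesis by blast
  qed
  ultimately have "R = grid_root 1 e ` upper (Suc n) \<union> uminus ` grid_root 1 e ` upper (Suc n)"
    unfolding grid_root_upper_image by blast
  with F show thesis by (rule that)
qed

text \<open>Types B and C together: they differ only in the multiple \<open>d\<close> of the last frame vector that is
  the last simple root.\<close>

lemma axis_root_systems:
  fixes R :: "'a::euclidean_space set"
  assumes R: "root_system R" and base: "root_base R (\<alpha> ` {1..n})" and n: "n = Suc m"
    and F: "orthogonal_frame n N e" and e: "\<And>i. i \<in> {1..m} \<Longrightarrow> \<alpha> i = e i - e (Suc i)"
    and last: "\<alpha> n = d *\<^sub>R e n" and d: "d \<noteq> 0"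
  shows "R = grid_root d e ` grid n \<union> uminus ` grid_root d e ` grid n"
proof -
  have \<alpha>R: "\<alpha> i \<in> R" if "i \<in> {1..n}" for i using base that unfolding root_base_def by blast
  note F' = orthogonal_frame_frame[OF F]
  let ?C = "pair_roots n e \<union> axis_roots d n e"
  have simple_cases: "(\<exists>l. 1 \<le> l \<and> l < n \<and> a = e l - e (Suc l)) \<or> a = d *\<^sub>R e n" if "a \<in> \<alpha> ` {1..n}" for a
  proof -
    obtain i where i: "i \<in> {1..n}" "a = \<alpha> i" using \<open>a \<in> \<alpha> ` {1..n}\<close> by blast
    then show ?thesis using e[of i] last n by (cases "i = n") auto
  qed
  have diff_mem: "e i - e j \<in> pair_roots n e" if "i \<in> {1..n}" "j \<in> {1..n}" "i \<noteq> j" for i j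
  proof -
    have "e i - e j = 1 *\<^sub>R e i + (-1) *\<^sub>R e j" by simp
    then show ?thesis using that unfolding pair_roots_iff by blast
  qed
  have "R \<subseteq> ?C"
  proof (rule roots_subset_reflection_closed[OF R base])
    show "\<alpha> ` {1..n} \<subseteq> ?C"
    proof
      fix a assume "a \<in> \<alpha> ` {1..n}"
      then consider l where "1 \<le> l" "l < n" "a = e l - e (Suc l)" | "a = (1 * d) *\<^sub>R e n"
        using simple_cases by fastforce
      then show "a \<in> ?C"
      proof cases
        case 1
        then show ?thesis using diff_mem[of l "Suc l"] by auto
      next
        case 2
        then show ?thesis using n unfolding axis_roots_def by fastforce
      qed
    qed
    show "reflection a c \<in> ?C" if "a \<in> \<alpha> ` {1..n}" "c \<in> ?C" for a c
    proof -
      have "signed_permutation n e (reflection a)"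
        using simple_cases[OF that(1)] signed_permutation_difference[OF F'] signed_permutation_axis[OF F _ d, of n] n
        by auto
      then show ?thesis
        using that(2) signed_permutation_pair_roots signed_permutation_axis_roots by blast
    qed
  qed
  moreover have "?C \<subseteq> R"
  proof -
    have diff: "e i - e j \<in> R" if "i \<in> {1..n}" "j \<in> {1..n}" "i \<noteq> j" for i j
      by (rule differences_in_roots[OF R F' _ that]) (use e \<alpha>R n in \<open>metis Suc_leD atLeastAtMost_iff less_Suc_eq_le le_SucI\<close>)
    have axis: "d *\<^sub>R e i \<in> R" if i: "i \<in> {1..n}" for i
    proof (cases "i = n")
      case True
      then show ?thesis using \<alpha>R[of n] last n by simp
    next
      case False
      have "reflection (e i - e n) (d *\<^sub>R e n) = d *\<^sub>R e i"
        using i n False by (simp add: reflection_scaleR reflection_difference[OF F'])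
      moreover have "reflection (e i - e n) (d *\<^sub>R e n) \<in> R"
        using reflection_in_roots[OF R diff] \<alpha>R[of n] last n i False by simp
      ultimately show ?thesis by simp
    qed
    have sum: "e i + e j \<in> R" if "i \<in> {1..n}" "j \<in> {1..n}" "i \<noteq> j" for i j
    proof -
      have "reflection (d *\<^sub>R e j) (e i - e j) = e i + e j"
        using that d by (simp add: reflection_by_scaled reflection_diff reflection_axis[OF F])
      then show ?thesis using reflection_in_roots[OF R axis[OF that(2)] diff[OF that]] by simp
    qed
    have "axis_roots d n e \<subseteq> R"
      using axis uminus_in_roots[OF R] unfolding axis_roots_def by auto
    moreover have "pair_roots n e \<subseteq> R" by (rule pair_roots_subset[OF R]) (fact diff, fact sum)
    ultimately show ?thesis by blast
  qed
  ultimately have "R = ?C" by blast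
  then show ?thesis unfolding grid_root_grid_image pair_roots_eq_grid_root[of n e d] axis_roots_def .
qed

text \<open>The first \<open>n - 1\<close> vertices of the diagrams B, C and D form a path of single edges.\<close>

lemma initial_chain:
  assumes R: "root_system R" and \<alpha>R: "\<And>i. i \<in> {1..n} \<Longrightarrow> \<alpha> i \<in> R" and n: "2 \<le> n" "n = Suc m"
    and cart: "\<And>i j. i \<in> {1..m} \<Longrightarrow> j \<in> {1..m} \<Longrightarrow>
      cartan_number (\<alpha> i) (\<alpha> j) = of_int (edges_cartan E i j)"
    and E: "\<And>i j. i \<in> {1..m} \<Longrightarrow> j \<in> {1..m} \<Longrightarrow> {i, j} \<in> E \<longleftrightarrow> j = Suc i \<or> i = Suc j"
  obtains N where "chain_gram m N \<alpha>"
proof (rule chain_gramI)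
  show "1 \<le> m" using n by simp
  show "\<alpha> i \<noteq> 0" if "i \<in> {1..m}" for i using root_nonzero[OF R] \<alpha>R that n by auto
  show "cartan_number (\<alpha> i) (\<alpha> j) = 2 * of_bool (i = j) - of_bool (j = Suc i) - of_bool (i = Suc j)"
    if "i \<in> {1..m}" "j \<in> {1..m}" for i j
    using cart[OF that] E[OF that] by (auto simp: edges_cartan_def)
qed

theorem type_B_roots:
  assumes R: "root_system R" and base: "root_base R (\<alpha> ` {1..n})" and n: "2 \<le> n"
    and cart: "\<And>i j. i \<in> {1..n} \<Longrightarrow> j \<in> {1..n} \<Longrightarrow>
      cartan_number (\<alpha> i) (\<alpha> j) = of_int (cartan_matrix (TypeB n) i j)"
  obtains N e where "orthogonal_frame n N e"
    "R = grid_root 1 e ` grid n \<union> uminus ` grid_root 1 e ` grid n"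
proof -
  obtain m where m: "n = Suc m" using n by (cases n) auto
  have \<alpha>R: "\<alpha> i \<in> R" if "i \<in> {1..n}" for i using base that unfolding root_base_def by blast
  have nz: "\<alpha> i \<noteq> 0" if "i \<in> {1..n}" for i using root_nonzero[OF R] \<alpha>R that by blast
  obtain N where g: "chain_gram m N \<alpha>"
  proof (rule initial_chain[OF R \<alpha>R n m])
    show "cartan_number (\<alpha> i) (\<alpha> j) = of_int (edges_cartan (path_edges 1 n) i j)"
      if "i \<in> {1..m}" "j \<in> {1..m}" for i j using cart[of i j] that m by auto
  qed (use m in \<open>auto simp: path_edges_iff\<close>)
  have ip: "\<alpha> i \<bullet> \<alpha> j = of_int (cartan_matrix (TypeB n) i j) * (\<alpha> j \<bullet> \<alpha> j) / 2"
    if "i \<in> {1..n}" "j \<in> {1..n}" for i j using inner_from_cartan[OF nz[OF that(2)] cart[OF that]] .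
  have mm: "\<alpha> m \<bullet> \<alpha> m = 2 * N" using g n m unfolding chain_gram_def by auto
  have i1: "\<alpha> n \<bullet> \<alpha> m = - N"
    using ip[of n m] mm n m by (auto simp: edges_cartan_def path_edges_iff)
  have i2: "\<alpha> n \<bullet> \<alpha> n = N"
    using ip[of m n] i1 n m by (auto simp: inner_commute)
  have i3: "\<alpha> n \<bullet> \<alpha> l = 0" if "l \<in> {1..m}" "l \<noteq> m" for l
    using ip[of n l] that n m by (auto simp: edges_cartan_def path_edges_iff)
  obtain e where e: "orthogonal_frame n N e" "\<And>i. i \<in> {1..m} \<Longrightarrow> \<alpha> i = e i - e (Suc i)" "e n = \<alpha> n"
    by (rule chain_orthogonal_frame[OF g m i2]) (use i1 i3 in auto)
  have "R = grid_root 1 e ` grid n \<union> uminus ` grid_root 1 e ` grid n"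
    by (rule axis_root_systems[OF R base m e(1,2)]) (use e(3) in auto)
  with e(1) show thesis by (rule that)
qed

theorem type_C_roots:
  assumes R: "root_system R" and base: "root_base R (\<alpha> ` {1..n})" and n: "2 \<le> n"
    and cart: "\<And>i j. i \<in> {1..n} \<Longrightarrow> j \<in> {1..n} \<Longrightarrow>
      cartan_number (\<alpha> i) (\<alpha> j) = of_int (cartan_matrix (TypeC n) i j)"
  obtains N e where "orthogonal_frame n N e"
    "R = grid_root 2 e ` grid n \<union> uminus ` grid_root 2 e ` grid n"
proof -
  obtain m where m: "n = Suc m" using n by (cases n) auto
  have \<alpha>R: "\<alpha> i \<in> R" if "i \<in> {1..n}" for i using base that unfolding root_base_def by blast
  have nz: "\<alpha> i \<noteq> 0" if "i \<in> {1..n}" for i using root_nonzero[OF R] \<alpha>R that by blast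
  obtain N where g: "chain_gram m N \<alpha>"
  proof (rule initial_chain[OF R \<alpha>R n m])
    show "cartan_number (\<alpha> i) (\<alpha> j) = of_int (edges_cartan (path_edges 1 n) i j)"
      if "i \<in> {1..m}" "j \<in> {1..m}" for i j using cart[of i j] that m by auto
  qed (use m in \<open>auto simp: path_edges_iff\<close>)
  have ip: "\<alpha> i \<bullet> \<alpha> j = of_int (cartan_matrix (TypeC n) i j) * (\<alpha> j \<bullet> \<alpha> j) / 2"
    if "i \<in> {1..n}" "j \<in> {1..n}" for i j using inner_from_cartan[OF nz[OF that(2)] cart[OF that]] .
  have mm: "\<alpha> m \<bullet> \<alpha> m = 2 * N" using g n m unfolding chain_gram_def by auto
  have i1: "\<alpha> n \<bullet> \<alpha> m = - 2 * N"
    using ip[of n m] mm n m by auto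
  have i2: "\<alpha> n \<bullet> \<alpha> n = 4 * N"
    using ip[of m n] i1 n m
    by (auto simp: inner_commute edges_cartan_def path_edges_iff)
  have i3: "\<alpha> n \<bullet> \<alpha> l = 0" if "l \<in> {1..m}" "l \<noteq> m" for l
    using ip[of n l] that n m by (auto simp: edges_cartan_def path_edges_iff)
  obtain e where e: "orthogonal_frame n N e" "\<And>i. i \<in> {1..m} \<Longrightarrow> \<alpha> i = e i - e (Suc i)" "e n = \<alpha> n /\<^sub>R 2"
    by (rule chain_orthogonal_frame[OF g m, of "\<alpha> n /\<^sub>R 2"]) (use i1 i2 i3 in auto)
  have "R = grid_root 2 e ` grid n \<union> uminus ` grid_root 2 e ` grid n"
    by (rule axis_root_systems[OF R base m e(1,2)]) (use e(3) in auto)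
  with e(1) show thesis by (rule that)
qed

theorem type_D_roots:
  assumes R: "root_system R" and base: "root_base R (\<alpha> ` {1..n})" and n: "3 \<le> n"
    and cart: "\<And>i j. i \<in> {1..n} \<Longrightarrow> j \<in> {1..n} \<Longrightarrow>
      cartan_number (\<alpha> i) (\<alpha> j) = of_int (cartan_matrix (TypeD n) i j)"
  obtains N e where "orthogonal_frame n N e" "R = pair_roots n e"
proof -
  obtain m where m: "n = Suc m" using n by (cases n) auto
  have \<alpha>R: "\<alpha> i \<in> R" if "i \<in> {1..n}" for i using base that unfolding root_base_def by blast
  have nz: "\<alpha> i \<noteq> 0" if "i \<in> {1..n}" for i using root_nonzero[OF R] \<alpha>R that by blast
  define E where "E = path_edges 1 (n - 1) \<union> {{n - 2, n}}"
  have E: "{i, j} \<in> E \<longleftrightarrow> (j = Suc i \<and> 1 \<le> i \<and> i < m) \<or> (i = Suc j \<and> 1 \<le> j \<and> j < m)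
      \<or> (i = n - 2 \<and> j = n) \<or> (i = n \<and> j = n - 2)" for i j
    unfolding E_def Un_iff path_edges_iff using m by (auto simp: doubleton_eq_iff)
  have cart': "cartan_number (\<alpha> i) (\<alpha> j) = of_int (edges_cartan E i j)"
    if "i \<in> {1..n}" "j \<in> {1..n}" for i j using cart[OF that] by (simp add: E_def)
  obtain N where g: "chain_gram m N \<alpha>"
    by (rule initial_chain[OF R \<alpha>R _ m cart']) (use m n E in auto)
  have ip: "\<alpha> i \<bullet> \<alpha> j = of_int (edges_cartan E i j) * (\<alpha> j \<bullet> \<alpha> j) / 2"
    if "i \<in> {1..n}" "j \<in> {1..n}" for i j using inner_from_cartan[OF nz[OF that(2)] cart'[OF that]] .
  have mm: "\<alpha> l \<bullet> \<alpha> l = 2 * N" if "l \<in> {1..m}" for l using g that unfolding chain_gram_def by auto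
  have gm: "\<alpha> m \<bullet> \<alpha> l = - N * of_bool (l = m - 1)" if "l \<in> {1..m}" "l \<noteq> m" for l
    using g that unfolding chain_gram_def by auto
  have i1: "\<alpha> n \<bullet> \<alpha> (n - 2) = - N"
  proof -
    have "edges_cartan E n (n - 2) = -1" using n E[of n "n - 2"] by (auto simp: edges_cartan_def)
    moreover have "n - 2 \<in> {1..m}" "n - 2 \<in> {1..n}" "n \<in> {1..n}" using n m by auto
    ultimately show ?thesis using ip[of n "n - 2"] mm[of "n - 2"] by simp
  qed
  have i2: "\<alpha> n \<bullet> \<alpha> n = 2 * N"
  proof -
    have "edges_cartan E (n - 2) n = -1" using n E[of "n - 2" n] by (auto simp: edges_cartan_def)
    moreover have "n - 2 \<in> {1..n}" "n \<in> {1..n}" using n by auto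
    ultimately show ?thesis using ip[of "n - 2" n] i1 by (simp add: inner_commute)
  qed
  have i3: "\<alpha> n \<bullet> \<alpha> l = 0" if "l \<in> {1..m}" "l \<noteq> m - 1" for l
  proof -
    have "edges_cartan E n l = 0" using E[of n l] that n m by (auto simp: edges_cartan_def)
    then show ?thesis using ip[of n l] that m by simp
  qed
  let ?u = "(\<alpha> n - \<alpha> m) /\<^sub>R 2"
  have u1: "?u \<bullet> ?u = N"
    using i2 i3[of m] mm[of m] m n by (simp add: inner_diff_left inner_diff_right inner_commute)
  have u2: "?u \<bullet> \<alpha> l = - N * of_bool (l = m)" if l: "l \<in> {1..m}" for l
  proof -
    consider "l = m" | "l = m - 1" "l \<noteq> m" | "l \<noteq> m - 1" "l \<noteq> m" by blast
    then show ?thesis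
    proof cases
      case 1
      then show ?thesis using i3[of m] mm[of m] m n by (simp add: inner_diff_left)
    next
      case 2
      moreover have "n - 2 = m - 1" using m by simp
      ultimately show ?thesis using i1 gm[OF l] by (simp add: inner_diff_left)
    next
      case 3
      then show ?thesis using i3[OF l] gm[OF l] by (simp add: inner_diff_left)
    qed
  qed
  obtain e where F: "orthogonal_frame n N e" and e: "\<And>i. i \<in> {1..m} \<Longrightarrow> \<alpha> i = e i - e (Suc i)"
    and en: "e n = ?u"
    by (rule chain_orthogonal_frame[OF g m u1 u2]) blast+
  note F' = orthogonal_frame_frame[OF F]
  have "\<alpha> n = 2 *\<^sub>R e n + \<alpha> m" by (simp add: en)
  then have last: "\<alpha> n = e m + e n"
    using e[of m] m n by (simp add: scaleR_2)
  have simple_cases: "(\<exists>l. 1 \<le> l \<and> l < n \<and> a = e l - e (Suc l)) \<or> a = e m + e n" if "a \<in> \<alpha> ` {1..n}" for a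
  proof -
    obtain i where i: "i \<in> {1..n}" "a = \<alpha> i" using \<open>a \<in> \<alpha> ` {1..n}\<close> by blast
    then show ?thesis using e[of i] last m by (cases "i = n") auto
  qed
  have "R \<subseteq> pair_roots n e"
  proof (rule roots_subset_reflection_closed[OF R base])
    have mem: "e i + s *\<^sub>R e j \<in> pair_roots n e" if "i \<in> {1..n}" "j \<in> {1..n}" "i \<noteq> j" "s \<in> {1, -1}" for i j s
    proof -
      have "e i + s *\<^sub>R e j = 1 *\<^sub>R e i + s *\<^sub>R e j" by simp
      then show ?thesis using that unfolding pair_roots_iff by blast
    qed
    show "\<alpha> ` {1..n} \<subseteq> pair_roots n e"
    proof
      fix a assume "a \<in> \<alpha> ` {1..n}"
      then consider l where "1 \<le> l" "l < n" "a = e l - e (Suc l)" | "a = e m + e n"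
        using simple_cases by blast
      then show "a \<in> pair_roots n e"
      proof cases
        case 1
        then show ?thesis using mem[of l "Suc l" "-1"] by simp
      next
        case 2
        then show ?thesis using mem[of m n 1] m n by simp
      qed
    qed
    show "reflection a c \<in> pair_roots n e" if "a \<in> \<alpha> ` {1..n}" "c \<in> pair_roots n e" for a c
    proof -
      have "signed_permutation n e (reflection a)"
        using simple_cases[OF that(1)] signed_permutation_difference[OF F'] signed_permutation_sum[OF F, of m n] m n
        by auto
      then show ?thesis using that(2) signed_permutation_pair_roots by blast
    qed
  qed
  moreover have "pair_roots n e \<subseteq> R"
  proof -
    have diff: "e i - e j \<in> R" if "i \<in> {1..n}" "j \<in> {1..n}" "i \<noteq> j" for i j
      by (rule differences_in_roots[OF R F' _ that]) (use e \<alpha>R m in \<open>metis Suc_leD atLeastAtMost_iff less_Suc_eq_le le_SucI\<close>)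
    have sum_n: "e i + e n \<in> R" if i: "i \<in> {1..m}" for i
    proof (cases "i = m")
      case True
      then show ?thesis using \<alpha>R[of n] last m by simp
    next
      case False
      have "reflection (e i - e m) (e m + e n) = e i + e n"
        using i m False by (simp add: reflection_add reflection_difference[OF F'])
      moreover have "reflection (e i - e m) (e m + e n) \<in> R"
        using reflection_in_roots[OF R diff] \<alpha>R[of n] last m i False by simp
      ultimately show ?thesis by simp
    qed
    have sum: "e i + e j \<in> R" if ij: "i \<in> {1..n}" "j \<in> {1..n}" "i \<noteq> j" for i j
    proof (cases "i = n \<or> j = n")
      case True
      then show ?thesis using sum_n[of i] sum_n[of j] ij m by (auto simp: add.commute)
    next
      case False
      have "reflection (e j - e n) (e i + e n) = e i + e j"
        using ij m False by (simp add: reflection_add reflection_difference[OF F'])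
      moreover have "reflection (e j - e n) (e i + e n) \<in> R"
        using reflection_in_roots[OF R diff sum_n] ij m False by simp
      ultimately show ?thesis by simp
    qed
    show ?thesis by (rule pair_roots_subset[OF R]) (fact diff, fact sum)
  qed
  ultimately have "R = pair_roots n e" by blast
  with F show thesis by (rule that)
qed

section \<open>The classical types\<close>

lemma grid_root_upper_inj:
  assumes F: "frame n N e" and xy: "x \<in> upper n" "y \<in> upper n"
    and eq: "grid_root d e x = grid_root d e y \<or> grid_root d e x = - grid_root d e y"
  shows "x = y"
proof -
  have N: "0 < N" using F unfolding frame_def by blast
  have ip: "e c \<bullet> grid_root d e z = N * of_int (coeff 1 c z)" if "c \<in> {1..n}" "z \<in> upper n" for c z
    by (rule inner_grid_root_upper[OF F that])
  have "coeff 1 c x = coeff 1 c y" if "grid_root d e x = grid_root d e y" "c \<in> {1..n}" for c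
    using ip[OF that(2) xy(1)] ip[OF that(2) xy(2)] that(1) N by simp
  moreover have "coeff 1 c x = - coeff 1 c y" if "grid_root d e x = - grid_root d e y" "c \<in> {1..n}" for c
  proof -
    have "N * of_int (coeff 1 c x) = N * of_int (- coeff 1 c y)"
      using ip[OF that(2) xy(1)] ip[OF that(2) xy(2)] that(1) by simp
    then show ?thesis using N by (metis mult_cancel_left of_int_eq_iff less_irrefl)
  qed
  moreover have "x \<in> grid n" "y \<in> grid n" using xy by (auto simp: upper_def grid_def)
  ultimately show ?thesis using coeff_inj[of x n y 1] eq by auto
qed

lemma grid_root_inj:
  assumes F: "orthogonal_frame n N e" and xy: "x \<in> grid n" "y \<in> grid n" and d: "0 < d"
    and eq: "grid_root (of_int d) e x = grid_root (of_int d) e y \<or> grid_root (of_int d) e x = - grid_root (of_int d) e y"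
  shows "x = y"
proof -
  have N: "0 < N" using F unfolding orthogonal_frame_def by blast
  have ip: "e c \<bullet> grid_root (of_int d) e z = N * of_int (coeff d c z)" if "c \<in> {1..n}" "z \<in> grid n" for c z
    by (rule inner_grid_root[OF F that])
  have "coeff d c x = coeff d c y" if "grid_root (of_int d) e x = grid_root (of_int d) e y" "c \<in> {1..n}" for c
    using ip[OF that(2) xy(1)] ip[OF that(2) xy(2)] that(1) N by simp
  moreover have "coeff d c x = - coeff d c y" if "grid_root (of_int d) e x = - grid_root (of_int d) e y" "c \<in> {1..n}" for c
  proof -
    have "N * of_int (coeff d c x) = N * of_int (- coeff d c y)"
      using ip[OF that(2) xy(1)] ip[OF that(2) xy(2)] that(1) by simp
    then show ?thesis using N by (metis mult_cancel_left of_int_eq_iff less_irrefl)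
  qed
  ultimately show ?thesis using coeff_inj[OF xy d] eq by blast
qed

text \<open>Matched pairs are disjoint.\<close>

lemma matching_orthogonal:
  assumes F: "frame n N e" and xy: "x \<in> matching n" "y \<in> matching n" "x \<noteq> y"
  shows "grid_root d e x \<bullet> grid_root d e y = 0"
proof -
  obtain i j k l where e: "x = (i, j)" "y = (k, l)" by (cases x, cases y)
  have r: "1 \<le> i" "i < j" "j \<le> n" "1 \<le> k" "k < l" "l \<le> n" "{i, j} \<inter> {k, l} = {}"
    using matching_range[of i j n] matching_range[of k l n] matching_disjoint[of i j n k l] xy unfolding e by auto
  then show ?thesis
    using frame_inner[OF F, of k l i] frame_inner[OF F, of k l j]
    by (simp add: e grid_root_simps inner_diff_left)
qed

lemma upper_root_norm:
  assumes F: "frame n N e" and x: "x \<in> upper n"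
  shows "grid_root d e x \<bullet> grid_root d e x = 2 * N"
  using x frame_norm[OF F] by (auto simp: upper_def grid_root_simps)

lemma grid_root_norm:
  assumes F: "orthogonal_frame n N e" and x: "x \<in> grid n"
  shows "grid_root d e x \<bullet> grid_root d e x = (if fst x = snd x then d\<^sup>2 else 2) * N"
proof -
  obtain i j where x': "x = (i, j)" "i \<in> {1..n}" "j \<in> {1..n}" using x by (auto simp: grid_def)
  have "e i \<bullet> e i = N" "e j \<bullet> e j = N" "i \<noteq> j \<Longrightarrow> e i \<bullet> e j = 0" "i \<noteq> j \<Longrightarrow> e j \<bullet> e i = 0"
    using orthogonal_frame_inner[OF F] x'(2,3) by simp_all
  then show ?thesis
    unfolding x'(1) by (cases i j rule: linorder_cases)
      (simp_all add: grid_root_simps inner_diff_left inner_diff_right inner_add_left inner_add_right power2_eq_square)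
qed

theorem type_A_minimal:
  assumes R: "root_system R" and P: "positive_roots R P"
    and F: "frame (Suc n) N e" and roots: "R = grid_root 1 e ` upper (Suc n) \<union> uminus ` grid_root 1 e ` upper (Suc n)"
    and m: "m = (if even n then 0 else Suc n div 2)"
  shows "minimal_cocardinality P balanced m \<and> minimal_cocardinality P (well_balanced R P) m"
proof -
  define K where "K = (if even n then {} else matching (Suc n))"
  have N: "0 < N" using F unfolding frame_def by blast
  have KI: "K \<subseteq> upper (Suc n)" using matching_upper by (simp add: K_def)
  have norm: "z \<bullet> z = 2 * N" if "z \<in> R" for z
    using that upper_root_norm[OF F] unfolding roots by auto
  show ?thesis
  proof (rule minimal_cocardinality_indexed[OF R P roots grid_root_upper_inj[OF F] KI])
    show "signed_null (upper (Suc n) - K) (grid_root 1 e)"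
      using upper_null[of "Suc n" 1 e] upper_minus_matching_null[of "Suc n" 1 e] by (simp add: K_def)
    show "strongly_orthogonal R (grid_root 1 e ` K)"
    proof (rule strongly_orthogonal_if_orthogonal[OF R])
      show sub: "grid_root 1 e ` K \<subseteq> R" using KI unfolding roots by blast
      fix u v assume uv: "u \<in> grid_root 1 e ` K" "v \<in> grid_root 1 e ` K" "u \<noteq> v"
      then obtain x y where "x \<in> K" "y \<in> K" "u = grid_root 1 e x" "v = grid_root 1 e y" "x \<noteq> y" by blast
      then show "u \<bullet> v = 0" using matching_orthogonal[OF F] by (auto simp: K_def split: if_splits)
      show "z \<bullet> z < u \<bullet> u + v \<bullet> v" if "z \<in> R" for z
        using norm[OF that] norm[OF subsetD[OF sub uv(1)]] norm[OF subsetD[OF sub uv(2)]] N by simp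
    qed
    show "card K = m" by (simp add: K_def m card_matching)
    fix J assume J: "J \<subseteq> upper (Suc n)" "signed_null J (grid_root 1 e)"
    show "m \<le> card (upper (Suc n) - J)"
    proof (cases "even n")
      case False
      then have "odd (\<Sum>x\<in>upper (Suc n) - J. coeff 1 c x)" if "c \<in> {1..Suc n}" for c
        using upper_complement_parity[OF F J that] by simp
      then have "Suc n \<le> 2 * card (upper (Suc n) - J)"
        by (intro card_le_double_card[of _ _ 1]) simp
      then have "Suc n div 2 \<le> card (upper (Suc n) - J)" by linarith
      then show ?thesis unfolding m by (simp only: False if_False)
    qed (simp add: m)
  qed
qed

theorem type_B_minimal:
  assumes R: "root_system R" and P: "positive_roots R P"
    and F: "orthogonal_frame n N e" and roots: "R = grid_root 1 e ` grid n \<union> uminus ` grid_root 1 e ` grid n"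
    and m: "m = Suc n div 2"
  shows "minimal_cocardinality P balanced m \<and> minimal_cocardinality P (well_balanced R P) m"
proof -
  let ?K = "B_removed n"
  have N: "0 < N" using F unfolding orthogonal_frame_def by blast
  note inj = grid_root_inj[OF F _ _ zero_less_one, simplified]
  have norm: "z \<bullet> z \<le> 2 * N" if "z \<in> R" for z
    using that grid_root_norm[OF F, of _ 1] N unfolding roots by auto
  show ?thesis
  proof (rule minimal_cocardinality_indexed[OF R P roots inj B_removed_grid grid_minus_B_removed_null])
    show "strongly_orthogonal R (grid_root 1 e ` ?K)"
    proof (rule strongly_orthogonal_if_orthogonal[OF R])
      show sub: "grid_root 1 e ` ?K \<subseteq> R" using B_removed_grid unfolding roots by blast
      fix u v assume "u \<in> grid_root 1 e ` ?K" "v \<in> grid_root 1 e ` ?K" "u \<noteq> v"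
      then obtain x y where xy: "x \<in> ?K" "y \<in> ?K" "x \<noteq> y" and uv: "u = grid_root 1 e x" "v = grid_root 1 e y"
        by blast
      \<comment> \<open>A distinct pair of omitted roots contains the short root \<open>e 1\<close> at most once.\<close>
      have axis: "odd n" "x = (1, 1) \<and> y \<in> matching n \<or> y = (1, 1) \<and> x \<in> matching n"
        if "x \<notin> matching n \<or> y \<notin> matching n"
        using xy that by (auto simp: B_removed_def split: if_splits)
      \<comment> \<open>For odd \<open>n\<close> the matched pairs avoid the index 1.\<close>
      have e1: "e 1 \<bullet> grid_root 1 e z = 0" if "odd n" "z \<in> matching n" for z
      proof -
        obtain k l where z: "z = (k, l)" by (cases z)
        then have "1 < k" "k < l" "l \<le> n" using matching_range[of k l n] that by auto
        then show ?thesis using frame_inner[OF orthogonal_frame_frame[OF F], of k l 1]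
          by (simp add: z grid_root_simps)
      qed
      show "u \<bullet> v = 0"
      proof (cases "x \<in> matching n \<and> y \<in> matching n")
        case True
        then show ?thesis using matching_orthogonal[OF orthogonal_frame_frame[OF F]] xy(3) uv by blast
      next
        case False
        then have "u = e 1 \<and> e 1 \<bullet> v = 0 \<or> v = e 1 \<and> e 1 \<bullet> u = 0"
          using axis e1 unfolding uv by (metis grid_root_simps(3) scaleR_one)
        then show ?thesis by (metis inner_commute)
      qed
      \<comment> \<open>A matched root is long, so two omitted roots have total squared norm at least \<open>3 * N\<close>.\<close>
      have two: "grid_root 1 e z \<bullet> grid_root 1 e z = 2 * N" if "z \<in> matching n" for z
        using upper_root_norm[OF orthogonal_frame_frame[OF F]] matching_upper that by blast
      have "2 * N < u \<bullet> u + v \<bullet> v"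
      proof (cases "x \<in> matching n \<and> y \<in> matching n")
        case True
        then show ?thesis using two N by (simp add: uv)
      next
        case False
        have "grid_root 1 e x \<bullet> grid_root 1 e x \<ge> N" "grid_root 1 e y \<bullet> grid_root 1 e y \<ge> N"
          using grid_root_norm[OF F subsetD[OF B_removed_grid xy(1)], of 1]
            grid_root_norm[OF F subsetD[OF B_removed_grid xy(2)], of 1] N by simp_all
        moreover have "x \<in> matching n \<or> y \<in> matching n" using axis(2) False by blast
        ultimately show ?thesis using two[of x] two[of y] N unfolding uv by auto
      qed
      then show "z \<bullet> z < u \<bullet> u + v \<bullet> v" if "z \<in> R" for z using norm[OF that] by simp
    qed
    have "(1, 1) \<notin> matching n" using matching_range[of 1 1 n] by auto
    then show "card ?K = m" by (auto simp: B_removed_def m card_matching elim!: oddE)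
    fix J assume J: "J \<subseteq> grid n" "signed_null J (grid_root 1 e)"
    have "odd (\<Sum>x\<in>grid n - J. coeff 1 c x)" if "c \<in> {1..n}" for c
      using grid_complement_parity[OF F order_refl J(1), of 1 c] J(2) that even_sum_coeff_grid[OF that, of 1] by simp
    then have "n \<le> 2 * card (grid n - J)"
      by (intro card_le_double_card[of _ _ 1]) simp
    then show "m \<le> card (grid n - J)" using m by linarith
  qed
qed

theorem type_C_minimal:
  assumes R: "root_system R" and P: "positive_roots R P" and n: "1 \<le> n"
    and F: "orthogonal_frame n N e" and roots: "R = grid_root 2 e ` grid n \<union> uminus ` grid_root 2 e ` grid n"
    and m: "m = (if n mod 4 = 0 \<or> n mod 4 = 3 then 0 else 1)"
  shows "minimal_cocardinality P balanced m \<and> minimal_cocardinality P (well_balanced R P) m"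
proof -
  let ?K = "C_removed n"
  note inj = grid_root_inj[OF F _ _ zero_less_numeral[of "num.Bit0 num.One"], simplified]
  have KI: "?K \<subseteq> grid n" using n by (auto simp: C_removed_def grid_def)
  show ?thesis
  proof (rule minimal_cocardinality_indexed[OF R P roots inj KI grid_minus_C_removed_null])
    have "strongly_orthogonal R {grid_root 2 e (1, 1)}"
      by (rule strongly_orthogonal_singleton[OF R]) (use n in \<open>auto simp: roots grid_def\<close>)
    then show "strongly_orthogonal R (grid_root 2 e ` ?K)"
      by (simp add: C_removed_def strongly_orthogonal_def)
    show "card ?K = m" by (simp add: C_removed_def m)
    fix J assume J: "J \<subseteq> grid n" "signed_null J (grid_root 2 e)"
    show "m \<le> card (grid n - J)"
    proof (cases "m = 0")
      case False
      then have "odd (\<Sum>x\<in>grid n - J. half_total x)"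
        using half_total_complement_parity[OF F order_refl J] even_sum_half_total_grid[of n] m by auto
      then have "grid n - J \<noteq> {}" by (metis even_zero sum.empty)
      then have "card (grid n - J) \<noteq> 0" by simp
      then show ?thesis using m by presburger
    qed simp
  qed
qed

text \<open>When the half total is odd some root must be omitted. It cannot be a single one: every coordinate has even sum
  over all positive roots, whereas a single root has odd coefficients.\<close>

theorem type_D_minimal:
  assumes R: "root_system R" and P: "positive_roots R P" and n: "2 \<le> n"
    and F: "orthogonal_frame n N e" and roots: "R = pair_roots n e"
    and m: "m = (if n mod 4 = 0 \<or> n mod 4 = 1 then 0 else 2)"
  shows "minimal_cocardinality P balanced m \<and> minimal_cocardinality P (well_balanced R P) m"
proof -
  let ?K = "D_removed n"
  have N: "0 < N" using F unfolding orthogonal_frame_def by blast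
  have off: "off_diagonal n \<subseteq> grid n" by (auto simp: off_diagonal_def grid_def)
  have roots': "R = grid_root 2 e ` off_diagonal n \<union> uminus ` grid_root 2 e ` off_diagonal n"
    unfolding roots by (rule pair_roots_eq_grid_root)
  have inj: "x = y" if "x \<in> off_diagonal n" "y \<in> off_diagonal n"
    "grid_root 2 e x = grid_root 2 e y \<or> grid_root 2 e x = - grid_root 2 e y" for x y
    using grid_root_inj[OF F, of x y 2] that off by auto
  have norm: "z \<bullet> z = 2 * N" if "z \<in> R" for z
  proof -
    have "grid_root 2 e x \<bullet> grid_root 2 e x = 2 * N" if "x \<in> off_diagonal n" for x
    proof -
      have "x \<in> grid n" "fst x \<noteq> snd x" using that off by (auto simp: off_diagonal_def grid_def)
      then show ?thesis using grid_root_norm[OF F, of x 2] by simp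
    qed
    then show ?thesis using that unfolding roots' by auto
  qed
  have KI: "?K \<subseteq> off_diagonal n" using n by (auto simp: D_removed_def off_diagonal_def)
  show ?thesis
  proof (rule minimal_cocardinality_indexed[OF R P roots' inj KI off_diagonal_minus_D_removed_null])
    show "strongly_orthogonal R (grid_root 2 e ` ?K)"
    proof (rule strongly_orthogonal_if_orthogonal[OF R])
      show sub: "grid_root 2 e ` ?K \<subseteq> R" using KI unfolding roots' by blast
      fix u v assume uv: "u \<in> grid_root 2 e ` ?K" "v \<in> grid_root 2 e ` ?K" "u \<noteq> v"
      have "(e 1 - e 2) \<bullet> (e 2 + e 1) = 0"
        using n orthogonal_frame_inner[OF F, of 1 1] orthogonal_frame_inner[OF F, of 2 2]
        by (simp add: inner_diff_left inner_diff_right inner_add_right inner_add_left inner_commute)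
      then show "u \<bullet> v = 0" using uv
        by (auto simp: D_removed_def grid_root_simps inner_commute split: if_splits)
      show "z \<bullet> z < u \<bullet> u + v \<bullet> v" if "z \<in> R" for z
        using norm[OF that] norm[OF subsetD[OF sub uv(1)]] norm[OF subsetD[OF sub uv(2)]] N by simp
    qed
    show "card ?K = m" by (simp add: D_removed_def m)
    fix J assume J: "J \<subseteq> off_diagonal n" "signed_null J (grid_root 2 e)"
    show "m \<le> card (off_diagonal n - J)"
    proof (cases "m = 0")
      case False
      have fin: "finite (off_diagonal n - J)" by simp
      have "odd (\<Sum>x\<in>off_diagonal n - J. half_total x)"
        using half_total_complement_parity[OF F off J] even_sum_half_total_off_diagonal[of n] m False by auto
      then have "off_diagonal n - J \<noteq> {}" by (metis even_zero sum.empty)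
      then have "card (off_diagonal n - J) \<noteq> 0" using fin by simp
      moreover have "card (off_diagonal n - J) \<noteq> 1"
      proof
        assume "card (off_diagonal n - J) = 1"
        then obtain x where x: "off_diagonal n - J = {x}" by (rule card_1_singletonE)
        then have "x \<in> off_diagonal n" by blast
        then obtain i j where ij: "x = (i, j)" "i \<in> {1..n}" "i \<noteq> j" by (auto simp: off_diagonal_def)
        have "even (\<Sum>x\<in>off_diagonal n - J. coeff 2 i x)"
          using grid_complement_parity[OF F off J(1), of 2 i] J(2) ij(2) even_sum_coeff_off_diagonal by simp
        then show False using ij(3) by (auto simp: x ij(1) coeff_def split: if_splits)
      qed
      ultimately show ?thesis using m by presburger
    qed simp
  qed
qed

section \<open>Root systems from coordinate lists\<close>

text \<open>Roots of the exceptional types are given by their coordinates in the simple roots, as lists whose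
  position \<open>i\<close> belongs to the simple root \<open>\<alpha> (Suc i)\<close>.\<close>

definition lincomb :: "(nat \<Rightarrow> 'a::real_vector) \<Rightarrow> int list \<Rightarrow> 'a" where
  "lincomb \<alpha> v = (\<Sum>i<length v. of_int (v ! i) *\<^sub>R \<alpha> (Suc i))"

definition dot :: "int list \<Rightarrow> int list \<Rightarrow> int" where
  "dot u v = sum_list (map2 (*) u v)"

text \<open>For each simple root its coordinates, together with its Cartan numbers against all simple
  roots, i.e. its coroot as a functional on coordinates.\<close>

definition simple_data :: "nat \<Rightarrow> (nat \<Rightarrow> nat \<Rightarrow> int) \<Rightarrow> (int list \<times> int list) list" where
  "simple_data n A = map (\<lambda>j. (map (\<lambda>i. if i = j then 1 else 0) [0..<n],
     map (\<lambda>i. A (Suc i) (Suc j)) [0..<n])) [0..<n]"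

text \<open>A criterion that can be checked by rewriting. The third condition lets every listed vector descend to
  a simple root, the fourth keeps simple reflections inside the list up to sign. The case
  \<open>k = 0\<close>, in which the reflection fixes the vector, is split off because it occurs about as often as the
  others and needs no search in \<open>L\<close>.\<close>

definition root_list :: "(int list \<times> int list) list \<Rightarrow> int list list \<Rightarrow> bool" where
  "root_list S L \<longleftrightarrow>
     list_all (\<lambda>v. length v = length S \<and> list_all (\<lambda>a. 0 \<le> a) v) L \<and>
     list_all (\<lambda>(u, c). u \<in> set L) S \<and>
     list_all (\<lambda>v. list_ex (\<lambda>(u, c). v = u \<or> 0 < dot v c) S) L \<and>
     list_all (\<lambda>v. list_all (\<lambda>(u, c). let k = dot v c in
       k = 0 \<or> v = u \<or> map2 (\<lambda>a b. a - k * b) v u \<in> set L) S) L"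

definition vector_sum :: "nat \<Rightarrow> int list list \<Rightarrow> int list" where
  "vector_sum n L = foldr (map2 (+)) L (replicate n 0)"

lemma length_vector_sum: "\<forall>v\<in>set L. length v = n \<Longrightarrow> length (vector_sum n L) = n"
  unfolding vector_sum_def by (induction L) auto

lemma vector_sum_nth:
  "\<forall>v\<in>set L. length v = n \<Longrightarrow> i < n \<Longrightarrow> vector_sum n L ! i = (\<Sum>v\<leftarrow>L. v ! i)"
proof (induction L)
  case (Cons v L)
  then show ?case using length_vector_sum[of L n] by (simp add: vector_sum_def)
qed (simp add: vector_sum_def)

lemma lincomb_vector_sum:
  assumes "\<forall>v\<in>set L. length v = n"
  shows "lincomb \<alpha> (vector_sum n L) = (\<Sum>v\<leftarrow>L. lincomb \<alpha> v)"
  using assms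
proof (induction L)
  case (Cons v L)
  have l: "length v = n" "length (vector_sum n L) = n" using Cons.prems length_vector_sum[of L n] by auto
  have "lincomb \<alpha> (vector_sum n (v # L)) = lincomb \<alpha> (map2 (+) v (vector_sum n L))"
    by (simp add: vector_sum_def)
  also have "\<dots> = lincomb \<alpha> v + lincomb \<alpha> (vector_sum n L)"
    by (simp add: lincomb_def l scaleR_left_distrib sum.distrib)
  finally show ?case using Cons by simp
qed (simp add: vector_sum_def lincomb_def)

lemma lincomb_simple:
  assumes "j < n"
  shows "lincomb \<alpha> (map (\<lambda>i. if i = j then 1 else 0) [0..<n]) = \<alpha> (Suc j)"
proof -
  have "lincomb \<alpha> (map (\<lambda>i. if i = j then 1 else 0) [0..<n]) = (\<Sum>i<n. if i = j then \<alpha> (Suc i) else 0)"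
    unfolding lincomb_def by (rule sum.cong) auto
  then show ?thesis using assms by simp
qed

lemma reflection_lincomb:
  fixes \<alpha> :: "nat \<Rightarrow> 'a::euclidean_space"
  assumes S: "(u, c) \<in> set (simple_data n A)" and v: "length v = n"
    and cart: "\<And>i j. i \<in> {1..n} \<Longrightarrow> j \<in> {1..n} \<Longrightarrow> cartan_number (\<alpha> i) (\<alpha> j) = of_int (A i j)"
  shows "reflection (lincomb \<alpha> u) (lincomb \<alpha> v) = lincomb \<alpha> (map2 (\<lambda>a b. a - dot v c * b) v u)"
proof -
  obtain j where j: "j < n" and u: "u = map (\<lambda>i. if i = j then 1 else 0) [0..<n]"
    and c: "c = map (\<lambda>i. A (Suc i) (Suc j)) [0..<n]"
    using S unfolding simple_data_def by auto
  have \<alpha>: "lincomb \<alpha> u = \<alpha> (Suc j)" unfolding u by (rule lincomb_simple[OF j])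
  have "cartan_number (lincomb \<alpha> v) (\<alpha> (Suc j)) = (\<Sum>i<n. of_int (v ! i) * cartan_number (\<alpha> (Suc i)) (\<alpha> (Suc j)))"
    by (simp add: cartan_number_def lincomb_def v inner_sum_left sum_divide_distrib sum_distrib_left algebra_simps)
  also have "\<dots> = (\<Sum>i<n. of_int (v ! i) * of_int (A (Suc i) (Suc j)))"
    using cart j by (intro sum.cong) auto
  also have "\<dots> = of_int (dot v c)"
    by (simp add: dot_def sum_list_sum_nth v c atLeast0LessThan)
  finally have k: "cartan_number (lincomb \<alpha> v) (\<alpha> (Suc j)) = of_int (dot v c)" .
  have "lincomb \<alpha> (map2 (\<lambda>a b. a - dot v c * b) v u) = lincomb \<alpha> v - of_int (dot v c) *\<^sub>R lincomb \<alpha> u"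
    by (simp add: lincomb_def v u scaleR_left_diff_distrib sum_subtractf scaleR_sum_right)
  then show ?thesis unfolding reflection_alt \<alpha> k by simp
qed

lemma simple_data_lincomb:
  "(\<lambda>(u, c). lincomb \<alpha> u) ` set (simple_data n A) = \<alpha> ` {1..n}"
proof -
  have "{1..n} = Suc ` {0..<n}" by (simp add: image_Suc_atLeastLessThan atLeastLessThanSuc_atLeastAtMost)
  moreover have "(\<lambda>(u, c). lincomb \<alpha> u) ` set (simple_data n A) = (\<lambda>j. \<alpha> (Suc j)) ` {0..<n}"
    unfolding simple_data_def by (simp add: image_image lincomb_simple)
  ultimately show ?thesis by (simp only: image_image)
qed

text \<open>Closure under simple reflections shows that all roots are listed. Conversely, lowering a listed
  vector ends at a simple root, so each listed vector is obtained from a simple root by reflections and is a root.\<close>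

theorem root_list_roots:
  fixes R :: "'a::euclidean_space set"
  assumes R: "root_system R" and base: "root_base R (\<alpha> ` {1..n})"
    and cart: "\<And>i j. i \<in> {1..n} \<Longrightarrow> j \<in> {1..n} \<Longrightarrow> cartan_number (\<alpha> i) (\<alpha> j) = of_int (A i j)"
    and L: "root_list (simple_data n A) L"
  shows "R = lincomb \<alpha> ` set L \<union> uminus ` lincomb \<alpha> ` set L"
proof -
  let ?S = "simple_data n A"
  have len: "length v = n" and nonneg: "\<And>a. a \<in> set v \<Longrightarrow> 0 \<le> a" if "v \<in> set L" for v
    using L that by (auto simp: root_list_def list_all_iff simple_data_def)
  have mem: "u \<in> set L" if "(u, c) \<in> set ?S" for u c
    using L that by (auto simp: root_list_def list_all_iff)
  have down: "\<exists>(u, c)\<in>set ?S. v = u \<or> 0 < dot v c" if "v \<in> set L" for v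
    using L that unfolding root_list_def list_all_iff list_ex_iff by blast
  have closed: "dot v c = 0 \<or> v = u \<or> map2 (\<lambda>a b. a - dot v c * b) v u \<in> set L"
    if "v \<in> set L" "(u, c) \<in> set ?S" for v u c
    using L that unfolding root_list_def list_all_iff Let_def by blast
  have refl: "reflection (lincomb \<alpha> u) (lincomb \<alpha> v) = lincomb \<alpha> (map2 (\<lambda>a b. a - dot v c * b) v u)"
    if "v \<in> set L" "(u, c) \<in> set ?S" for v u c
    by (rule reflection_lincomb[OF that(2) len[OF that(1)] cart])
  have uR: "lincomb \<alpha> u \<in> R" if "(u, c) \<in> set ?S" for u c
  proof -
    have "lincomb \<alpha> u \<in> \<alpha> ` {1..n}"
      unfolding simple_data_lincomb[of \<alpha> n A, symmetric] using that by (intro image_eqI[of _ _ "(u, c)"]) auto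
    then show ?thesis using base unfolding root_base_def by blast
  qed
  let ?C = "lincomb \<alpha> ` set L \<union> uminus ` lincomb \<alpha> ` set L"
  have "R \<subseteq> ?C"
  proof (rule roots_subset_reflection_closed[OF R base])
    show "\<alpha> ` {1..n} \<subseteq> ?C"
      unfolding simple_data_lincomb[of \<alpha> n A, symmetric] using mem by auto
    fix a x assume "a \<in> \<alpha> ` {1..n}" and x: "x \<in> ?C"
    then obtain u c where uc: "(u, c) \<in> set ?S" "a = lincomb \<alpha> u"
      unfolding simple_data_lincomb[of \<alpha> n A, symmetric] by auto
    have a0: "a \<noteq> 0" using root_nonzero[OF R uR[OF uc(1)]] uc(2) by simp
    have *: "reflection a (lincomb \<alpha> v) \<in> ?C" if v: "v \<in> set L" for v
    proof -
      consider "dot v c = 0" | "v = u" | "map2 (\<lambda>a b. a - dot v c * b) v u \<in> set L"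
        using closed[OF v uc(1)] by blast
      then show ?thesis
      proof cases
        case 1
        have "length u = n" using len mem uc(1) by blast
        then have "map2 (\<lambda>a b. a - dot v c * b) v u = v" using 1 len[OF v] by (intro nth_equalityI) auto
        then show ?thesis using refl[OF v uc(1)] v uc(2) by simp
      next
        case 2
        then show ?thesis using reflection_self[OF a0] v uc(2) by auto
      next
        case 3
        then show ?thesis using refl[OF v uc(1)] uc(2) by simp
      qed
    qed
    from x obtain v where v: "v \<in> set L" "x = lincomb \<alpha> v \<or> x = - lincomb \<alpha> v" by blast
    have neg: "- y \<in> ?C" if "y \<in> ?C" for y using that by auto
    show "reflection a x \<in> ?C" using v(2) *[OF v(1)] neg[OF *[OF v(1)]] by (auto simp: reflection_minus)
  qed
  moreover have "lincomb \<alpha> v \<in> R" if "v \<in> set L" for v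
    using that
  proof (induction "nat (sum_list v)" arbitrary: v rule: less_induct)
    case less
    obtain u c where uc: "(u, c) \<in> set ?S" "v = u \<or> 0 < dot v c" using down[OF less.prems] by blast
    show ?case
    proof (cases "v = u")
      case True
      then show ?thesis using uR uc(1) by simp
    next
      case False
      then have pos: "0 < dot v c" using uc(2) by blast
      let ?w = "map2 (\<lambda>a b. a - dot v c * b) v u"
      have w: "?w \<in> set L" using closed[OF less.prems uc(1)] pos False by auto
      obtain j where j: "j < n" and u: "u = map (\<lambda>i. if i = j then 1 else 0) [0..<n]"
        using uc(1) unfolding simple_data_def by auto
      have "sum_list ?w = (\<Sum>i<n. v ! i - dot v c * (if i = j then 1 else 0))"
        by (simp add: sum_list_sum_nth len[OF less.prems] u atLeast0LessThan)
      also have "\<dots> = sum_list v - dot v c"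
        using j by (simp add: sum_list_sum_nth len[OF less.prems] atLeast0LessThan sum_subtractf sum_distrib_left[symmetric])
      finally have "sum_list ?w < sum_list v" using pos by simp
      moreover have "0 \<le> sum_list ?w" by (rule sum_list_nonneg) (use nonneg[OF w] in blast)
      ultimately have "lincomb \<alpha> ?w \<in> R" using less.hyps[OF _ w] by linarith
      then have "reflection (lincomb \<alpha> u) (lincomb \<alpha> ?w) \<in> R"
        using reflection_in_roots[OF R uR[OF uc(1)]] by blast
      then show ?thesis
        using refl[OF less.prems uc(1)] reflection_reflection root_nonzero[OF R uR[OF uc(1)]] by metis
    qed
  qed
  ultimately show ?thesis using uminus_in_roots[OF R] by blast
qed

text \<open>The coordinates are values of linear functionals because the base is linearly independent.\<close>

lemma simple_coordinates:
  fixes \<alpha> :: "nat \<Rightarrow> 'a::euclidean_space"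
  assumes inj: "inj_on \<alpha> {1..n}" and ind: "independent (\<alpha> ` {1..n})" and j: "j < n"
  obtains g :: "'a \<Rightarrow> real" where "linear g" "\<And>v. length v = n \<Longrightarrow> g (lincomb \<alpha> v) = of_int (v ! j)"
proof -
  obtain g where g: "linear g" "\<forall>x\<in>\<alpha> ` {1..n}. g x = (if x = \<alpha> (Suc j) then 1 else 0 :: real)"
    using linear_independent_extend[OF ind, of "\<lambda>x. if x = \<alpha> (Suc j) then 1 else 0 :: real"]
    by (elim exE conjE)
  have ga: "g (\<alpha> (Suc i)) = (if i = j then 1 else 0)" if "i < n" for i
  proof -
    have "\<alpha> (Suc i) = \<alpha> (Suc j) \<longleftrightarrow> i = j" using inj_on_eq_iff[OF inj, of "Suc i" "Suc j"] that j by simp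
    then show ?thesis using g(2)[rule_format, of "\<alpha> (Suc i)"] that by simp
  qed
  have "g (lincomb \<alpha> v) = of_int (v ! j)" if v: "length v = n" for v
  proof -
    have "g (lincomb \<alpha> v) = (\<Sum>i<n. of_int (v ! i) * g (\<alpha> (Suc i)))"
      by (simp add: lincomb_def v linear_sum[OF g(1)] linear_cmul[OF g(1)])
    also have "\<dots> = (\<Sum>i<n. if i = j then of_int (v ! i) else 0)"
      by (rule sum.cong) (auto simp: ga)
    finally show ?thesis using j by simp
  qed
  with g(1) show thesis by (rule that)
qed

lemma lincomb_inj:
  fixes \<alpha> :: "nat \<Rightarrow> 'a::euclidean_space"
  assumes inj: "inj_on \<alpha> {1..n}" and ind: "independent (\<alpha> ` {1..n})"
    and v: "length v = n" "\<forall>a\<in>set v. 0 \<le> a" and w: "length w = n" "\<forall>a\<in>set w. 0 \<le> a"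
    and eq: "lincomb \<alpha> v = lincomb \<alpha> w \<or> lincomb \<alpha> v = - lincomb \<alpha> w"
  shows "v = w"
proof (rule nth_equalityI)
  fix j assume "j < length v"
  then have j: "j < n" using v(1) by simp
  obtain g :: "'a \<Rightarrow> real" where g: "linear g" "\<And>v. length v = n \<Longrightarrow> g (lincomb \<alpha> v) = of_int (v ! j)"
    using simple_coordinates[OF inj ind j] by blast
  have "real_of_int (v ! j) = of_int (w ! j) \<or> real_of_int (v ! j) = - of_int (w ! j)"
    using eq g(2)[OF v(1)] g(2)[OF w(1)] linear_neg[OF g(1)] by metis
  moreover have "0 \<le> v ! j" "0 \<le> w ! j" using v w j by auto
  ultimately show "v ! j = w ! j" by linarith
qed (use v w in simp)

text \<open>The omitted, the plus and the minus roots are listed separately, so that balancedness is an equality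
  of two coordinate vectors.\<close>

theorem root_list_minimal:
  fixes R P :: "'a::euclidean_space set"
  assumes R: "root_system R" and P: "positive_roots R P"
    and inj: "inj_on \<alpha> {1..n}" and base: "root_base R (\<alpha> ` {1..n})"
    and cart: "\<And>i j. i \<in> {1..n} \<Longrightarrow> j \<in> {1..n} \<Longrightarrow> cartan_number (\<alpha> i) (\<alpha> j) = of_int (A i j)"
    and L: "root_list (simple_data n A) (removed @ positives @ negatives)"
    and distinct: "distinct (removed @ positives @ negatives)"
    and null: "vector_sum n positives = vector_sum n negatives"
    and so: "strongly_orthogonal R (lincomb \<alpha> ` set removed)"
    and lower: "\<And>J. J \<subseteq> set (removed @ positives @ negatives) \<Longrightarrow> signed_null J (lincomb \<alpha>) \<Longrightarrow>
      length removed \<le> card (set (removed @ positives @ negatives) - J)"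
  shows "minimal_cocardinality P balanced (length removed) \<and>
    minimal_cocardinality P (well_balanced R P) (length removed)"
proof -
  let ?I = "set (removed @ positives @ negatives)"
  have len: "length v = n" and nonneg: "\<forall>a\<in>set v. 0 \<le> a" if "v \<in> ?I" for v
    using L that unfolding root_list_def list_all_iff by (auto simp: simple_data_def)
  have ind: "independent (\<alpha> ` {1..n})" using base unfolding root_base_def by blast
  show ?thesis
  proof (rule minimal_cocardinality_indexed[OF R P root_list_roots[OF R base cart L]])
    show "v = w" if "v \<in> ?I" "w \<in> ?I" "lincomb \<alpha> v = lincomb \<alpha> w \<or> lincomb \<alpha> v = - lincomb \<alpha> w" for v w
      using lincomb_inj[OF inj ind] len nonneg that by blast
    show "set removed \<subseteq> ?I" by simp
    have "lincomb \<alpha> (vector_sum n positives) = sum (lincomb \<alpha>) (set positives)"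
      using len distinct by (subst lincomb_vector_sum) (auto simp: sum_list_distinct_conv_sum_set)
    moreover have "lincomb \<alpha> (vector_sum n negatives) = sum (lincomb \<alpha>) (set negatives)"
      using len distinct by (subst lincomb_vector_sum) (auto simp: sum_list_distinct_conv_sum_set)
    ultimately have "signed_null (set positives \<union> set negatives) (lincomb \<alpha>)"
      using null distinct by (intro signed_null_eq_sums) auto
    moreover have "?I - set removed = set positives \<union> set negatives" using distinct by auto
    ultimately show "signed_null (?I - set removed) (lincomb \<alpha>)" by simp
    show "card (set removed) = length removed" using distinct by (simp add: distinct_card)
  qed (use so lower in auto)
qed

lemma simply_laced_norm:
  assumes R: "root_system R" and base: "root_base R \<Delta>" and N: "\<And>\<alpha>. \<alpha> \<in> \<Delta> \<Longrightarrow> \<alpha> \<bullet> \<alpha> = N" and x: "x \<in> R"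
  shows "x \<bullet> x = N"
proof -
  have "R \<subseteq> {x. x \<bullet> x = N}"
    by (rule roots_subset_reflection_closed[OF R base]) (auto simp: N inner_reflection_self)
  then show ?thesis using x by blast
qed

definition parities :: "int list \<Rightarrow> bool list" where
  "parities v = map (\<lambda>a. a mod 2 = 1) v"

text \<open>No sum of at most two roots has the parities \<open>t\<close> of the sum of all roots in \<open>L\<close>. With the zero vector
  adjoined to \<open>L\<close>, sums of at most two roots are sums of exactly two list elements, and
  modulo 2 the second summand is determined by the first.\<close>

definition two_roots_miss :: "nat \<Rightarrow> int list list \<Rightarrow> bool" where
  "two_roots_miss n L \<longleftrightarrow> (let t = parities (vector_sum n L); Q = map parities (replicate n 0 # L)
     in list_all (\<lambda>q. map2 (\<noteq>) q t \<notin> set Q) Q)"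

text \<open>For a balanced subset, the omitted roots have the same sum modulo 2 as all roots, coordinate by
  coordinate.\<close>

lemma two_roots_miss_lower:
  fixes \<alpha> :: "nat \<Rightarrow> 'a::euclidean_space"
  assumes inj: "inj_on \<alpha> {1..n}" and ind: "independent (\<alpha> ` {1..n})"
    and len: "\<forall>v\<in>set L. length v = n" and distinct: "distinct L"
    and miss: "two_roots_miss n L" and J: "J \<subseteq> set L" "signed_null J (lincomb \<alpha>)"
  shows "3 \<le> card (set L - J)"
proof (rule ccontr)
  let ?K = "set L - J" and ?z = "replicate n (0::int)"
  assume "\<not> 3 \<le> card ?K"
  then have "card ?K = 0 \<or> card ?K = 1 \<or> card ?K = 2" by linarith
  then have "?K = {} \<or> (\<exists>x. ?K = {x}) \<or> (\<exists>x y. ?K = {x, y} \<and> x \<noteq> y)"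
    by (auto simp: card_1_singleton_iff card_2_iff)
  then obtain x y where xy: "x \<in> insert ?z (set L)" "y \<in> insert ?z (set L)"
    and sum: "\<And>j. j < n \<Longrightarrow> (\<Sum>v\<in>?K. v ! j) = x ! j + y ! j"
  proof (elim disjE exE conjE)
    assume K: "?K = {}"
    show thesis by (rule that[of ?z ?z]) (unfold K, simp_all)
  next
    fix x assume "?K = {x}"
    moreover have "x \<in> set L" using calculation by blast
    ultimately show thesis by (intro that[of x ?z]) auto
  next
    fix x y assume "?K = {x, y}" "x \<noteq> y"
    moreover have "x \<in> set L" "y \<in> set L" using calculation by blast+
    ultimately show thesis by (intro that[of x y]) auto
  qed
  have lxy: "length x = n" "length y = n" "length (vector_sum n L) = n"
    using xy len length_vector_sum[OF len] by auto
  have "parities y = map2 (\<noteq>) (parities x) (parities (vector_sum n L))"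
  proof (rule nth_equalityI)
    fix j assume "j < length (parities y)"
    then have j: "j < n" by (simp add: parities_def lxy)
    obtain g :: "'a \<Rightarrow> real" where g: "linear g" "\<And>v. length v = n \<Longrightarrow> g (lincomb \<alpha> v) = of_int (v ! j)"
      using simple_coordinates[OF inj ind j] by blast
    have "even (\<Sum>v\<in>?K. v ! j) \<longleftrightarrow> even (\<Sum>v\<in>set L. v ! j)"
      by (rule signed_null_parity_complement[OF J(2) _ J(1) g(1)]) (use g(2) len in auto)
    also have "(\<Sum>v\<in>set L. v ! j) = vector_sum n L ! j"
      using vector_sum_nth[OF len j] distinct by (simp add: sum_list_distinct_conv_sum_set)
    finally have "even (x ! j + y ! j) \<longleftrightarrow> even (vector_sum n L ! j)" using sum[OF j] by simp
    then show "parities y ! j = map2 (\<noteq>) (parities x) (parities (vector_sum n L)) ! j"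
      using j by (simp add: parities_def lxy) presburger
  qed (simp add: parities_def lxy)
  moreover have "map2 (\<noteq>) (parities x) (parities (vector_sum n L)) \<notin> parities ` insert ?z (set L)"
    using miss xy(1) unfolding two_roots_miss_def Let_def list_all_iff by auto
  ultimately show False using imageI[OF xy(2), of parities] by metis
qed

section \<open>The exceptional types\<close>

lemma E_edges_iff:
  "{i, j} \<in> E_edges n \<longleftrightarrow> (i = 1 \<and> j = 3) \<or> (i = 3 \<and> j = 1) \<or> (i = 2 \<and> j = 4) \<or> (i = 4 \<and> j = 2)
     \<or> (j = Suc i \<and> 3 \<le> i \<and> i < n) \<or> (i = Suc j \<and> 3 \<le> j \<and> j < n)"
  unfolding E_edges_def Un_iff path_edges_iff by (auto simp: doubleton_eq_iff)

text \<open>Simple roots are numbered as in the Dynkin diagrams. For each type the positive roots are divided into those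
  taken with sign \<open>+\<close> (the list \<open>positive\<close>) and those taken with sign \<open>-\<close> (the list \<open>negative\<close>); the division
  is one of many with equal sums.\<close>

definition G2_simple :: "(int list \<times> int list) list" where
  "G2_simple = [
    ([1,0], [2,-3]),
    ([0,1], [-1,2])]"

definition G2_positive :: "int list list" where
  "G2_positive = [
    [0,1], [2,1], [3,1]]"

definition G2_negative :: "int list list" where
  "G2_negative = [
    [1,0], [1,1], [3,2]]"

lemma G2_simple_data: "simple_data 2 (cartan_matrix TypeG2) = G2_simple"
proof -
  have "[0..<2] = [0, 1]" by code_simp
  then show ?thesis
    by (simp add: simple_data_def G2_simple_def edges_cartan_def path_edges_iff)
qed

lemma G2_root_list: "root_list G2_simple ([] @ G2_positive @ G2_negative)"
  by code_simp

lemma G2_distinct: "distinct ([] @ G2_positive @ G2_negative)"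
  by code_simp

lemma G2_vector_sum: "vector_sum 2 G2_positive = vector_sum 2 G2_negative"
  by code_simp

definition F4_simple :: "(int list \<times> int list) list" where
  "F4_simple = [
    ([1,0,0,0], [2,-1,0,0]),
    ([0,1,0,0], [-1,2,-1,0]),
    ([0,0,1,0], [0,-2,2,-1]),
    ([0,0,0,1], [0,0,-1,2])]"

definition F4_positive :: "int list list" where
  "F4_positive = [
    [0,0,0,1], [0,0,1,1], [0,1,1,0], [1,1,0,0], [0,1,2,0], [1,1,1,0], [0,1,2,1], [1,2,2,0],
    [1,1,2,2], [1,2,2,2], [1,2,4,2], [2,3,4,2]]"

definition F4_negative :: "int list list" where
  "F4_negative = [
    [0,0,1,0], [0,1,0,0], [1,0,0,0], [0,1,1,1], [1,1,1,1], [1,1,2,0], [0,1,2,2], [1,1,2,1],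
    [1,2,2,1], [1,2,3,1], [1,2,3,2], [1,3,4,2]]"

lemma F4_simple_data: "simple_data 4 (cartan_matrix TypeF4) = F4_simple"
proof -
  have "[0..<4] = [0, 1, 2, 3]" by code_simp
  then show ?thesis
    by (simp add: simple_data_def F4_simple_def edges_cartan_def path_edges_iff)
qed

lemma F4_root_list: "root_list F4_simple ([] @ F4_positive @ F4_negative)"
  by code_simp

lemma F4_distinct: "distinct ([] @ F4_positive @ F4_negative)"
  by code_simp

lemma F4_vector_sum: "vector_sum 4 F4_positive = vector_sum 4 F4_negative"
  by code_simp

definition E6_simple :: "(int list \<times> int list) list" where
  "E6_simple = [
    ([1,0,0,0,0,0], [2,0,-1,0,0,0]),
    ([0,1,0,0,0,0], [0,2,0,-1,0,0]),
    ([0,0,1,0,0,0], [-1,0,2,-1,0,0]),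
    ([0,0,0,1,0,0], [0,-1,-1,2,-1,0]),
    ([0,0,0,0,1,0], [0,0,0,-1,2,-1]),
    ([0,0,0,0,0,1], [0,0,0,0,-1,2])]"

definition E6_positive :: "int list list" where
  "E6_positive = [
    [0,0,0,0,0,1], [0,0,0,0,1,0], [0,1,0,1,0,0], [1,0,1,0,0,0], [0,0,0,1,1,1], [0,0,1,1,1,0],
    [0,1,1,1,0,0], [1,0,1,1,0,0], [0,0,1,1,1,1], [0,1,0,1,1,1], [1,0,1,1,1,0], [1,1,1,1,0,0],
    [0,1,1,2,1,0], [1,1,1,1,1,1], [1,1,1,2,1,0], [0,1,1,2,2,1], [1,1,2,2,2,1], [1,2,2,3,2,1]]"

definition E6_negative :: "int list list" where
  "E6_negative = [
    [0,0,0,1,0,0], [0,0,1,0,0,0], [0,1,0,0,0,0], [1,0,0,0,0,0], [0,0,0,0,1,1], [0,0,0,1,1,0],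
    [0,0,1,1,0,0], [0,1,0,1,1,0], [0,1,1,1,1,0], [0,1,1,1,1,1], [1,0,1,1,1,1], [1,1,1,1,1,0],
    [0,1,1,2,1,1], [1,1,1,2,1,1], [1,1,2,2,1,0], [1,1,1,2,2,1], [1,1,2,2,1,1], [1,1,2,3,2,1]]"

lemma E6_simple_data: "simple_data 6 (cartan_matrix TypeE6) = E6_simple"
proof -
  have "[0..<6] = [0, 1, 2, 3, 4, 5]" by code_simp
  then show ?thesis
    by (simp add: simple_data_def E6_simple_def edges_cartan_def E_edges_iff)
qed

lemma E6_root_list: "root_list E6_simple ([] @ E6_positive @ E6_negative)"
  by code_simp

lemma E6_distinct: "distinct ([] @ E6_positive @ E6_negative)"
  by code_simp

lemma E6_vector_sum: "vector_sum 6 E6_positive = vector_sum 6 E6_negative"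
  by code_simp

definition E7_simple :: "(int list \<times> int list) list" where
  "E7_simple = [
    ([1,0,0,0,0,0,0], [2,0,-1,0,0,0,0]),
    ([0,1,0,0,0,0,0], [0,2,0,-1,0,0,0]),
    ([0,0,1,0,0,0,0], [-1,0,2,-1,0,0,0]),
    ([0,0,0,1,0,0,0], [0,-1,-1,2,-1,0,0]),
    ([0,0,0,0,1,0,0], [0,0,0,-1,2,-1,0]),
    ([0,0,0,0,0,1,0], [0,0,0,0,-1,2,-1]),
    ([0,0,0,0,0,0,1], [0,0,0,0,0,-1,2])]"

definition E7_positive :: "int list list" where
  "E7_positive = [
    [0,0,0,1,0,0,0], [0,0,0,0,0,1,1], [0,0,0,0,1,1,0], [0,0,0,1,1,0,0], [0,0,1,1,0,0,0],
    [0,0,1,1,1,0,0], [0,1,0,1,1,1,0], [1,0,1,1,1,0,0], [0,0,1,1,1,1,1], [0,1,1,1,1,1,0],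
    [1,0,1,1,1,1,0], [1,1,1,1,1,0,0], [0,1,1,1,1,1,1], [0,1,1,2,1,1,0], [1,1,1,2,1,0,0],
    [0,1,1,2,1,1,1], [0,1,1,2,2,1,0], [1,1,1,1,1,1,1], [1,1,2,2,1,0,0], [1,1,1,2,1,1,1],
    [1,1,1,2,2,1,0], [1,1,1,2,2,1,1], [1,1,2,2,1,1,1], [1,1,2,2,2,1,0], [1,1,1,2,2,2,1],
    [1,1,2,2,2,2,1], [1,2,2,3,2,1,0], [1,1,2,3,2,2,1], [1,2,2,3,2,1,1], [1,2,2,3,2,2,1]]"

definition E7_negative :: "int list list" where
  "E7_negative = [
    [0,0,0,0,0,1,0], [0,0,1,0,0,0,0], [1,0,0,0,0,0,0], [0,1,0,1,0,0,0], [1,0,1,0,0,0,0],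
    [0,0,0,0,1,1,1], [0,0,0,1,1,1,0], [0,1,0,1,1,0,0], [0,1,1,1,0,0,0], [1,0,1,1,0,0,0],
    [0,0,0,1,1,1,1], [0,0,1,1,1,1,0], [0,1,1,1,1,0,0], [1,1,1,1,0,0,0], [0,1,0,1,1,1,1],
    [0,1,1,2,1,0,0], [1,0,1,1,1,1,1], [1,1,1,1,1,1,0], [1,1,1,2,1,1,0], [0,1,1,2,2,1,1],
    [1,1,2,2,1,1,0], [0,1,1,2,2,2,1], [1,1,2,2,2,1,1], [1,1,2,3,2,1,0], [1,1,2,3,2,1,1],
    [1,1,2,3,3,2,1], [1,2,2,3,3,2,1], [1,2,2,4,3,2,1], [1,2,3,4,3,2,1], [2,2,3,4,3,2,1]]"

definition E7_removed :: "int list list" where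
  "E7_removed = [
    [0,0,0,0,0,0,1], [0,0,0,0,1,0,0], [0,1,0,0,0,0,0]]"

lemma E7_simple_data: "simple_data 7 (cartan_matrix TypeE7) = E7_simple"
proof -
  have "[0..<7] = [0, 1, 2, 3, 4, 5, 6]" by code_simp
  then show ?thesis
    by (simp add: simple_data_def E7_simple_def edges_cartan_def E_edges_iff)
qed

lemma E7_root_list: "root_list E7_simple (E7_removed @ E7_positive @ E7_negative)"
  by code_simp

lemma E7_distinct: "distinct (E7_removed @ E7_positive @ E7_negative)"
  by code_simp

lemma E7_vector_sum: "vector_sum 7 E7_positive = vector_sum 7 E7_negative"
  by code_simp

lemma E7_two_roots_miss: "two_roots_miss 7 (E7_removed @ E7_positive @ E7_negative)"
  by code_simp

definition E8_simple :: "(int list \<times> int list) list" where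
  "E8_simple = [
    ([1,0,0,0,0,0,0,0], [2,0,-1,0,0,0,0,0]),
    ([0,1,0,0,0,0,0,0], [0,2,0,-1,0,0,0,0]),
    ([0,0,1,0,0,0,0,0], [-1,0,2,-1,0,0,0,0]),
    ([0,0,0,1,0,0,0,0], [0,-1,-1,2,-1,0,0,0]),
    ([0,0,0,0,1,0,0,0], [0,0,0,-1,2,-1,0,0]),
    ([0,0,0,0,0,1,0,0], [0,0,0,0,-1,2,-1,0]),
    ([0,0,0,0,0,0,1,0], [0,0,0,0,0,-1,2,-1]),
    ([0,0,0,0,0,0,0,1], [0,0,0,0,0,0,-1,2])]"

definition E8_positive :: "int list list" where
  "E8_positive = [
    [0,0,0,0,0,0,0,1], [0,0,0,0,1,0,0,0], [0,0,0,1,0,0,0,0], [1,0,0,0,0,0,0,0],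
    [0,0,0,0,0,1,1,0], [0,0,0,0,1,1,0,0], [0,0,0,1,1,0,0,0], [0,0,1,1,0,0,0,0],
    [0,1,0,1,0,0,0,0], [0,0,0,0,0,1,1,1], [0,0,0,0,1,1,1,0], [0,0,1,1,1,0,0,0],
    [0,0,0,0,1,1,1,1], [0,0,0,1,1,1,1,0], [0,0,1,1,1,1,0,0], [0,1,0,1,1,1,0,0],
    [0,1,1,1,1,0,0,0], [1,1,1,1,0,0,0,0], [1,0,1,1,1,1,0,0], [1,1,1,1,1,0,0,0],
    [0,0,1,1,1,1,1,1], [0,1,1,1,1,1,1,0], [0,1,1,2,1,1,0,0], [1,1,1,1,1,1,0,0],
    [0,1,1,1,1,1,1,1], [1,0,1,1,1,1,1,1], [1,1,1,1,1,1,1,0], [1,1,1,2,1,1,0,0],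
    [1,1,2,2,1,0,0,0], [0,1,1,2,1,1,1,1], [0,1,1,2,2,1,1,0], [1,1,1,2,2,1,0,0],
    [1,1,2,2,1,1,0,0], [0,1,1,2,2,1,1,1], [0,1,1,2,2,2,1,0], [1,1,1,2,1,1,1,1],
    [1,1,1,2,2,1,1,0], [1,1,1,2,2,2,1,0], [1,1,2,3,2,1,0,0], [1,1,2,2,2,1,1,1],
    [1,1,2,2,2,2,1,0], [1,1,2,3,2,1,1,0], [1,1,1,2,2,2,2,1], [1,1,2,3,2,1,1,1],
    [1,1,2,3,2,2,1,0], [1,2,2,3,2,1,1,0], [1,1,2,2,2,2,2,1], [1,2,2,3,2,1,1,1],
    [1,2,2,3,2,2,1,1], [1,2,2,4,3,2,1,1], [1,2,3,4,3,2,1,0], [1,2,2,3,3,3,2,1],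
    [1,2,2,4,3,2,2,1], [1,2,3,4,3,2,1,1], [1,2,2,4,3,3,2,1], [1,2,3,4,3,2,2,1],
    [2,2,3,4,3,2,2,1], [1,2,3,4,4,3,2,1], [2,2,3,4,3,3,2,1], [1,2,3,5,4,3,2,1],
    [2,2,3,4,4,3,2,1], [2,3,3,5,4,3,2,1], [2,3,4,5,4,3,2,1], [2,3,4,6,5,4,3,1]]"

definition E8_negative :: "int list list" where
  "E8_negative = [
    [0,0,0,0,0,0,1,0], [0,0,0,0,0,1,0,0], [0,0,1,0,0,0,0,0], [0,1,0,0,0,0,0,0],
    [0,0,0,0,0,0,1,1], [1,0,1,0,0,0,0,0], [0,0,0,1,1,1,0,0], [0,1,0,1,1,0,0,0],
    [0,1,1,1,0,0,0,0], [1,0,1,1,0,0,0,0], [1,0,1,1,1,0,0,0], [0,0,0,1,1,1,1,1],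
    [0,0,1,1,1,1,1,0], [0,1,0,1,1,1,1,0], [0,1,1,1,1,1,0,0], [0,1,1,2,1,0,0,0],
    [0,1,0,1,1,1,1,1], [1,0,1,1,1,1,1,0], [1,1,1,2,1,0,0,0], [0,1,1,2,1,1,1,0],
    [0,1,1,2,2,1,0,0], [1,1,1,1,1,1,1,1], [1,1,1,2,1,1,1,0], [1,1,2,2,1,1,1,0],
    [1,1,2,2,2,1,0,0], [0,1,1,2,2,2,1,1], [1,1,1,2,2,1,1,1], [1,1,2,2,1,1,1,1],
    [1,1,2,2,2,1,1,0], [0,1,1,2,2,2,2,1], [1,1,1,2,2,2,1,1], [1,2,2,3,2,1,0,0],
    [1,1,2,2,2,2,1,1], [1,1,2,3,2,2,1,1], [1,1,2,3,3,2,1,0], [1,2,2,3,2,2,1,0],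
    [1,1,2,3,2,2,2,1], [1,1,2,3,3,2,1,1], [1,2,2,3,3,2,1,0], [1,1,2,3,3,2,2,1],
    [1,2,2,3,2,2,2,1], [1,2,2,3,3,2,1,1], [1,2,2,4,3,2,1,0], [1,1,2,3,3,3,2,1],
    [1,2,2,3,3,2,2,1], [2,2,3,4,3,2,1,0], [2,2,3,4,3,2,1,1], [1,2,2,4,4,3,2,1],
    [1,2,3,4,3,3,2,1], [1,3,3,5,4,3,2,1], [2,2,3,5,4,3,2,1], [2,2,4,5,4,3,2,1],
    [2,3,4,6,4,3,2,1], [2,3,4,6,5,3,2,1], [2,3,4,6,5,4,2,1], [2,3,4,6,5,4,3,2]]"

lemma E8_simple_data: "simple_data 8 (cartan_matrix TypeE8) = E8_simple"
proof -
  have "[0..<8] = [0, 1, 2, 3, 4, 5, 6, 7]" by code_simp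
  then show ?thesis
    by (simp add: simple_data_def E8_simple_def edges_cartan_def E_edges_iff)
qed

lemma E8_root_list: "root_list E8_simple ([] @ E8_positive @ E8_negative)"
  by code_simp

lemma E8_distinct: "distinct ([] @ E8_positive @ E8_negative)"
  by code_simp

lemma E8_vector_sum: "vector_sum 8 E8_positive = vector_sum 8 E8_negative"
  by code_simp

lemma exceptional_minimal:
  fixes R P :: "'a::euclidean_space set"
  assumes R: "root_system R" and P: "positive_roots R P"
    and inj: "inj_on \<alpha> {1..n}" and base: "root_base R (\<alpha> ` {1..n})"
    and cart: "\<And>i j. i \<in> {1..n} \<Longrightarrow> j \<in> {1..n} \<Longrightarrow> cartan_number (\<alpha> i) (\<alpha> j) = of_int (A i j)"
    and S: "simple_data n A = S" and L: "root_list S ([] @ positives @ negatives)"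
    and distinct: "distinct ([] @ positives @ negatives)"
    and null: "vector_sum n positives = vector_sum n negatives"
  shows "minimal_cocardinality P balanced 0 \<and> minimal_cocardinality P (well_balanced R P) 0"
proof -
  have "strongly_orthogonal R (lincomb \<alpha> ` set [])" by (simp add: strongly_orthogonal_def)
  from root_list_minimal[OF R P inj base cart L[folded S] distinct null this] show ?thesis by simp
qed

text \<open>Modulo 2 the sum of all positive roots is the sum \<open>r\<close> of the three mutually orthogonal simple roots at
  the vertices 2, 5 and 7, so these can be omitted. Fewer do not suffice, because \<open>r\<close> lies in
  the radical of the bilinear form modulo 2 while the quadratic form \<open>q\<close> modulo 2, with value 1 on
  every root, has \<open>q r = 1\<close>. So \<open>r\<close> is not zero; it is not a root, as no root lies in the radical; and
  for a root \<open>x\<close> the value \<open>q (x + r) = 1 + 1\<close> vanishes, so that \<open>x + r\<close> is not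
  congruent to a root either. The proof reads this off from the list of roots.\<close>

lemma E7_minimal:
  fixes R P :: "'a::euclidean_space set"
  assumes R: "root_system R" and P: "positive_roots R P"
    and inj: "inj_on \<alpha> {1..7}" and base: "root_base R (\<alpha> ` {1..7})"
    and cart: "\<And>i j. i \<in> {1..7} \<Longrightarrow> j \<in> {1..7} \<Longrightarrow> cartan_number (\<alpha> i) (\<alpha> j) = of_int (cartan_matrix TypeE7 i j)"
  shows "minimal_cocardinality P balanced 3 \<and> minimal_cocardinality P (well_balanced R P) 3"
proof -
  let ?L = "E7_removed @ E7_positive @ E7_negative"
  have \<alpha>R: "\<alpha> i \<in> R" if "i \<in> {1..7}" for i using base that unfolding root_base_def by blast
  have nz: "\<alpha> i \<noteq> 0" if "i \<in> {1..7}" for i using root_nonzero[OF R] \<alpha>R that by blast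
  have ind: "independent (\<alpha> ` {1..7})" using base unfolding root_base_def by blast
  have adjacent: "\<alpha> i \<bullet> \<alpha> i = \<alpha> j \<bullet> \<alpha> j" if "i \<in> {1..7}" "j \<in> {1..7}" "{i, j} \<in> E_edges 7" for i j
  proof (cases "i = j")
    case False
    have ji: "{j, i} \<in> E_edges 7" using that(3) by (simp add: insert_commute)
    have "\<alpha> i \<bullet> \<alpha> j = - (\<alpha> j \<bullet> \<alpha> j) / 2"
      using inner_from_cartan[OF nz[OF that(2)] cart[OF that(1,2)]] that(3) False by (simp add: edges_cartan_def)
    moreover have "\<alpha> j \<bullet> \<alpha> i = - (\<alpha> i \<bullet> \<alpha> i) / 2"
      using inner_from_cartan[OF nz[OF that(1)] cart[OF that(2,1)]] ji False by (simp add: edges_cartan_def)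
    ultimately show ?thesis by (simp add: inner_commute)
  qed simp
  have edges: "{1, 3} \<in> E_edges 7" "{2, 4} \<in> E_edges 7" "{3, 4} \<in> E_edges 7" "{4, 5} \<in> E_edges 7"
    "{5, 6} \<in> E_edges 7" "{6, 7} \<in> E_edges 7"
    by (simp_all add: E_edges_def path_edges_iff)
  have eqs: "\<alpha> 1 \<bullet> \<alpha> 1 = \<alpha> 3 \<bullet> \<alpha> 3" "\<alpha> 2 \<bullet> \<alpha> 2 = \<alpha> 4 \<bullet> \<alpha> 4" "\<alpha> 3 \<bullet> \<alpha> 3 = \<alpha> 4 \<bullet> \<alpha> 4"
    "\<alpha> 4 \<bullet> \<alpha> 4 = \<alpha> 5 \<bullet> \<alpha> 5" "\<alpha> 5 \<bullet> \<alpha> 5 = \<alpha> 6 \<bullet> \<alpha> 6" "\<alpha> 6 \<bullet> \<alpha> 6 = \<alpha> 7 \<bullet> \<alpha> 7"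
    by (rule adjacent; (rule edges | simp))+
  have "{1..7} = {1, 2, 3, 4, 5, 6, 7::nat}" by auto
  then have simple_norm: "\<alpha> i \<bullet> \<alpha> i = \<alpha> 1 \<bullet> \<alpha> 1" if "i \<in> {1..7}" for i
    using that eqs by auto
  have norm: "x \<bullet> x = \<alpha> 1 \<bullet> \<alpha> 1" if "x \<in> R" for x
    using simply_laced_norm[OF R base _ that] simple_norm by blast
  have removed: "lincomb \<alpha> ` set E7_removed = {\<alpha> 2, \<alpha> 5, \<alpha> 7}"
    by (auto simp: E7_removed_def lincomb_def lessThan_Suc numeral_eq_Suc)
  have orth: "\<alpha> i \<bullet> \<alpha> j = 0" if "i \<in> {2, 5, 7}" "j \<in> {2, 5, 7}" "i \<noteq> j" for i j
  proof -
    have ij: "i \<in> {1..7}" "j \<in> {1..7}" using that by auto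
    have "{i, j} \<notin> E_edges 7" using that by (auto simp: E_edges_iff)
    then show ?thesis
      using inner_from_cartan[OF nz[OF ij(2)] cart[OF ij]] that(3) by (simp add: edges_cartan_def)
  qed
  have so: "strongly_orthogonal R (lincomb \<alpha> ` set E7_removed)"
    unfolding removed
  proof (rule strongly_orthogonal_if_orthogonal[OF R])
    show sub: "{\<alpha> 2, \<alpha> 5, \<alpha> 7} \<subseteq> R" using \<alpha>R by simp
    fix x y assume xy: "x \<in> {\<alpha> 2, \<alpha> 5, \<alpha> 7}" "y \<in> {\<alpha> 2, \<alpha> 5, \<alpha> 7}" "x \<noteq> y"
    have "\<alpha> 2 \<bullet> \<alpha> 5 = 0" "\<alpha> 2 \<bullet> \<alpha> 7 = 0" "\<alpha> 5 \<bullet> \<alpha> 7 = 0"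
      by (simp_all add: orth)
    then show "x \<bullet> y = 0" using xy by (elim insertE emptyE) (simp_all add: inner_commute)
    show "z \<bullet> z < x \<bullet> x + y \<bullet> y" if "z \<in> R" for z
      using norm[OF that] norm[OF subsetD[OF sub xy(1)]] norm[OF subsetD[OF sub xy(2)]] nz[of 1] by simp
  qed
  have len: "\<forall>v\<in>set ?L. length v = 7"
    using E7_root_list unfolding root_list_def list_all_iff by (auto simp: E7_simple_def)
  have "length E7_removed = 3" by (simp add: E7_removed_def)
  moreover have "3 \<le> card (set ?L - J)" if "J \<subseteq> set ?L" "signed_null J (lincomb \<alpha>)" for J
    by (rule two_roots_miss_lower[OF inj ind len E7_distinct E7_two_roots_miss that])
  ultimately show ?thesis
    using root_list_minimal[OF R P inj base cart E7_root_list[folded E7_simple_data] E7_distinct E7_vector_sum so]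
    by metis
qed

section \<open>The minimal cocardinality for each Dynkin type\<close>

fun minimal_cocard :: "dynkin_type \<Rightarrow> nat" where
  "minimal_cocard (TypeA n) = (if even n then 0 else Suc n div 2)"
| "minimal_cocard (TypeB n) = Suc n div 2"
| "minimal_cocard (TypeC n) = (if n mod 4 = 0 \<or> n mod 4 = 3 then 0 else 1)"
| "minimal_cocard (TypeD n) = (if n mod 4 = 0 \<or> n mod 4 = 1 then 0 else 2)"
| "minimal_cocard TypeE7 = 3"
| "minimal_cocard _ = 0"

lemma minimal_cocardinality_dynkin_type:
  fixes R P :: "'a::euclidean_space set"
  assumes R: "root_system R" and X: "has_dynkin_type R X" and P: "positive_roots R P"
  shows "minimal_cocardinality P balanced (minimal_cocard X) \<and>
    minimal_cocardinality P (well_balanced R P) (minimal_cocard X)"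
proof -
  obtain \<alpha> where adm: "admissible_type X" and inj: "inj_on \<alpha> {1..dynkin_rank X}"
    and base: "root_base R (\<alpha> ` {1..dynkin_rank X})"
    and cart: "\<And>i j. i \<in> {1..dynkin_rank X} \<Longrightarrow> j \<in> {1..dynkin_rank X} \<Longrightarrow>
      cartan_number (\<alpha> i) (\<alpha> j) = of_int (cartan_matrix X i j)"
    using X unfolding has_dynkin_type_def by blast
  show ?thesis
  proof (cases X)
    case (TypeA n)
    obtain N e where "frame (Suc n) N e"
      "R = grid_root 1 e ` upper (Suc n) \<union> uminus ` grid_root 1 e ` upper (Suc n)"
      by (rule type_A_roots[OF R, of \<alpha> n]) (use adm base cart TypeA in auto)
    from type_A_minimal[OF R P this refl] show ?thesis by (simp only: TypeA minimal_cocard.simps)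
  next
    case (TypeB n)
    obtain N e where "orthogonal_frame n N e" "R = grid_root 1 e ` grid n \<union> uminus ` grid_root 1 e ` grid n"
      by (rule type_B_roots[OF R, of \<alpha> n]) (use adm base cart TypeB in auto)
    from type_B_minimal[OF R P this refl] show ?thesis by (simp only: TypeB minimal_cocard.simps)
  next
    case (TypeC n)
    obtain N e where "orthogonal_frame n N e" "R = grid_root 2 e ` grid n \<union> uminus ` grid_root 2 e ` grid n"
      by (rule type_C_roots[OF R, of \<alpha> n]) (use adm base cart TypeC in auto)
    from type_C_minimal[OF R P _ this refl] show ?thesis using adm by (simp only: TypeC minimal_cocard.simps) simp
  next
    case (TypeD n)
    obtain N e where "orthogonal_frame n N e" "R = pair_roots n e"
      by (rule type_D_roots[OF R, of \<alpha> n]) (use adm base cart TypeD in auto)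
    from type_D_minimal[OF R P _ this refl] show ?thesis using adm by (simp only: TypeD minimal_cocard.simps) simp
  next
    case TypeE6
    then have "simple_data (dynkin_rank X) (cartan_matrix X) = E6_simple"
      "vector_sum (dynkin_rank X) E6_positive = vector_sum (dynkin_rank X) E6_negative"
      by (simp_all only: dynkin_rank.simps E6_simple_data E6_vector_sum)
    from exceptional_minimal[OF R P inj base cart this(1) E6_root_list E6_distinct this(2)]
    show ?thesis by (simp add: TypeE6)
  next
    case TypeE7
    then show ?thesis using E7_minimal[OF R P, of \<alpha>] inj base cart by simp
  next
    case TypeE8
    then have "simple_data (dynkin_rank X) (cartan_matrix X) = E8_simple"
      "vector_sum (dynkin_rank X) E8_positive = vector_sum (dynkin_rank X) E8_negative"
      by (simp_all only: dynkin_rank.simps E8_simple_data E8_vector_sum)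
    from exceptional_minimal[OF R P inj base cart this(1) E8_root_list E8_distinct this(2)]
    show ?thesis by (simp add: TypeE8)
  next
    case TypeF4
    then have "simple_data (dynkin_rank X) (cartan_matrix X) = F4_simple"
      "vector_sum (dynkin_rank X) F4_positive = vector_sum (dynkin_rank X) F4_negative"
      by (simp_all only: dynkin_rank.simps F4_simple_data F4_vector_sum)
    from exceptional_minimal[OF R P inj base cart this(1) F4_root_list F4_distinct this(2)]
    show ?thesis by (simp add: TypeF4)
  next
    case TypeG2
    then have "simple_data (dynkin_rank X) (cartan_matrix X) = G2_simple"
      "vector_sum (dynkin_rank X) G2_positive = vector_sum (dynkin_rank X) G2_negative"
      by (simp_all only: dynkin_rank.simps G2_simple_data G2_vector_sum)
    from exceptional_minimal[OF R P inj base cart this(1) G2_root_list G2_distinct this(2)]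
    show ?thesis by (simp add: TypeG2)
  qed
qed

theorem theorem3p2:
  fixes R P :: "'a::euclidean_space set" and n :: nat and X :: dynkin_type
  assumes "simple_root_system R"
    and "dim R = n"
    and "has_dynkin_type R X"
    and "positive_roots R P"
  shows "\<exists>m. minimal_cocardinality P balanced m \<and>
             minimal_cocardinality P (well_balanced R P) m \<and>
             (X = TypeA n \<longrightarrow>
               (\<forall>k. (n = 4 * k \<longrightarrow> m = 0) \<and> (n = 4 * k + 1 \<longrightarrow> m = 2 * k + 1) \<and>
                    (n = 4 * k + 2 \<longrightarrow> m = 0) \<and> (n = 4 * k + 3 \<longrightarrow> m = 2 * k + 2))) \<and>
             (X = TypeB n \<longrightarrow>
               (\<forall>k. (n = 4 * k \<longrightarrow> m = 2 * k) \<and> (n = 4 * k + 1 \<longrightarrow> m = 2 * k + 1) \<and>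
                    (n = 4 * k + 2 \<longrightarrow> m = 2 * k + 1) \<and> (n = 4 * k + 3 \<longrightarrow> m = 2 * k + 2))) \<and>
             (X = TypeC n \<longrightarrow>
               (\<forall>k. (n = 4 * k \<longrightarrow> m = 0) \<and> (n = 4 * k + 1 \<longrightarrow> m = 1) \<and>
                    (n = 4 * k + 2 \<longrightarrow> m = 1) \<and> (n = 4 * k + 3 \<longrightarrow> m = 0))) \<and>
             (X = TypeD n \<longrightarrow>
               (\<forall>k. (n = 4 * k \<longrightarrow> m = 0) \<and> (n = 4 * k + 1 \<longrightarrow> m = 0) \<and>
                    (n = 4 * k + 2 \<longrightarrow> m = 2) \<and> (n = 4 * k + 3 \<longrightarrow> m = 2))) \<and>
             (X = TypeE6 \<longrightarrow> m = 0) \<and> (X = TypeE7 \<longrightarrow> m = 3) \<and> (X = TypeE8 \<longrightarrow> m = 0) \<and>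
             (X = TypeF4 \<longrightarrow> m = 0) \<and> (X = TypeG2 \<longrightarrow> m = 0)"
proof (intro exI conjI)
  have "root_system R" using assms(1) unfolding simple_root_system_def by blast
  from minimal_cocardinality_dynkin_type[OF this assms(3,4)]
  show "minimal_cocardinality P balanced (minimal_cocard X)"
    "minimal_cocardinality P (well_balanced R P) (minimal_cocard X)" by blast+
qed (auto simp: mod_Suc)

end
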